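(* Let $H:\mathbb{R}^d\times\mathscr{P}_2(\mathbb{R}^d)\times\mathbb{R}^d\to\mathbb{R}$ be fully $C^2$ and satisfy Assumption (H) of the context, let $\alpha\in\mathbb{R}$, and let $H_\alpha(x,\mu,p):=H(x,\mu,p-\alpha x)$. Then $H_\alpha$ is displacement monotone if and only if $$\int_{\mathbb{R}^d}\Big[\big(\partial_{xx}H(x,\mu,p(x))-2\alpha\,\partial_{xp}H(x,\mu,p(x))\big)v(x)\Big]\cdot v(x)\,d\mu(x)$$ $$+\int_{\mathbb{R}^d\times\mathbb{R}^d}\Big[\big(\partial_{x\mu}H(x,\mu,\tilde x,p(x))-2\alpha\,\partial_{p\mu}H(x,\mu,\tilde x,p(x))\big)v(\tilde x)\Big]\cdot v(x)\,d\mu(x)\,d\mu(\tilde x)$$ $$+\frac14\int_{\mathbb{R}^d}\left|[\partial_{pp}H(x,\mu,p(x))]^{-\frac12}\left[\int_{\mathbb{R}^d}\partial_{p\mu}H(x,\mu,\tilde x,p(x))v(\tilde x)\,d\mu(\tilde x)+2\alpha\,\partial_{pp}H(x,\mu,p(x))v(x)\right]\right|^2d\mu(x)\ \le\ 0$$ for all $\mu\in\mathscr{P}_2(\mathbb{R}^d)$, all $p\in C(\mathbb{R}^d;\mathbb{R}^d)$ and all $v\in L^2_\mu(\mathbb{R}^d;\mathbb{R}^d)$.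
   Context: $\mathscr{P}_2(\mathbb{R}^d)$ is the set of Borel probability measures on $\mathbb{R}^d$ with finite second moment, with the 2-Wasserstein metric $W_2$; continuity in the measure variable is with respect to $W_2$; $\Pi(\mu,\nu)$ is the set of couplings of $\mu$ and $\nu$. Derivatives in the measure: for $U:\mathscr{P}_2(\mathbb{R}^d)\to\mathbb{R}$, $\partial_\mu U(\mu,\tilde x)\in\mathbb{R}^d$ denotes the Wasserstein gradient (Lions derivative), i.e. the lift $\xi\mapsto U(\mathrm{Law}(\xi))$ on $L^2(\Omega;\mathbb{R}^d)$ is Fréchet differentiable with gradient $\partial_\mu U(\mathrm{Law}(\xi),\xi)$. $\partial_{x\mu}H(x,\mu,\tilde x,p)$ and $\partial_{p\mu}H(x,\mu,\tilde x,p)$ are the $d\times d$ matrices of mixed derivatives (row index $x$, respectively $p$; column index the component of $\partial_\mu$). A function is fully $C^k$ if all its derivatives up to order $k$ in the Euclidean variables, in the measure and in the extra variables exist and have jointly continuous versions. Assumption (H): $H$ is fully $C^2$ and there are $c_0,L^H>0$ such that: $\partial_{pp}H$ is uniformly continuous and $\partial_{pp}H(x,\mu,p)\ge c_0^{-1}I$ for all $(x,\mu,p)$; $\partial_{xp}H,\partial_{pp}H,\partial_{xx}H$ are continuous and uniformly bounded by $L^H$; $\partial_{p\mu}H,\partial_{x\mu}H$ are uniformly continuous and uniformly bounded by $L^H$ on $\mathbb{R}^d\times\mathscr{P}_2(\mathbb{R}^d)\times\mathbb{R}^d\times\mathbb{R}^d$; and $\partial_pH(x,\mu,p)\cdot p-H(x,\mu,p)\ge-L^H$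 for all $(x,\mu,p)$. Displacement monotonicity of a Hamiltonian: a function $K:\mathbb{R}^d\times\mathscr{P}_2(\mathbb{R}^d)\times\mathbb{R}^d\to\mathbb{R}$ with $K(\cdot,\mu,\cdot)\in C^1(\mathbb{R}^d\times\mathbb{R}^d)$ for all $\mu$ is displacement monotone if $$-\int_{\mathbb{R}^d\times\mathbb{R}^d}[\partial_xK(x,\mu,p^1(x))-\partial_xK(y,\nu,p^2(y))]\cdot(x-y)\,d\gamma(x,y)+\int_{\mathbb{R}^d\times\mathbb{R}^d}[\partial_pK(x,\mu,p^1(x))-\partial_pK(y,\nu,p^2(y))]\cdot(p^1(x)-p^2(y))\,d\gamma(x,y)\ge0$$ for all $\mu,\nu\in\mathscr{P}_2(\mathbb{R}^d)$, all $\gamma\in\Pi(\mu,\nu)$ and all $p^1,p^2\in C_b(\mathbb{R}^d;\mathbb{R}^d)$. *)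

theory Defs
  imports "HOL-Probability.Probability"
begin

section \<open>Square-integrable functions, Wasserstein space\<close>

definition L2fun :: "'a measure \<Rightarrow> ('a \<Rightarrow> 'b::euclidean_space) set" where
  "L2fun M = {f \<in> borel_measurable M. integrable M (\<lambda>x. (norm (f x))\<^sup>2)}"

definition L2norm :: "'a measure \<Rightarrow> ('a \<Rightarrow> 'b::euclidean_space) \<Rightarrow> real" where
  "L2norm M f = sqrt (\<integral>x. (norm (f x))\<^sup>2 \<partial>M)"

definition P2 :: "(real^'n) measure set" where
  "P2 = {\<mu>. prob_space \<mu> \<and> sets \<mu> = sets borel \<and> integrable \<mu> (\<lambda>x. (norm x)\<^sup>2)}"

definition couplings :: "(real^'n) measure \<Rightarrow> (real^'n) measure \<Rightarrow> ((real^'n) \<times> (real^'n)) measure set" where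
  "couplings \<mu> \<nu> = {\<gamma>. prob_space \<gamma> \<and> sets \<gamma> = sets borel \<and>
     distr \<gamma> borel fst = \<mu> \<and> distr \<gamma> borel snd = \<nu>}"

definition W2 :: "(real^'n) measure \<Rightarrow> (real^'n) measure \<Rightarrow> real" where
  "W2 \<mu> \<nu> = sqrt (INF \<gamma>\<in>couplings \<mu> \<nu>. \<integral>z. (dist (fst z) (snd z))\<^sup>2 \<partial>\<gamma>)"

text \<open>Functions of finitely many Euclidean variables and one measure variable are written
  \<open>f z \<mu>\<close>, with all Euclidean variables collected in the tuple \<open>z\<close>. The values for
  \<open>\<mu>\<close> outside \<open>P2\<close> are irrelevant. Joint continuity is with respect to the product of
  the Euclidean topology and \<open>W2\<close>.\<close>

definition jointly_continuous ::
    "('z::metric_space \<Rightarrow> (real^'n) measure \<Rightarrow> 'b::metric_space) \<Rightarrow> bool" where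
  "jointly_continuous f \<longleftrightarrow>
     (\<forall>z. \<forall>\<mu>\<in>P2. \<forall>e>0. \<exists>d>0. \<forall>z'. \<forall>\<nu>\<in>P2.
        dist z z' < d \<and> W2 \<mu> \<nu> < d \<longrightarrow> dist (f z \<mu>) (f z' \<nu>) < e)"

definition jointly_uniformly_continuous ::
    "('z::metric_space \<Rightarrow> (real^'n) measure \<Rightarrow> 'b::metric_space) \<Rightarrow> bool" where
  "jointly_uniformly_continuous f \<longleftrightarrow>
     (\<forall>e>0. \<exists>d>0. \<forall>z z'. \<forall>\<mu>\<in>P2. \<forall>\<nu>\<in>P2.
        dist z z' < d \<and> W2 \<mu> \<nu> < d \<longrightarrow> dist (f z \<mu>) (f z' \<nu>) < e)"

section \<open>Derivatives in the measure\<close>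

text \<open>The atomless probability space carrying the lifts is the unit interval with Lebesgue
  measure.\<close>

definition Om :: "real measure" where
  "Om = restrict_space lborel {0..1}"

definition Law :: "(real \<Rightarrow> real^'n) \<Rightarrow> (real^'n) measure" where
  "Law \<xi> = distr Om borel \<xi>"

text \<open>The lift of \<open>U\<close> to the Hilbert space of square-integrable random variables is
  Frechet differentiable at every \<open>\<xi>\<close>, with gradient \<open>g (Law \<xi>) \<xi>\<close>.\<close>

definition has_lions_derivative ::
    "((real^'n) measure \<Rightarrow> real) \<Rightarrow> ((real^'n) measure \<Rightarrow> real^'n \<Rightarrow> real^'n) \<Rightarrow> bool" where
  "has_lions_derivative U g \<longleftrightarrow>
     (\<forall>\<xi>\<in>L2fun Om.
        (\<lambda>\<omega>. g (Law \<xi>) (\<xi> \<omega>)) \<in> L2fun Om \<and>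
        (\<forall>e>0. \<exists>d>0. \<forall>\<eta>\<in>L2fun Om. L2norm Om \<eta> < d \<longrightarrow>
           \<bar>U (Law (\<lambda>\<omega>. \<xi> \<omega> + \<eta> \<omega>)) - U (Law \<xi>) - (\<integral>\<omega>. g (Law \<xi>) (\<xi> \<omega>) \<bullet> \<eta> \<omega> \<partial>Om)\<bar>
             \<le> e * L2norm Om \<eta>))"

text \<open>A Lions derivative at \<open>\<mu>\<close> is only determined \<open>\<mu>\<close>-almost everywhere; requiring
  joint continuity makes it unique on \<open>P2\<close>, since measures of full support are dense there.\<close>

definition continuous_lions_derivative ::
    "('z::metric_space \<Rightarrow> (real^'n) measure \<Rightarrow> real) \<Rightarrow>
     ('z \<Rightarrow> (real^'n) measure \<Rightarrow> real^'n \<Rightarrow> real^'n) \<Rightarrow> bool" where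
  "continuous_lions_derivative f g \<longleftrightarrow>
     (\<forall>z. has_lions_derivative (f z) (g z)) \<and> jointly_continuous (\<lambda>(z, y) \<mu>. g z \<mu> y)"

definition lions ::
    "('z::metric_space \<Rightarrow> (real^'n) measure \<Rightarrow> real) \<Rightarrow>
     'z \<Rightarrow> (real^'n) measure \<Rightarrow> real^'n \<Rightarrow> real^'n" where
  "lions f = (SOME g. continuous_lions_derivative f g)"

section \<open>Full differentiability\<close>

definition grad :: "('z::euclidean_space \<Rightarrow> real) \<Rightarrow> 'z \<Rightarrow> 'z" where
  "grad f z = (THE D. GDERIV f z :> D)"

definition fully_C1 :: "('z::euclidean_space \<Rightarrow> (real^'n) measure \<Rightarrow> real) \<Rightarrow> bool" where
  "fully_C1 f \<longleftrightarrow>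
     jointly_continuous f \<and>
     (\<forall>\<mu>\<in>P2. \<forall>z. (\<lambda>z'. f z' \<mu>) differentiable (at z)) \<and>
     jointly_continuous (\<lambda>z \<mu>. grad (\<lambda>z'. f z' \<mu>) z) \<and>
     (\<exists>g. continuous_lions_derivative f g)"

text \<open>The first derivatives are themselves fully \<open>C1\<close>; the measure derivative has the extra
  variable \<open>y\<close>, which joins the Euclidean variables.\<close>

definition fully_C2 :: "('z::euclidean_space \<Rightarrow> (real^'n) measure \<Rightarrow> real) \<Rightarrow> bool" where
  "fully_C2 f \<longleftrightarrow>
     fully_C1 f \<and>
     (\<forall>b\<in>Basis. fully_C1 (\<lambda>z \<mu>. grad (\<lambda>z'. f z' \<mu>) z \<bullet> b)) \<and>
     (\<forall>i. fully_C1 (\<lambda>(z, y) \<mu>. lions f z \<mu> y $ i))"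

section \<open>Hamiltonians and their derivatives\<close>

type_synonym 'n hamiltonian = "real^'n \<Rightarrow> (real^'n) measure \<Rightarrow> real^'n \<Rightarrow> real"

definition dx :: "'n::finite hamiltonian \<Rightarrow> real^'n \<Rightarrow> (real^'n) measure \<Rightarrow> real^'n \<Rightarrow> real^'n" where
  "dx H x \<mu> p = grad (\<lambda>x'. H x' \<mu> p) x"

definition dp :: "'n::finite hamiltonian \<Rightarrow> real^'n \<Rightarrow> (real^'n) measure \<Rightarrow> real^'n \<Rightarrow> real^'n" where
  "dp H x \<mu> p = grad (\<lambda>p'. H x \<mu> p') p"

definition dmu ::
    "'n::finite hamiltonian \<Rightarrow> real^'n \<Rightarrow> (real^'n) measure \<Rightarrow> real^'n \<Rightarrow> real^'n \<Rightarrow> real^'n" where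
  "dmu H x \<mu> y p = lions (\<lambda>(x, p) \<mu>. H x \<mu> p) (x, p) \<mu> y"

definition dxx :: "'n::finite hamiltonian \<Rightarrow> real^'n \<Rightarrow> (real^'n) measure \<Rightarrow> real^'n \<Rightarrow> real^'n^'n" where
  "dxx H x \<mu> p = jacobian (\<lambda>x'. dx H x' \<mu> p) (at x)"

definition dxp :: "'n::finite hamiltonian \<Rightarrow> real^'n \<Rightarrow> (real^'n) measure \<Rightarrow> real^'n \<Rightarrow> real^'n^'n" where
  "dxp H x \<mu> p = jacobian (\<lambda>p'. dx H x \<mu> p') (at p)"

definition dpp :: "'n::finite hamiltonian \<Rightarrow> real^'n \<Rightarrow> (real^'n) measure \<Rightarrow> real^'n \<Rightarrow> real^'n^'n" where
  "dpp H x \<mu> p = jacobian (\<lambda>p'. dp H x \<mu> p') (at p)"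

text \<open>The rows of \<open>jacobian\<close> are indexed by the components of the function; the transpose makes
  the row index that of \<open>x\<close> (or \<open>p\<close>) and the column index that of the measure derivative.\<close>

definition dxmu ::
    "'n::finite hamiltonian \<Rightarrow> real^'n \<Rightarrow> (real^'n) measure \<Rightarrow> real^'n \<Rightarrow> real^'n \<Rightarrow> real^'n^'n" where
  "dxmu H x \<mu> y p = transpose (jacobian (\<lambda>x'. dmu H x' \<mu> y p) (at x))"

definition dpmu ::
    "'n::finite hamiltonian \<Rightarrow> real^'n \<Rightarrow> (real^'n) measure \<Rightarrow> real^'n \<Rightarrow> real^'n \<Rightarrow> real^'n^'n" where
  "dpmu H x \<mu> y p = transpose (jacobian (\<lambda>p'. dmu H x \<mu> y p') (at p))"

definition assumption_H :: "'n::finite hamiltonian \<Rightarrow> bool" where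
  "assumption_H H \<longleftrightarrow>
     fully_C2 (\<lambda>(x, p) \<mu>. H x \<mu> p) \<and>
     (\<exists>c0>0. \<exists>L>0.
        jointly_uniformly_continuous (\<lambda>(x, p) \<mu>. dpp H x \<mu> p) \<and>
        (\<forall>x. \<forall>\<mu>\<in>P2. \<forall>p w. w \<bullet> (dpp H x \<mu> p *v w) \<ge> inverse c0 * (w \<bullet> w)) \<and>
        jointly_continuous (\<lambda>(x, p) \<mu>. dxp H x \<mu> p) \<and>
        jointly_continuous (\<lambda>(x, p) \<mu>. dpp H x \<mu> p) \<and>
        jointly_continuous (\<lambda>(x, p) \<mu>. dxx H x \<mu> p) \<and>
        (\<forall>x. \<forall>\<mu>\<in>P2. \<forall>p. norm (dxp H x \<mu> p) \<le> L \<and> norm (dpp H x \<mu> p) \<le> L \<and> norm (dxx H x \<mu> p) \<le> L) \<and>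
        jointly_uniformly_continuous (\<lambda>(x, y, p) \<mu>. dpmu H x \<mu> y p) \<and>
        jointly_uniformly_continuous (\<lambda>(x, y, p) \<mu>. dxmu H x \<mu> y p) \<and>
        (\<forall>x. \<forall>\<mu>\<in>P2. \<forall>y p. norm (dpmu H x \<mu> y p) \<le> L \<and> norm (dxmu H x \<mu> y p) \<le> L) \<and>
        (\<forall>x. \<forall>\<mu>\<in>P2. \<forall>p. dp H x \<mu> p \<bullet> p - H x \<mu> p \<ge> - L))"

definition shift_H :: "'n::finite hamiltonian \<Rightarrow> real \<Rightarrow> 'n hamiltonian" where
  "shift_H H \<alpha> x \<mu> p = H x \<mu> (p - \<alpha> *\<^sub>R x)"

definition displacement_monotone :: "'n::finite hamiltonian \<Rightarrow> bool" where
  "displacement_monotone K \<longleftrightarrow>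
     (\<forall>\<mu>\<in>P2. \<exists>g. continuous_on UNIV g \<and> (\<forall>z. GDERIV (\<lambda>(x, p). K x \<mu> p) z :> g z)) \<and>
     (\<forall>\<mu>\<in>P2. \<forall>\<nu>\<in>P2. \<forall>\<gamma>\<in>couplings \<mu> \<nu>. \<forall>p1\<in>bcontfun. \<forall>p2\<in>bcontfun.
        - (\<integral>(x, y). (dx K x \<mu> (p1 x) - dx K y \<nu> (p2 y)) \<bullet> (x - y) \<partial>\<gamma>)
        + (\<integral>(x, y). (dp K x \<mu> (p1 x) - dp K y \<nu> (p2 y)) \<bullet> (p1 x - p2 y) \<partial>\<gamma>) \<ge> 0)"

section \<open>Matrix square roots\<close>

text \<open>The unique symmetric positive semidefinite square root; only used for symmetric positive
  semidefinite \<open>A\<close>.\<close>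

definition matrix_sqrt :: "real^'n^'n \<Rightarrow> real^'n^'n" where
  "matrix_sqrt A = (THE B. transpose B = B \<and> (\<forall>w. 0 \<le> w \<bullet> (B *v w)) \<and> B ** B = A)"

definition matrix_inv_sqrt :: "real^'n^'n \<Rightarrow> real^'n^'n" where
  "matrix_inv_sqrt A = matrix_inv (matrix_sqrt A)"

end

theory Submission
  imports Defs
begin

text \<open>Write \<open>K = shift_H H \<alpha>\<close>, \<open>q = p - \<alpha> x\<close>. In terms of \<open>q\<close> the displacement form of \<open>K\<close> pairs increments of
  the gradient \<open>(H\<^sub>x, H\<^sub>p)\<close> with increments of \<open>(x, q)\<close>. Along a straight segment from \<open>(x, q)\<close> in direction
  \<open>(v, r)\<close> its infinitesimal version is a quadratic form in \<open>(v, r)\<close>, in which the mixed terms \<open>H\<^sub>x\<^sub>p\<close>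
  cancel by symmetry; minimising over \<open>r\<close> (completing the square) gives minus the expression in the
  theorem. So one direction is differentiation and the other integration along segments. For finitely
  supported laws both are finite-dimensional calculus: a point configuration lifts to a simple random variable,
  so Lions derivatives become partial derivatives in the points, and after an arbitrarily small
  perturbation the points are distinct, so that momenta and directions are values of continuous
  functions of the point. General measures and couplings follow by approximation with simple functions
  and dominated convergence.\<close>

text \<open>The factor 2 \<alpha> has two sources: the x-gradient of the shifted Hamiltonian is
  \<open>dx\<close> minus \<alpha> times \<open>dp\<close>, and the increment of p = q + \<alpha> x
  contributes a second \<alpha>. The factor 1/4 comes from the minimum over r of r . A r + b . r,
  which is -1/4 b . A^-1 b. One obstacle is regularity: full C2 smoothness supplies the Lions
  derivative of the gradient and the gradient of the Lions derivative separately, and they have to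
  be matched by a Schwarz argument along point configurations. Another is that momenta and
  directions in both conditions are functions of the point, while segments between configurations
  may pass through collisions. The forms are therefore stated for momenta and directions indexed by
  the sample space, so that moving the points leaves these unchanged. In the limits, the quadratic
  form contains only second derivatives, bounded uniformly in the momentum, so any continuous p is
  admissible. The displacement form contains the gradient itself; there bounded p and a Lipschitz
  bound give linear growth.\<close>

section \<open>Matrix-vector products\<close>

lemma norm_matrix_vector_mult_le:
  fixes A :: "real^'n^'m" and x :: "real^'n"
  shows "norm (A *v x) \<le> norm A * norm x"
proof -
  have "(A *v x) $ i = (A $ i) \<bullet> x" for i
    by (simp add: matrix_vector_mult_def inner_vec_def)
  then have "(norm (A *v x))\<^sup>2 = (\<Sum>i\<in>UNIV. ((A $ i) \<bullet> x)\<^sup>2)"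
    by (simp only: power2_norm_eq_inner) (simp add: inner_vec_def[of "A *v x"] power2_eq_square)
  \<comment> \<open>Cauchy-Schwarz in each row; the norm on matrices is the Frobenius norm.\<close>
  also have "\<dots> \<le> (\<Sum>i\<in>UNIV. (norm (A $ i))\<^sup>2 * (norm x)\<^sup>2)"
    by (intro sum_mono) (metis Cauchy_Schwarz_ineq2 abs_ge_zero power2_abs power_mono power_mult_distrib)
  also have "\<dots> = (norm A * norm x)\<^sup>2"
    by (simp add: power_mult_distrib sum_distrib_right norm_vec_def L2_set_def sum_nonneg)
  finally show ?thesis
    by (rule power2_le_imp_le) auto
qed

lemma bounded_bilinear_matrix_vector_mult:
  "bounded_bilinear ((*v) :: real^'n^'m \<Rightarrow> real^'n \<Rightarrow> real^'m)"
  using norm_matrix_vector_mult_le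
  by (intro bounded_bilinear.intro exI[of _ 1])
    (auto simp: matrix_vector_mult_add_rdistrib matrix_vector_right_distrib
      scaleR_matrix_vector_assoc matrix_vector_mult_scaleR)

lemma norm_matrix_vector_mult_bound:
  fixes A :: "real^'n^'m"
  assumes "norm A \<le> L"
  shows "norm (A *v w) \<le> L * norm w"
  using norm_matrix_vector_mult_le[of A w] mult_right_mono[OF assms norm_ge_zero[of w]] by linarith

lemmas tendsto_matrix_vector_mult [tendsto_intros] =
  bounded_bilinear.tendsto[OF bounded_bilinear_matrix_vector_mult]

lemma borel_measurable_matrix_vector_mult [measurable]:
  fixes f :: "'a \<Rightarrow> real^'n^'m" and g :: "'a \<Rightarrow> real^'n"
  assumes [measurable]: "f \<in> borel_measurable M" "g \<in> borel_measurable M"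
  shows "(\<lambda>x. f x *v g x) \<in> borel_measurable M"
proof -
  have "(\<lambda>x. (\<lambda>z. fst z *v snd z) (f x, g x)) \<in> borel_measurable M"
    by (rule borel_measurable_continuous_Pair[OF assms])
       (intro bounded_bilinear.continuous_on[OF bounded_bilinear_matrix_vector_mult] continuous_intros)
  then show ?thesis by simp
qed

lemma inner_matrix_vector_transpose:
  fixes A :: "real^'n^'m"
  shows "(A *v x) \<bullet> y = x \<bullet> (transpose A *v y)"
  by (metis dot_lmul_matrix inner_commute transpose_matrix_vector)

section \<open>Matrix square roots\<close>

text \<open>For \<open>D = B - C\<close> the hypothesis gives \<open>B D + D C = 0\<close>; multiplying by \<open>D\<close> and taking traces,
  \<open>tr (D B D) + tr (D C D) = 0\<close> with both traces nonnegative.\<close>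

lemma matrix_sqrt_unique:
  fixes B C :: "real^'n^'n"
  assumes B: "transpose B = B" "\<And>w. w \<noteq> 0 \<Longrightarrow> 0 < w \<bullet> (B *v w)"
    and C: "transpose C = C" "\<And>w. 0 \<le> w \<bullet> (C *v w)" and eq: "B ** B = C ** C"
  shows "C = B"
proof -
  define D where "D = B - C"
  have D: "transpose D = D"
    using B(1) C(1) by (simp add: D_def transpose_def vec_eq_iff)
  have BCD: "B = C + D" by (simp add: D_def)
  have "B ** B = B ** C + B ** D"
    by (subst (2) BCD) (rule matrix_add_ldistrib)
  moreover have "B ** C = C ** C + D ** C"
    by (subst BCD) (simp add: matrix_matrix_mult_def vec_eq_iff sum.distrib distrib_right)
  ultimately have "D ** C + B ** D = 0"
    using eq by simp
  then have "D ** (D ** C) + D ** (B ** D) = 0"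
    by (simp add: matrix_add_ldistrib[symmetric])
  then have "D ** (D ** C) + D ** B ** D = 0"
    by (simp add: matrix_mul_assoc)
  then have "trace (D ** (D ** C)) + trace (D ** B ** D) = 0"
    by (simp add: trace_add[symmetric] trace_0[simplified mat_0])
  moreover have "trace (D ** (D ** C)) = trace (D ** C ** D)"
    by (rule trace_mul_sym)
  ultimately have "trace (D ** B ** D) = - trace (D ** C ** D)"
    by simp
  moreover have tr: "trace (D ** X ** D) = (\<Sum>i\<in>UNIV. (D *v axis i 1) \<bullet> (X *v (D *v axis i 1)))"
    for X :: "real^'n^'n"
  proof -
    have "(D ** X ** D) $ i $ i = (D *v axis i 1) \<bullet> (X *v (D *v axis i 1))" for i
    proof -
      have "(D ** X ** D) $ i $ i = axis i 1 \<bullet> ((D ** X ** D) *v axis i 1)"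
        by (simp add: inner_axis' matrix_vector_mult_basis column_def)
      also have "\<dots> = axis i 1 \<bullet> (transpose D *v (X *v (D *v axis i 1)))"
        by (simp add: D matrix_vector_mul_assoc matrix_mul_assoc)
      finally show ?thesis
        by (simp only: inner_matrix_vector_transpose)
    qed
    then show ?thesis by (simp add: trace_def)
  qed
  ultimately have "(\<Sum>i\<in>UNIV. (D *v axis i 1) \<bullet> (B *v (D *v axis i 1))) \<le> 0"
    using C(2) by (simp add: sum_nonneg)
  moreover have nn: "0 \<le> w \<bullet> (B *v w)" for w
    using B(2)[of w] by (cases "w = 0") auto
  ultimately have "(\<Sum>i\<in>UNIV. (D *v axis i 1) \<bullet> (B *v (D *v axis i 1))) = 0"
    by (intro antisym sum_nonneg) auto
  then have "(D *v axis i 1) \<bullet> (B *v (D *v axis i 1)) = 0" for i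
    using nn by (subst (asm) sum_nonneg_eq_0_iff) auto
  \<comment> \<open>Definiteness of \<open>B\<close> kills every column of \<open>D\<close>; from
    \<open>C\<close> only the sign of its form was used.\<close>
  then have "D *v axis i 1 = 0" for i
    using B(2)[of "D *v axis i 1"] by force
  then have "D = 0"
    by (simp add: matrix_vector_mult_basis column_def vec_eq_iff)
  then show ?thesis by (simp add: D_def)
qed

text \<open>Polarisation: for a self-adjoint map, \<open>4 * (R u \<bullet> y)\<close> is the
  difference of the quadratic form at \<open>u + y\<close> and \<open>u - y\<close>, so a bound on
  the form bounds the operator norm with the same constant.\<close>

lemma symmetric_norm_le:
  fixes R :: "'a::real_inner \<Rightarrow> 'a"
  assumes "linear R" and sym: "\<And>v w. R v \<bullet> w = v \<bullet> R w"
    and bnd: "\<And>w. \<bar>w \<bullet> R w\<bar> \<le> \<rho> * (w \<bullet> w)"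
  shows "norm (R x) \<le> \<rho> * norm x"
proof (cases "R x = 0 \<or> x = 0")
  case True
  have "0 \<le> \<rho> * norm x"
  proof (cases "x = 0")
    case False
    then have "0 \<le> \<rho>"
      using bnd[of x] by (smt (verit) inner_gt_zero_iff mult_neg_pos)
    then show ?thesis by simp
  qed simp
  with True assms(1) show ?thesis by (auto simp: linear_0)
next
  case False
  interpret linear R by fact
  have pol: "4 * (R u \<bullet> y) \<le> 2 * \<rho> * (u \<bullet> u + y \<bullet> y)" for u y
  proof -
    have "4 * (R u \<bullet> y) = (u + y) \<bullet> R (u + y) - (u - y) \<bullet> R (u - y)"
      using sym[of u y] by (simp add: add diff inner_simps inner_commute)
    also have "\<dots> \<le> \<rho> * ((u + y) \<bullet> (u + y)) + \<rho> * ((u - y) \<bullet> (u - y))"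
      using bnd[of "u + y"] bnd[of "u - y"] by linarith
    also have "\<dots> = 2 * \<rho> * (u \<bullet> u + y \<bullet> y)"
      by (simp add: inner_simps algebra_simps inner_commute)
    finally show ?thesis .
  qed
  \<comment> \<open>The direction of \<open>R x\<close>, rescaled to the length of \<open>x\<close>
    so that both squares on the right of the polarised bound are equal.\<close>
  define y where "y = (norm x / norm (R x)) *\<^sub>R R x"
  have "y \<bullet> y = x \<bullet> x"
    using False by (simp add: y_def power2_norm_eq_inner[symmetric] power2_eq_square)
  moreover have "R x \<bullet> y = norm x * norm (R x)"
    using False by (simp add: y_def power2_norm_eq_inner[symmetric] power2_eq_square)
  ultimately have "norm x * norm (R x) \<le> \<rho> * (x \<bullet> x)"
    using pol[of x y] by simp
  then show ?thesis
    using False by (simp add: power2_norm_eq_inner[symmetric] power2_eq_square mult.commute mult.left_commute)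
qed

text \<open>With \<open>A = M (1 - R)\<close> and \<open>norm R < 1\<close>, the root is \<open>sqrt M * (1 - Y)\<close>, where \<open>Y\<close> is the fixed
  point of the contraction \<open>Y \<mapsto> (R + Y\<^sup>2) / 2\<close>.\<close>

lemma matrix_sqrt_exists:
  fixes A :: "real^'n^'n"
  assumes sym: "transpose A = A" and c: "0 < c" "\<And>w. c * (w \<bullet> w) \<le> w \<bullet> (A *v w)"
  obtains B where "transpose B = B" "\<And>w. w \<noteq> 0 \<Longrightarrow> 0 < w \<bullet> (B *v w)" "B ** B = A"
proof -
  \<comment> \<open>Large enough to dominate the form of \<open>A\<close> from above and to exceed
    \<open>c\<close>; then the form of \<open>R = 1 - A / M\<close> lies between 0 and
    \<open>1 - c / M\<close>.\<close>
  define M where "M = norm A + c + 1"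
  have M: "0 < M" "c < M" "norm A \<le> M" using c by (auto simp: M_def add_nonneg_pos)
  have AM: "w \<bullet> (A *v w) \<le> M * (w \<bullet> w)" for w
  proof -
    have "w \<bullet> (A *v w) \<le> norm w * norm (A *v w)" by (rule norm_cauchy_schwarz)
    also have "\<dots> \<le> norm w * (norm A * norm w)"
      by (intro mult_left_mono norm_matrix_vector_mult_le) auto
    also have "\<dots> \<le> norm w * (M * norm w)"
      using M by (intro mult_left_mono mult_right_mono) auto
    finally show ?thesis by (simp add: power2_norm_eq_inner[symmetric] power2_eq_square mult_ac)
  qed
  define \<rho> where "\<rho> = 1 - c / M"
  have \<rho>: "0 \<le> \<rho>" "\<rho> < 1" using M c by (auto simp: \<rho>_def)
  \<comment> \<open>The smaller root of \<open>(\<rho> + r * r) / 2 = r\<close>: the ball of this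
    radius is mapped into itself, and \<open>r\<close> is also the contraction constant on
    it.\<close>
  define r where "r = 1 - sqrt (1 - \<rho>)"
  have r: "0 \<le> r" "r < 1" using \<rho> by (auto simp: r_def)
  have "r * r = 1 - 2 * sqrt (1 - \<rho>) + (sqrt (1 - \<rho>))\<^sup>2"
    by (simp add: r_def algebra_simps power2_eq_square)
  then have r_eq: "(\<rho> + r * r) / 2 = r"
    using \<rho> by (simp add: r_def)
  define R where "R = Blinfun (\<lambda>w. w - (1 / M) *\<^sub>R (A *v w))"
  have "bounded_linear (\<lambda>w. w - (1 / M) *\<^sub>R (A *v w))"
    by (intro bounded_linear_sub bounded_linear_ident bounded_linear_scaleR_right
        bounded_linear_compose[OF bounded_linear_scaleR_right] matrix_vector_mul_bounded_linear)
  then have R: "blinfun_apply R w = w - (1 / M) *\<^sub>R (A *v w)" for w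
    by (simp add: R_def bounded_linear_Blinfun_apply)
  have Asym: "(A *v v) \<bullet> w = v \<bullet> (A *v w)" for v w
    by (simp only: inner_matrix_vector_transpose sym)
  have Rsym: "blinfun_apply R v \<bullet> w = v \<bullet> blinfun_apply R w" for v w
    by (simp add: R inner_simps Asym)
  have "norm R \<le> \<rho>"
  proof (rule norm_blinfun_bound[OF \<rho>(1)], rule symmetric_norm_le)
    show "\<bar>w \<bullet> blinfun_apply R w\<bar> \<le> \<rho> * (w \<bullet> w)" for w
      using AM[of w] c(2)[of w] M by (auto simp: R inner_simps \<rho>_def field_simps abs_le_iff)
  qed (auto intro: Rsym bounded_linear.linear blinfun.bounded_linear_right)
  define S where "S = {Y :: (real^'n) \<Rightarrow>\<^sub>L (real^'n). norm Y \<le> r \<and>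
    (\<forall>v w. blinfun_apply Y v \<bullet> w = v \<bullet> blinfun_apply Y w)}"
  define \<Phi> where "\<Phi> Y = (1/2) *\<^sub>R (R + (Y o\<^sub>L Y))" for Y
  have "closed S"
    unfolding S_def
    by (intro closed_Collect_conj closed_Collect_all closed_Collect_le closed_Collect_eq
        continuous_intros)
  note complete_S = iffD2[OF complete_eq_closed this]
  have "\<exists>!Y\<in>S. \<Phi> Y = Y"
  proof (rule Banach_fix[OF complete_S, of r])
    show "S \<noteq> {}" using r by (auto simp: S_def intro!: exI[of _ 0])
    show "\<Phi> ` S \<subseteq> S"
    proof safe
      fix Y assume Y: "Y \<in> S"
      have "norm (\<Phi> Y) \<le> (norm R + norm (Y o\<^sub>L Y)) / 2"
        using norm_triangle_ineq[of R "Y o\<^sub>L Y"] by (simp add: \<Phi>_def)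
      also have "\<dots> \<le> (\<rho> + norm Y * norm Y) / 2"
        using \<open>norm R \<le> \<rho>\<close> norm_blinfun_compose[of Y Y] by simp
      also have "\<dots> \<le> (\<rho> + r * r) / 2"
        using Y by (auto simp: S_def intro!: mult_mono r)
      finally have "norm (\<Phi> Y) \<le> r" by (simp only: r_eq)
      moreover have "blinfun_apply (\<Phi> Y) v \<bullet> w = v \<bullet> blinfun_apply (\<Phi> Y) w" for v w
        using Y by (simp add: S_def \<Phi>_def blinfun.bilinear_simps inner_simps Rsym)
      ultimately show "\<Phi> Y \<in> S" by (simp add: S_def)
    qed
    show "dist (\<Phi> Y) (\<Phi> Z) \<le> r * dist Y Z" if "Y \<in> S" "Z \<in> S" for Y Z
    proof -
      \<comment> \<open>The factors need not commute, so the difference of squares is split as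
        \<open>Y (Y - Z) + (Y - Z) Z\<close>.\<close>
      have "\<Phi> Y - \<Phi> Z = (1/2) *\<^sub>R ((Y o\<^sub>L (Y - Z)) + ((Y - Z) o\<^sub>L Z))"
        by (rule blinfun_eqI) (simp add: \<Phi>_def blinfun.bilinear_simps algebra_simps)
      then have "norm (\<Phi> Y - \<Phi> Z) \<le> (norm (Y o\<^sub>L (Y - Z)) + norm ((Y - Z) o\<^sub>L Z)) / 2"
        using norm_triangle_ineq[of "Y o\<^sub>L (Y - Z)" "(Y - Z) o\<^sub>L Z"] by simp
      also have "\<dots> \<le> (norm Y * norm (Y - Z) + norm (Y - Z) * norm Z) / 2"
        using norm_blinfun_compose[of Y "Y - Z"] norm_blinfun_compose[of "Y - Z" Z] by simp
      also have "\<dots> \<le> (r * norm (Y - Z) + norm (Y - Z) * r) / 2"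
        using that by (intro divide_right_mono add_mono mult_right_mono mult_left_mono) (auto simp: S_def)
      finally show ?thesis by (simp add: dist_norm mult.commute)
    qed
  qed (use r in auto)
  then obtain Y where Y: "Y \<in> S" "\<Phi> Y = Y" by blast
  \<comment> \<open>Equivalently, the square of \<open>1 - Y\<close> is \<open>1 - R\<close>, that
    is \<open>A / M\<close>.\<close>
  have YY: "R + (Y o\<^sub>L Y) = 2 *\<^sub>R Y"
    using arg_cong[OF Y(2), of "\<lambda>X. 2 *\<^sub>R X"] by (simp add: \<Phi>_def)
  define b where "b w = sqrt M *\<^sub>R (w - blinfun_apply Y w)" for w
  have lin: "linear b"
    by (rule linearI) (auto simp: b_def blinfun.bilinear_simps algebra_simps)
  define B where "B = matrix b"
  have B: "B *v w = b w" for w by (simp add: B_def matrix_works lin)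
  have bsym: "b v \<bullet> w = v \<bullet> b w" for v w
    using Y(1) by (simp add: b_def S_def inner_simps)
  have "transpose B = B"
  proof -
    have "(transpose B *v v) \<bullet> w = (B *v v) \<bullet> w" for v w
      using bsym[of v w] inner_matrix_vector_transpose[of B w v]
      by (simp add: B inner_commute)
    then show ?thesis
      by (metis matrix_eq vector_eq_rdot)
  qed
  moreover have "0 < w \<bullet> (B *v w)" if "w \<noteq> 0" for w
  proof -
    have "w \<bullet> blinfun_apply Y w \<le> norm w * norm (blinfun_apply Y w)"
      by (rule norm_cauchy_schwarz)
    also have "\<dots> \<le> norm w * (norm Y * norm w)"
      by (intro mult_left_mono norm_blinfun) auto
    also have "\<dots> \<le> norm w * (r * norm w)"
      using Y by (intro mult_left_mono mult_right_mono) (auto simp: S_def)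
    also have "\<dots> < w \<bullet> w"
      using that r by (simp add: power2_norm_eq_inner[symmetric] power2_eq_square)
    finally show ?thesis using M by (simp add: B b_def inner_simps)
  qed
  moreover have "B ** B = A"
  proof -
    have "(B ** B) *v w = A *v w" for w
    proof -
      have "blinfun_apply R w + Y (Y w) = 2 *\<^sub>R Y w"
        using arg_cong[OF YY, of "\<lambda>X. blinfun_apply X w"] by (simp add: blinfun.bilinear_simps)
      then have YY': "Y (Y w) = 2 *\<^sub>R Y w - w + (1 / M) *\<^sub>R (A *v w)"
        by (simp add: R algebra_simps)
      have "b (b w) = (sqrt M * sqrt M) *\<^sub>R (w - 2 *\<^sub>R Y w + Y (Y w))"
      proof -
        have "w - Y w - Y (w - Y w) = w - 2 *\<^sub>R Y w + Y (Y w)"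
          by (simp add: blinfun.diff_right scaleR_2)
        moreover have "b (b w) = (sqrt M * sqrt M) *\<^sub>R (w - Y w - Y (w - Y w))"
          unfolding b_def blinfun.scaleR_right scaleR_right_diff_distrib[symmetric] scaleR_scaleR ..
        ultimately show ?thesis by simp
      qed
      also have "\<dots> = A *v w"
        using M by (simp add: YY')
      finally show ?thesis
        by (simp add: B matrix_vector_mul_assoc[symmetric])
    qed
    then show ?thesis by (simp add: matrix_eq)
  qed
  ultimately show ?thesis using that by blast
qed

lemma invertible_pos_def:
  fixes A :: "real^'n^'n"
  assumes "\<And>w. w \<noteq> 0 \<Longrightarrow> 0 < w \<bullet> (A *v w)"
  shows "invertible A"
  using assms by (metis inner_zero_right invertible_left_inverse matrix_left_invertible_ker less_irrefl)

lemma matrix_inv_mult_vector: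
  fixes A :: "real^'n^'n"
  assumes "invertible A"
  shows "A *v (matrix_inv A *v b) = b" "matrix_inv A *v (A *v b) = b"
proof -
  have "A ** matrix_inv A = mat 1 \<and> matrix_inv A ** A = mat 1"
    using assms unfolding invertible_def matrix_inv_def by (rule someI_ex)
  then show "A *v (matrix_inv A *v b) = b" "matrix_inv A *v (A *v b) = b"
    by (simp_all add: matrix_vector_mul_assoc)
qed

text \<open>With \<open>A = B ** B\<close> and \<open>b = A *v w\<close>, both sides are the squared
  norm of \<open>B *v w\<close>. This replaces the square root by the inverse of \<open>A\<close>,
  the form in which completing the square produces it.\<close>

lemma norm_matrix_inv_sqrt:
  fixes A :: "real^'n^'n"
  assumes sym: "transpose A = A" and c: "0 < c" "\<And>w. c * (w \<bullet> w) \<le> w \<bullet> (A *v w)"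
  shows "(norm (matrix_inv_sqrt A *v b))\<^sup>2 = b \<bullet> (matrix_inv A *v b)"
proof -
  obtain B where B: "transpose B = B" "\<And>w. w \<noteq> 0 \<Longrightarrow> 0 < w \<bullet> (B *v w)" "B ** B = A"
    using matrix_sqrt_exists[OF assms] by blast
  have nn: "0 \<le> w \<bullet> (B *v w)" for w
    using B(2)[of w] by (cases "w = 0") auto
  have "matrix_sqrt A = B"
    unfolding matrix_sqrt_def
  proof (rule the_equality)
    show "transpose B = B \<and> (\<forall>w. 0 \<le> w \<bullet> (B *v w)) \<and> B ** B = A"
      using B nn by blast
    show "C = B" if "transpose C = C \<and> (\<forall>w. 0 \<le> w \<bullet> (C *v w)) \<and> C ** C = A" for C
      by (rule matrix_sqrt_unique) (use that B in auto)
  qed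
  have "0 < w \<bullet> (A *v w)" if "w \<noteq> 0" for w
    using c(1) c(2)[of w] that by (smt (verit) inner_gt_zero_iff mult_pos_pos)
  then have iA: "invertible A" by (rule invertible_pos_def)
  have iB: "invertible B" using B(2) by (rule invertible_pos_def)
  define u where "u = matrix_inv B *v b"
  have b: "b = B *v u" using matrix_inv_mult_vector[OF iB] by (simp add: u_def)
  define w where "w = matrix_inv B *v u"
  have u: "u = B *v w" using matrix_inv_mult_vector[OF iB] by (simp add: w_def)
  have "b = A *v w" by (simp add: b u B(3)[symmetric] matrix_vector_mul_assoc)
  then have "matrix_inv A *v b = w" by (simp add: matrix_inv_mult_vector[OF iA])
  then have "b \<bullet> (matrix_inv A *v b) = u \<bullet> u"
    by (simp add: b u) (simp only: inner_matrix_vector_transpose B(1))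
  then show ?thesis
    by (simp add: matrix_inv_sqrt_def \<open>matrix_sqrt A = B\<close> power2_norm_eq_inner u_def)
qed

section \<open>Mixed derivatives\<close>

text \<open>Schwarz: the second difference over a square of side \<open>k\<close> is evaluated by
  two mean values in either order, giving \<open>k * k\<close> times each mixed derivative at a
  nearby point. The scalar formulation lets either parameter move a measure instead of a
  vector.\<close>

lemma mixed_derivatives_eq:
  fixes h :: "real \<Rightarrow> real \<Rightarrow> real"
  assumes hs: "\<And>s t. ((\<lambda>s. h s t) has_real_derivative hs s t) (at s)"
    and ht: "\<And>s t. ((\<lambda>t. h s t) has_real_derivative ht s t) (at t)"
    and hst: "\<And>s t. ((\<lambda>t. hs s t) has_real_derivative hst s t) (at t)"
    and hts: "\<And>s t. ((\<lambda>s. ht s t) has_real_derivative hts s t) (at s)"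
    and cst: "isCont (\<lambda>z. hst (fst z) (snd z)) (0, 0)"
    and cts: "isCont (\<lambda>z. hts (fst z) (snd z)) (0, 0)"
  shows "hst 0 0 = hts 0 0"
proof (rule ccontr)
  assume ne: "hst 0 0 \<noteq> hts 0 0"
  define e where "e = \<bar>hst 0 0 - hts 0 0\<bar> / 2"
  have e: "0 < e" using ne by (simp add: e_def)
  obtain d1 where d1: "d1 > 0" "\<And>z. dist z (0,0) < d1 \<Longrightarrow> dist (hst (fst z) (snd z)) (hst 0 0) < e"
    using cst e unfolding continuous_at_eps_delta by auto
  obtain d2 where d2: "d2 > 0" "\<And>z. dist z (0,0) < d2 \<Longrightarrow> dist (hts (fst z) (snd z)) (hts 0 0) < e"
    using cts e unfolding continuous_at_eps_delta by auto
  \<comment> \<open>Halved because a point of the open square has norm below \<open>2 * k\<close> by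
    the triangle inequality.\<close>
  define k where "k = min d1 d2 / 2"
  have k: "0 < k" "2 * k \<le> d1" "2 * k \<le> d2" using d1 d2 by (auto simp: k_def)
  have near: "dist (\<xi>, \<eta>) (0, 0) < 2 * k" if "0 < \<xi>" "\<xi> < k" "0 < \<eta>" "\<eta> < k" for \<xi> \<eta> :: real
    using that norm_Pair_le[of \<xi> \<eta>] by (simp add: dist_norm zero_prod_def[symmetric])
  have "\<exists>\<xi>>0. \<xi> < k \<and> (h k k - h k 0) - (h 0 k - h 0 0) = (k - 0) * (hs \<xi> k - hs \<xi> 0)"
    by (rule MVT2[OF k(1), of "\<lambda>s. h s k - h s 0"]) (intro DERIV_diff hs)
  then obtain \<xi> where \<xi>: "0 < \<xi>" "\<xi> < k"
    "(h k k - h k 0) - (h 0 k - h 0 0) = k * (hs \<xi> k - hs \<xi> 0)" by auto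
  have "\<exists>\<eta>>0. \<eta> < k \<and> hs \<xi> k - hs \<xi> 0 = (k - 0) * hst \<xi> \<eta>"
    by (rule MVT2[OF k(1)]) (intro hst)
  then obtain \<eta> where \<eta>: "0 < \<eta>" "\<eta> < k" "hs \<xi> k - hs \<xi> 0 = k * hst \<xi> \<eta>" by auto
  have "\<exists>\<eta>'>0. \<eta>' < k \<and> (h k k - h 0 k) - (h k 0 - h 0 0) = (k - 0) * (ht k \<eta>' - ht 0 \<eta>')"
    by (rule MVT2[OF k(1), of "\<lambda>t. h k t - h 0 t"]) (intro DERIV_diff ht)
  then obtain \<eta>' where \<eta>': "0 < \<eta>'" "\<eta>' < k"
    "(h k k - h 0 k) - (h k 0 - h 0 0) = k * (ht k \<eta>' - ht 0 \<eta>')" by auto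
  have "\<exists>\<xi>'>0. \<xi>' < k \<and> ht k \<eta>' - ht 0 \<eta>' = (k - 0) * hts \<xi>' \<eta>'"
    by (rule MVT2[OF k(1)]) (intro hts)
  then obtain \<xi>' where \<xi>': "0 < \<xi>'" "\<xi>' < k" "ht k \<eta>' - ht 0 \<eta>' = k * hts \<xi>' \<eta>'" by auto
  have "(h k k - h k 0) - (h 0 k - h 0 0) = (h k k - h 0 k) - (h k 0 - h 0 0)"
    by simp
  then have "k * (k * hst \<xi> \<eta>) = k * (k * hts \<xi>' \<eta>')"
    unfolding \<xi>(3) \<eta>(3) \<xi>'(3) \<eta>'(3) .
  then have "hst \<xi> \<eta> = hts \<xi>' \<eta>'" using k by simp
  moreover have "dist (hst \<xi> \<eta>) (hst 0 0) < e"
    using d1(2)[of "(\<xi>, \<eta>)"] near[OF \<xi>(1,2) \<eta>(1,2)] k by auto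
  moreover have "dist (hts \<xi>' \<eta>') (hts 0 0) < e"
    using d2(2)[of "(\<xi>', \<eta>')"] near[OF \<xi>'(1,2) \<eta>'(1,2)] k by auto
  ultimately show False
    using e by (simp add: dist_real_def e_def abs_if split: if_splits)
qed

section \<open>Gradients\<close>

lemma GDERIV_unique:
  assumes "GDERIV f z :> D" "GDERIV f z :> D'"
  shows "D = D'"
proof -
  have "(\<lambda>h. h \<bullet> D) = (\<lambda>h. h \<bullet> D')"
    using assms unfolding gderiv_def by (rule has_derivative_unique)
  then have "\<And>h. h \<bullet> D = h \<bullet> D'" by meson
  then show ?thesis by (metis vector_eq_ldot)
qed

lemma grad_eqI: "GDERIV f z :> D \<Longrightarrow> grad f z = D"
  unfolding grad_def by (rule the_equality) (auto intro: GDERIV_unique)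

lemma GDERIV_grad:
  fixes f :: "'z::euclidean_space \<Rightarrow> real"
  assumes "f differentiable (at z)"
  shows "GDERIV f z :> grad f z"
proof -
  obtain f' where f': "(f has_derivative f') (at z)"
    using assms by (auto simp: differentiable_def)
  interpret f': bounded_linear f' using f' by (rule has_derivative_bounded_linear)
  define D where "D = (\<Sum>b\<in>Basis. f' b *\<^sub>R b)"
  have "f' h = h \<bullet> D" for h
  proof -
    have "f' h = f' (\<Sum>b\<in>Basis. (h \<bullet> b) *\<^sub>R b)" by (simp add: euclidean_representation)
    also have "\<dots> = h \<bullet> D"
      by (simp add: f'.sum f'.scaleR D_def inner_sum_right mult.commute)
    finally show ?thesis .
  qed
  then have "f' = (\<lambda>h. h \<bullet> D)" by auto
  with f' have "GDERIV f z :> D" by (simp add: gderiv_def)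
  then show ?thesis using grad_eqI by metis
qed

lemma GDERIV_along_line:
  fixes f :: "'z::euclidean_space \<Rightarrow> real"
  assumes "GDERIV f (z + t *\<^sub>R \<zeta>) :> D"
  shows "((\<lambda>t. f (z + t *\<^sub>R \<zeta>)) has_real_derivative D \<bullet> \<zeta>) (at t)"
proof -
  have "((\<lambda>t. f (z + t *\<^sub>R \<zeta>)) has_derivative (\<lambda>s. (s *\<^sub>R \<zeta>) \<bullet> D)) (at t)"
    using assms unfolding gderiv_def
    by (rule has_derivative_compose[rotated]) (auto intro!: derivative_eq_intros)
  then show ?thesis
    by (rule has_derivative_imp_has_field_derivative) (simp add: inner_commute)
qed

section \<open>Wasserstein convergence\<close>

lemma borel_measurable_fst_snd [measurable]:
  "fst \<in> borel_measurable (borel :: ('a::topological_space \<times> 'b::topological_space) measure)"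
  "snd \<in> borel_measurable (borel :: ('a::topological_space \<times> 'b::topological_space) measure)"
  by (intro borel_measurable_continuous_onI continuous_intros)+

lemma distr_Pair_in_couplings:
  fixes X Y :: "'a \<Rightarrow> real^'n"
  assumes "prob_space M" and [measurable]: "X \<in> borel_measurable M" "Y \<in> borel_measurable M"
  shows "distr M borel (\<lambda>\<omega>. (X \<omega>, Y \<omega>)) \<in> couplings (distr M borel X) (distr M borel Y)"
proof -
  interpret prob_space M by fact
  show ?thesis
    unfolding couplings_def
    by (auto intro!: prob_space_distr simp: distr_distr comp_def)
qed

text \<open>The joint law of \<open>X\<close> and \<open>Y\<close> is a competitor in the infimum.
  It also gives nonnegativity, since it shows that the infimum is over a nonempty set.\<close>

lemma W2_distr_le:
  fixes X Y :: "'a \<Rightarrow> real^'n"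
  assumes "prob_space M" and [measurable]: "X \<in> borel_measurable M" "Y \<in> borel_measurable M"
  shows "W2 (distr M borel X) (distr M borel Y) \<le> sqrt (\<integral>\<omega>. (dist (X \<omega>) (Y \<omega>))\<^sup>2 \<partial>M)"
    and "0 \<le> W2 (distr M borel X) (distr M borel Y)"
proof -
  note * = distr_Pair_in_couplings[OF assms]
  have "(INF \<gamma>\<in>couplings (distr M borel X) (distr M borel Y). \<integral>z. (dist (fst z) (snd z))\<^sup>2 \<partial>\<gamma>)
    \<le> (\<integral>z. (dist (fst z) (snd z))\<^sup>2 \<partial>distr M borel (\<lambda>\<omega>. (X \<omega>, Y \<omega>)))"
    by (intro cINF_lower * bdd_belowI2[of _ 0]) simp
  also have "\<dots> = (\<integral>\<omega>. (dist (X \<omega>) (Y \<omega>))\<^sup>2 \<partial>M)"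
    by (subst integral_distr) simp_all
  finally show "W2 (distr M borel X) (distr M borel Y) \<le> sqrt (\<integral>\<omega>. (dist (X \<omega>) (Y \<omega>))\<^sup>2 \<partial>M)"
    by (simp add: W2_def)
  show "0 \<le> W2 (distr M borel X) (distr M borel Y)"
    unfolding W2_def using * by (intro real_sqrt_ge_zero cINF_greatest) auto
qed

lemma distr_in_P2:
  fixes X :: "'a \<Rightarrow> real^'n"
  assumes "prob_space M" "X \<in> L2fun M"
  shows "distr M borel X \<in> P2"
proof -
  interpret prob_space M by fact
  show ?thesis
    using assms(2) unfolding P2_def L2fun_def
    by (auto intro!: prob_space_distr simp: integrable_distr_eq)
qed

lemma W2_tendsto_0:
  fixes X :: "'a \<Rightarrow> real^'n"
  assumes "prob_space M" "X \<in> borel_measurable M" "\<And>k. Y k \<in> borel_measurable M"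
    and "((\<lambda>k. \<integral>\<omega>. (dist (X \<omega>) (Y k \<omega>))\<^sup>2 \<partial>M) \<longlongrightarrow> 0) F"
  shows "((\<lambda>k. W2 (distr M borel X) (distr M borel (Y k))) \<longlongrightarrow> 0) F"
proof (rule tendsto_sandwich)
  show "((\<lambda>k. 0 :: real) \<longlongrightarrow> 0) F" by simp
  show "((\<lambda>k. sqrt (\<integral>\<omega>. (dist (X \<omega>) (Y k \<omega>))\<^sup>2 \<partial>M)) \<longlongrightarrow> 0) F"
    using tendsto_real_sqrt[OF assms(4)] by simp
  show "\<forall>\<^sub>F k in F. 0 \<le> W2 (distr M borel X) (distr M borel (Y k))"
    "\<forall>\<^sub>F k in F. W2 (distr M borel X) (distr M borel (Y k)) \<le> sqrt (\<integral>\<omega>. (dist (X \<omega>) (Y k \<omega>))\<^sup>2 \<partial>M)"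
    using W2_distr_le[OF assms(1-3)] by auto
qed

text \<open>The filter form of joint continuity, through which all later limits in a moving measure
  are taken.\<close>

lemma jointly_continuous_tendsto:
  fixes f :: "'z::metric_space \<Rightarrow> (real^'n) measure \<Rightarrow> 'b::metric_space"
  assumes "jointly_continuous f" "(zk \<longlongrightarrow> z) F" "((\<lambda>k. W2 \<mu> (\<mu>k k)) \<longlongrightarrow> 0) F"
    and "\<mu> \<in> P2" "\<And>k. \<mu>k k \<in> P2"
  shows "((\<lambda>k. f (zk k) (\<mu>k k)) \<longlongrightarrow> f z \<mu>) F"
proof (rule tendstoI)
  fix e :: real assume "0 < e"
  then obtain d where d: "d > 0"
    "\<And>z' \<nu>. \<nu> \<in> P2 \<Longrightarrow> dist z z' < d \<Longrightarrow> W2 \<mu> \<nu> < d \<Longrightarrow> dist (f z \<mu>) (f z' \<nu>) < e"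
    using assms(1,4) unfolding jointly_continuous_def by meson
  have "\<forall>\<^sub>F k in F. dist (zk k) z < d" "\<forall>\<^sub>F k in F. W2 \<mu> (\<mu>k k) < d"
    using tendstoD[OF assms(2) d(1)] order_tendstoD(2)[OF assms(3) d(1)] by auto
  then show "\<forall>\<^sub>F k in F. dist (f (zk k) (\<mu>k k)) (f z \<mu>) < e"
    by eventually_elim (metis d(2) assms(5) dist_commute)
qed

lemma W2_self_tendsto: "\<mu> \<in> P2 \<Longrightarrow> ((\<lambda>k. W2 \<mu> \<mu>) \<longlongrightarrow> 0) F"
  using W2_tendsto_0[of \<mu> "\<lambda>x. x" "\<lambda>_ x. x" F]
  by (auto simp: P2_def distr_id2)

lemma jointly_continuous_imp_continuous:
  fixes f :: "'z::metric_space \<Rightarrow> (real^'n) measure \<Rightarrow> 'b::metric_space"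
  assumes "jointly_continuous f" "\<mu> \<in> P2"
  shows "continuous_on UNIV (\<lambda>z. f z \<mu>)"
  unfolding continuous_on_def
  using jointly_continuous_tendsto[OF assms(1) _ W2_self_tendsto assms(2)] assms(2)
  by (auto intro: tendsto_ident_at)

lemma jointly_uniformly_continuous_imp_continuous:
  "jointly_uniformly_continuous f \<Longrightarrow> jointly_continuous f"
  unfolding jointly_uniformly_continuous_def jointly_continuous_def by meson

section \<open>Finitely supported laws and their lifts\<close>

lemma pmf_L2fun: "finite (set_pmf P) \<Longrightarrow> X \<in> L2fun (measure_pmf P)"
  by (auto simp: L2fun_def integrable_measure_pmf_finite)

lemma plaw_in_P2 [simp]:
  fixes X :: "'i \<Rightarrow> real^'n"
  shows "finite (set_pmf P) \<Longrightarrow> distr (measure_pmf P) borel X \<in> P2"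
  by (intro distr_in_P2 pmf_L2fun prob_space_measure_pmf)

lemma integral_pmf_finite:
  fixes f :: "'i \<Rightarrow> 'b::{banach, second_countable_topology}"
  assumes "finite (set_pmf P)"
  shows "(\<integral>i. f i \<partial>measure_pmf P) = (\<Sum>i\<in>set_pmf P. pmf P i *\<^sub>R f i)"
  by (rule integral_measure_pmf[OF assms]) auto

lemma plaw_W2_tendsto_0:
  fixes X :: "'i \<Rightarrow> real^'n"
  assumes "finite (set_pmf P)" "\<And>i. i \<in> set_pmf P \<Longrightarrow> ((\<lambda>k. Y k i) \<longlongrightarrow> X i) F"
  shows "((\<lambda>k. W2 (distr (measure_pmf P) borel X) (distr (measure_pmf P) borel (Y k))) \<longlongrightarrow> 0) F"
proof (rule W2_tendsto_0)
  have "((\<lambda>k. \<Sum>i\<in>set_pmf P. pmf P i *\<^sub>R (dist (X i) (Y k i))\<^sup>2) \<longlongrightarrow>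
      (\<Sum>i\<in>set_pmf P. pmf P i *\<^sub>R (dist (X i) (X i))\<^sup>2)) F"
    by (intro tendsto_intros assms)
  then show "((\<lambda>k. \<integral>\<omega>. (dist (X \<omega>) (Y k \<omega>))\<^sup>2 \<partial>measure_pmf P) \<longlongrightarrow> 0) F"
    by (simp add: integral_pmf_finite[OF assms(1)])
qed (auto simp: prob_space_measure_pmf)

text \<open>Lions derivatives are tested with random variables on the unit interval, so an index
  with law \<open>P\<close> has to be realised there. The support is encoded in the naturals, the
  quantile function of the resulting real law is taken on the open interval, and its values are
  decoded.\<close>

lemma exists_lift:
  fixes P :: "'i pmf"
  obtains J where "J \<in> measurable Om (count_space UNIV)" "distr Om (count_space UNIV) J = measure_pmf P"
proof -
  define S where "S = set_pmf P"
  define \<iota> where "\<iota> i = real (to_nat_on S i)" for i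
  define dec where "dec x = from_nat_into S (nat \<lfloor>x\<rfloor>)" for x :: real
  have dec\<iota>: "dec (\<iota> i) = i" if "i \<in> S" for i
    using that by (simp add: dec_def \<iota>_def S_def countable_set_pmf)
  define N where "N = distr (measure_pmf P) borel \<iota>"
  interpret N: real_distribution N
    unfolding N_def by (rule prob_space.real_distribution_distr[OF prob_space_measure_pmf]) simp
  interpret cdf_distribution N ..
  have dec_meas [measurable]: "dec \<in> measurable borel (count_space UNIV)"
    unfolding dec_def by measurable
  \<comment> \<open>The quantile function represents the law on the open interval; the value at all
    other points is arbitrary, since the two endpoints are null.\<close>
  define J where "J \<omega> = (if \<omega> \<in> {0<..<1} then dec (I \<omega>) else from_nat_into S 0)" for \<omega>
  have I_meas: "I \<in> borel_measurable (restrict_space lborel {0<..<1})"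
    by (subst measurable_cong_sets[OF sets_restrict_space_cong[OF sets_lborel] refl]) (rule measurable_CI)
  have J_meas0: "J \<in> measurable lborel (count_space UNIV)"
    unfolding J_def
    using measurable_compose[OF I_meas dec_meas]
    by (subst measurable_If_restrict_space_iff) (auto simp: greaterThanLessThan_def greaterThan_def lessThan_def Int_def)
  then have J_meas: "J \<in> measurable Om (count_space UNIV)"
    unfolding Om_def by (rule measurable_restrict_space1)
  moreover have "distr Om (count_space UNIV) J = measure_pmf P"
  proof (rule measure_eqI)
    fix A assume "A \<in> sets (distr Om (count_space UNIV) J)"
    have "emeasure (distr Om (count_space UNIV) J) A = emeasure Om (J -` A \<inter> space Om)"
      by (rule emeasure_distr) (use J_meas in auto)
    also have "\<dots> = emeasure lborel (J -` A \<inter> {0..1})"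
      by (simp add: Om_def space_restrict_space emeasure_restrict_space)
    also have "\<dots> = emeasure lborel (J -` A \<inter> {0<..<1})"
    proof (rule emeasure_eq_AE)
      show "AE x in lborel. (x \<in> J -` A \<inter> {0..1}) = (x \<in> J -` A \<inter> {0<..<1})"
        using AE_lborel_singleton[of 0] AE_lborel_singleton[of "1::real"] by eventually_elim auto
    qed (use measurable_sets[OF J_meas0, of A] in auto)
    also have "J -` A \<inter> {0<..<1} = I -` (dec -` A) \<inter> {0<..<1}"
      by (auto simp: J_def)
    also have "emeasure lborel \<dots> = emeasure (distr (restrict_space lborel {0<..<1}) borel I) (dec -` A)"
      using measurable_sets[OF dec_meas, of A] I_meas
      by (subst emeasure_distr) (auto simp: space_restrict_space emeasure_restrict_space)
    also have "\<dots> = emeasure N (dec -` A)"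
      by (simp add: distr_I_eq_M)
    also have "\<dots> = emeasure (measure_pmf P) (\<iota> -` dec -` A)"
      using measurable_sets[OF dec_meas, of A] by (simp add: N_def emeasure_distr)
    also have "\<dots> = emeasure (measure_pmf P) A"
      by (rule emeasure_eq_AE) (auto simp: AE_measure_pmf_iff dec\<iota> S_def)
    finally show "emeasure (distr Om (count_space UNIV) J) A = emeasure (measure_pmf P) A" .
  qed simp
  ultimately show ?thesis using that by blast
qed

section \<open>Differentiation along finitely supported laws\<close>

text \<open>Composition with the lifted index turns the moving configuration into \<open>X\<close>
  plus the perturbation \<open>t *\<^sub>R V\<close>, whose norm in the lift is
  \<open>\<bar>t\<bar> * K\<close>. The Frechet remainder divided by \<open>t\<close> therefore
  vanishes.\<close>

lemma lions_derivative_line: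
  fixes U :: "(real^'n) measure \<Rightarrow> real" and X V :: "'i \<Rightarrow> real^'n" and P :: "'i pmf"
  assumes g: "has_lions_derivative U g" and fin: "finite (set_pmf P)"
  defines "m t \<equiv> distr (measure_pmf P) borel (\<lambda>i. X i + t *\<^sub>R V i)"
  shows "((\<lambda>t. (U (m t) - U (m 0)) / t) \<longlongrightarrow> (\<integral>i. g (m 0) (X i) \<bullet> V i \<partial>measure_pmf P)) (at 0)"
proof (rule tendstoI)
  obtain J where J: "J \<in> measurable Om (count_space UNIV)"
    "distr Om (count_space UNIV) J = measure_pmf P" by (rule exists_lift)
  have meas: "(\<lambda>\<omega>. w (J \<omega>)) \<in> borel_measurable Om" for w :: "'i \<Rightarrow> 'b::topological_space"
    by (rule measurable_compose[OF J(1)]) simp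
  have law: "Law (\<lambda>\<omega>. w (J \<omega>)) = distr (measure_pmf P) borel w" for w :: "'i \<Rightarrow> real^'n"
    unfolding Law_def J(2)[symmetric] by (subst distr_distr[OF _ J(1)]) (auto simp: comp_def)
  have int: "(\<integral>\<omega>. w (J \<omega>) \<partial>Om) = (\<integral>i. w i \<partial>measure_pmf P)" for w :: "'i \<Rightarrow> real"
    unfolding J(2)[symmetric] by (rule integral_distr[OF J(1), symmetric]) simp
  have L2: "(\<lambda>\<omega>. w (J \<omega>)) \<in> L2fun Om" for w :: "'i \<Rightarrow> real^'n"
  proof -
    have "integrable (distr Om (count_space UNIV) J) (\<lambda>i. (norm (w i))\<^sup>2)"
      unfolding J(2) by (rule integrable_measure_pmf_finite[OF fin])
    then show ?thesis
      using meas[of w] by (simp add: L2fun_def integrable_distr_eq[OF J(1)])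
  qed
  define K where "K = L2norm (measure_pmf P) V"
  have K: "0 \<le> K" by (simp add: K_def L2norm_def)
  have L2n: "L2norm Om (\<lambda>\<omega>. t *\<^sub>R V (J \<omega>)) = \<bar>t\<bar> * K" for t
    using int[of "\<lambda>i. (norm (V i))\<^sup>2"]
    by (simp add: L2norm_def K_def power_mult_distrib real_sqrt_mult)
  have m0: "m 0 = distr (measure_pmf P) borel X" by (simp add: m_def)
  fix e :: real assume e: "0 < e"
  \<comment> \<open>The 1 keeps \<open>e' * K < e\<close> meaningful when the direction vanishes and
    \<open>K = 0\<close>.\<close>
  define e' where "e' = e / (K + 1)"
  have e': "e' > 0" "e' * K < e"
    using e K by (auto simp: e'_def field_simps intro!: add_pos_nonneg)
  obtain d where d: "d > 0" "\<And>\<eta>. \<eta> \<in> L2fun Om \<Longrightarrow> L2norm Om \<eta> < d \<Longrightarrow>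
      \<bar>U (Law (\<lambda>\<omega>. X (J \<omega>) + \<eta> \<omega>)) - U (Law (\<lambda>\<omega>. X (J \<omega>)))
        - (\<integral>\<omega>. g (Law (\<lambda>\<omega>. X (J \<omega>))) (X (J \<omega>)) \<bullet> \<eta> \<omega> \<partial>Om)\<bar> \<le> e' * L2norm Om \<eta>"
    using g L2[of X] e' unfolding has_lions_derivative_def by meson
  have "((\<lambda>t. \<bar>t\<bar> * K) \<longlongrightarrow> \<bar>0\<bar> * K) (at 0)" by (intro tendsto_intros)
  then have "\<forall>\<^sub>F t in at 0. \<bar>t\<bar> * K < d"
    using d(1) by (intro order_tendstoD(2)[where y="\<bar>0\<bar> * K"]) auto
  moreover have "\<forall>\<^sub>F t in at 0. t \<noteq> (0::real)" by (rule eventually_neq_at_within)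
  ultimately show "\<forall>\<^sub>F t in at 0. dist ((U (m t) - U (m 0)) / t) (\<integral>i. g (m 0) (X i) \<bullet> V i \<partial>measure_pmf P) < e"
  proof eventually_elim
    case (elim t)
    have "\<bar>U (m t) - U (m 0) - t * (\<integral>i. g (m 0) (X i) \<bullet> V i \<partial>measure_pmf P)\<bar> \<le> e' * (\<bar>t\<bar> * K)"
      using d(2)[OF L2[of "\<lambda>i. t *\<^sub>R V i"]] elim(1)
      unfolding L2n law law[of "\<lambda>i. X i + t *\<^sub>R V i"]
        int[of "\<lambda>i. g (distr (measure_pmf P) borel X) (X i) \<bullet> t *\<^sub>R V i"] m0
      by (simp add: m_def)
    also have "\<dots> = (e' * K) * \<bar>t\<bar>" by simp
    also have "\<dots> < e * \<bar>t\<bar>" using e' elim by (intro mult_strict_right_mono) auto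
    finally have "\<bar>U (m t) - U (m 0) - t * (\<integral>i. g (m 0) (X i) \<bullet> V i \<partial>measure_pmf P)\<bar> / \<bar>t\<bar> < e"
      using elim(2) by (simp add: divide_less_eq)
    also have "\<bar>U (m t) - U (m 0) - t * (\<integral>i. g (m 0) (X i) \<bullet> V i \<partial>measure_pmf P)\<bar> / \<bar>t\<bar>
      = \<bar>(U (m t) - U (m 0)) / t - (\<integral>i. g (m 0) (X i) \<bullet> V i \<partial>measure_pmf P)\<bar>"
      using elim(2) by (simp add: abs_divide[symmetric] diff_divide_distrib)
    finally show ?case by (simp add: dist_real_def)
  qed
qed

text \<open>Derivatives are given separately in each variable. The increment is split at the
  intermediate pair \<open>z\<close>, \<open>m t\<close>: the Euclidean part is a mean value at the
  measure \<open>m t\<close>, controlled by joint continuity of the gradient, and the measure part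
  is a Lions derivative at the fixed point \<open>z\<close>.\<close>

lemma DERIV_along_plaw_0:
  fixes f :: "'z::euclidean_space \<Rightarrow> (real^'n) measure \<Rightarrow> real" and X V :: "'i \<Rightarrow> real^'n"
  assumes f: "fully_C1 f" and g: "continuous_lions_derivative f g" and fin: "finite (set_pmf P)"
  defines "m t \<equiv> distr (measure_pmf P) borel (\<lambda>i. X i + t *\<^sub>R V i)"
  shows "((\<lambda>t. f (z + t *\<^sub>R \<zeta>) (m t)) has_real_derivative
    grad (\<lambda>z'. f z' (m 0)) z \<bullet> \<zeta> + (\<integral>i. g z (m 0) (X i) \<bullet> V i \<partial>measure_pmf P)) (at 0)"
proof -
  have mP2: "m t \<in> P2" for t using fin by (simp add: m_def)
  have m0: "m 0 = distr (measure_pmf P) borel X" by (simp add: m_def)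
  have G: "GDERIV (\<lambda>z'. f z' (m t)) z' :> grad (\<lambda>z'. f z' (m t)) z'" for t z'
    using f mP2 by (intro GDERIV_grad) (auto simp: fully_C1_def)
  \<comment> \<open>The mean value theorem is applied on the unit interval in \<tau>, which treats
    all signs of \<open>t\<close>, and \<open>t = 0\<close>, at once.\<close>
  have "\<exists>\<tau>>0. \<tau> < 1 \<and> f (z + t *\<^sub>R \<zeta>) (m t) - f z (m t)
      = t * (grad (\<lambda>z'. f z' (m t)) (z + \<tau> *\<^sub>R (t *\<^sub>R \<zeta>)) \<bullet> \<zeta>)" for t
  proof -
    have "\<exists>\<tau>>0. \<tau> < 1 \<and> f (z + 1 *\<^sub>R (t *\<^sub>R \<zeta>)) (m t) - f (z + 0 *\<^sub>R (t *\<^sub>R \<zeta>)) (m t)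
      = (1 - 0) * (grad (\<lambda>z'. f z' (m t)) (z + \<tau> *\<^sub>R (t *\<^sub>R \<zeta>)) \<bullet> (t *\<^sub>R \<zeta>))"
      by (rule MVT2[of 0 1 "\<lambda>\<tau>. f (z + \<tau> *\<^sub>R (t *\<^sub>R \<zeta>)) (m t)"]) (auto simp del: scaleR_scaleR inner_scaleR_right intro!: GDERIV_along_line G)
    then show ?thesis by simp
  qed
  then obtain \<tau> where \<tau>: "\<And>t. 0 < \<tau> t" "\<And>t. \<tau> t < 1"
    "\<And>t. f (z + t *\<^sub>R \<zeta>) (m t) - f z (m t)
      = t * (grad (\<lambda>z'. f z' (m t)) (z + \<tau> t *\<^sub>R (t *\<^sub>R \<zeta>)) \<bullet> \<zeta>)" by metis
  have \<tau>0: "((\<lambda>t. \<tau> t * t) \<longlongrightarrow> 0) (at 0)"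
  proof (rule Lim_null_comparison)
    show "\<forall>\<^sub>F t in at 0. norm (\<tau> t * t) \<le> \<bar>t\<bar>"
      using \<tau>(1,2) by (auto simp: abs_mult less_imp_le intro!: always_eventually mult_left_le_one_le)
    show "((\<lambda>t. \<bar>t\<bar>) \<longlongrightarrow> 0) (at (0::real))"
      using tendsto_rabs[OF tendsto_ident_at[of "0::real" UNIV]] by simp
  qed
  have "((\<lambda>t. z + (\<tau> t * t) *\<^sub>R \<zeta>) \<longlongrightarrow> z + 0 *\<^sub>R \<zeta>) (at 0)"
    by (intro tendsto_intros \<tau>0)
  then have "((\<lambda>t. z + \<tau> t *\<^sub>R (t *\<^sub>R \<zeta>)) \<longlongrightarrow> z) (at 0)" by simp
  moreover have "((\<lambda>t. W2 (m 0) (m t)) \<longlongrightarrow> 0) (at 0)"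
    unfolding m0 unfolding m_def
    by (rule plaw_W2_tendsto_0[OF fin]) (auto intro!: tendsto_eq_intros)
  ultimately have "((\<lambda>t. grad (\<lambda>z'. f z' (m t)) (z + \<tau> t *\<^sub>R (t *\<^sub>R \<zeta>))) \<longlongrightarrow> grad (\<lambda>z'. f z' (m 0)) z) (at 0)"
    using f mP2 by (intro jointly_continuous_tendsto[where f="\<lambda>z \<mu>. grad (\<lambda>z'. f z' \<mu>) z"])
      (auto simp: fully_C1_def)
  then have A: "((\<lambda>t. grad (\<lambda>z'. f z' (m t)) (z + \<tau> t *\<^sub>R (t *\<^sub>R \<zeta>)) \<bullet> \<zeta>) \<longlongrightarrow> grad (\<lambda>z'. f z' (m 0)) z \<bullet> \<zeta>) (at 0)"
    by (intro tendsto_intros)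
  have B: "((\<lambda>t. (f z (m t) - f z (m 0)) / t) \<longlongrightarrow> (\<integral>i. g z (m 0) (X i) \<bullet> V i \<partial>measure_pmf P)) (at 0)"
    unfolding m_def
    by (rule lions_derivative_line[OF _ fin]) (use g in \<open>auto simp: continuous_lions_derivative_def\<close>)
  have "((\<lambda>t. (f (z + t *\<^sub>R \<zeta>) (m t) - f z (m 0)) / t) \<longlongrightarrow>
    grad (\<lambda>z'. f z' (m 0)) z \<bullet> \<zeta> + (\<integral>i. g z (m 0) (X i) \<bullet> V i \<partial>measure_pmf P)) (at 0)"
  proof (rule Lim_transform_eventually[OF tendsto_add[OF A B]])
    show "\<forall>\<^sub>F t in at 0. grad (\<lambda>z'. f z' (m t)) (z + \<tau> t *\<^sub>R (t *\<^sub>R \<zeta>)) \<bullet> \<zeta> + (f z (m t) - f z (m 0)) / t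
      = (f (z + t *\<^sub>R \<zeta>) (m t) - f z (m 0)) / t"
    proof (rule eventually_mono[OF eventually_neq_at_within[of 0]])
      fix t :: real assume "t \<noteq> 0"
      then have "grad (\<lambda>z'. f z' (m t)) (z + \<tau> t *\<^sub>R (t *\<^sub>R \<zeta>)) \<bullet> \<zeta> = (f (z + t *\<^sub>R \<zeta>) (m t) - f z (m t)) / t"
        using \<tau>(3)[of t] by simp
      then show "grad (\<lambda>z'. f z' (m t)) (z + \<tau> t *\<^sub>R (t *\<^sub>R \<zeta>)) \<bullet> \<zeta> + (f z (m t) - f z (m 0)) / t
        = (f (z + t *\<^sub>R \<zeta>) (m t) - f z (m 0)) / t"
        by (simp add: add_divide_distrib[symmetric])
    qed
  qed
  then show ?thesis
    by (simp add: DERIV_def)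
qed

lemma DERIV_along_plaw:
  fixes f :: "'z::euclidean_space \<Rightarrow> (real^'n) measure \<Rightarrow> real" and X V :: "'i \<Rightarrow> real^'n"
  assumes f: "fully_C1 f" and g: "continuous_lions_derivative f g" and fin: "finite (set_pmf P)"
  defines "m t \<equiv> distr (measure_pmf P) borel (\<lambda>i. X i + t *\<^sub>R V i)"
  shows "((\<lambda>t. f (z + t *\<^sub>R \<zeta>) (m t)) has_real_derivative
    grad (\<lambda>z'. f z' (m t)) (z + t *\<^sub>R \<zeta>) \<bullet> \<zeta>
      + (\<integral>i. g (z + t *\<^sub>R \<zeta>) (m t) (X i + t *\<^sub>R V i) \<bullet> V i \<partial>measure_pmf P)) (at t)"
proof -
  have "((\<lambda>s. f (z + (t + s) *\<^sub>R \<zeta>) (m (t + s))) has_real_derivative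
    grad (\<lambda>z'. f z' (m t)) (z + t *\<^sub>R \<zeta>) \<bullet> \<zeta>
      + (\<integral>i. g (z + t *\<^sub>R \<zeta>) (m t) (X i + t *\<^sub>R V i) \<bullet> V i \<partial>measure_pmf P)) (at 0)"
    using DERIV_along_plaw_0[OF f g fin, where z="z + t *\<^sub>R \<zeta>" and \<zeta>=\<zeta> and X="\<lambda>i. X i + t *\<^sub>R V i" and V=V]
    by (simp add: m_def scaleR_add_left add.assoc)
  then show ?thesis
    using DERIV_shift[of "\<lambda>s. f (z + s *\<^sub>R \<zeta>) (m s)" _ 0 t] by (simp add: add.commute)
qed

lemma lions_derivative_lions:
  "fully_C1 f \<Longrightarrow> continuous_lions_derivative f (lions f)"
  unfolding lions_def fully_C1_def by (metis someI_ex)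

text \<open>Schwarz with one parameter moving \<open>z\<close> along \<open>b\<close> and the other
  moving the points along \<open>V\<close>. The left side differentiates the gradient in the
  measure, the right side differentiates the Lions derivative in \<open>z\<close>; they are compared
  only after integration against \<open>V\<close>.\<close>

lemma lions_grad_commute:
  fixes f :: "'z::euclidean_space \<Rightarrow> (real^'n) measure \<Rightarrow> real" and X V :: "'i \<Rightarrow> real^'n"
  assumes f: "fully_C2 f" and b: "b \<in> Basis" and fin: "finite (set_pmf P)"
    and g: "continuous_lions_derivative (\<lambda>z \<mu>. grad (\<lambda>z'. f z' \<mu>) z \<bullet> b) g"
  defines "m \<equiv> distr (measure_pmf P) borel X"
  shows "(\<integral>i. g z m (X i) \<bullet> V i \<partial>measure_pmf P) =
    (\<integral>i. (\<Sum>k\<in>UNIV. V i $ k * (grad (\<lambda>(z, y). lions f z m y $ k) (z, X i) \<bullet> (b, 0))) \<partial>measure_pmf P)"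
proof -
  have f1: "fully_C1 f" and fb: "fully_C1 (\<lambda>z \<mu>. grad (\<lambda>z'. f z' \<mu>) z \<bullet> b)"
    and fl: "fully_C1 (\<lambda>(z, y) \<mu>. lions f z \<mu> y $ k)" for k
    using f b by (auto simp: fully_C2_def)
  note fl' = fl[unfolded case_prod_beta]
  define mt where "mt t = distr (measure_pmf P) borel (\<lambda>i. X i + t *\<^sub>R V i)" for t
  have mP2: "mt t \<in> P2" for t using fin by (simp add: mt_def)
  have mt0: "mt 0 = m" by (simp add: mt_def m_def)
  define l where "l k = (\<lambda>z \<mu>. grad (\<lambda>zy. lions f (fst zy) \<mu> (snd zy) $ k) z)" for k
  define h where "h s t = f (z + s *\<^sub>R b) (mt t)" for s t
  define hs where "hs s t = grad (\<lambda>z'. f z' (mt t)) (z + s *\<^sub>R b) \<bullet> b" for s t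
  define ht where "ht s t = (\<Sum>i\<in>set_pmf P. pmf P i * (\<Sum>k\<in>UNIV. lions f (z + s *\<^sub>R b) (mt t) (X i + t *\<^sub>R V i) $ k * V i $ k))" for s t
  define hst where "hst s t = (\<Sum>i\<in>set_pmf P. pmf P i * (g (z + s *\<^sub>R b) (mt t) (X i + t *\<^sub>R V i) \<bullet> V i))" for s t
  define hts where "hts s t = (\<Sum>i\<in>set_pmf P. pmf P i * (\<Sum>k\<in>UNIV. (l k (z + s *\<^sub>R b, X i + t *\<^sub>R V i) (mt t) \<bullet> (b, 0)) * V i $ k))" for s t
  have limz: "((\<lambda>w. z + fst w *\<^sub>R b) \<longlongrightarrow> z) (at ((0::real), (0::real)))"
    by (auto intro!: tendsto_eq_intros)
  have limX: "((\<lambda>w. X i + snd w *\<^sub>R V i) \<longlongrightarrow> X i) (at ((0::real), (0::real)))" for i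
    by (auto intro!: tendsto_eq_intros)
  have limW: "((\<lambda>w. W2 m (mt (snd w))) \<longlongrightarrow> 0) (at ((0::real), (0::real)))"
    unfolding m_def mt_def by (rule plaw_W2_tendsto_0[OF fin limX])
  have mP2': "m \<in> P2" using mP2[of 0] by (simp add: mt0)
  have jcg: "jointly_continuous (\<lambda>(z, y) \<mu>. g z \<mu> y)"
    using g by (simp add: continuous_lions_derivative_def)
  have jcl: "jointly_continuous (l k)" for k
    using fl'[of k] by (simp add: fully_C1_def l_def)
  have "hst 0 0 = hts 0 0"
  proof (rule mixed_derivatives_eq[of h hs ht hst hts])
    show "((\<lambda>s. h s t) has_real_derivative hs s t) (at s)" for s t
      unfolding h_def hs_def
      by (intro GDERIV_along_line GDERIV_grad) (use f1 mP2 in \<open>auto simp: fully_C1_def\<close>)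
    \<comment> \<open>Choosing \<open>\<zeta> = 0\<close> freezes the Euclidean variable, leaving
      only the Lions term.\<close>
    show "((\<lambda>t. h s t) has_real_derivative ht s t) (at t)" for s t
      using DERIV_along_plaw[OF f1 lions_derivative_lions[OF f1] fin, where z="z + s *\<^sub>R b" and \<zeta>=0 and X=X and V=V and t=t]
      by (simp add: h_def ht_def mt_def integral_pmf_finite[OF fin] inner_vec_def)
    show "((\<lambda>t. hs s t) has_real_derivative hst s t) (at t)" for s t
      using DERIV_along_plaw[OF fb g fin, where z="z + s *\<^sub>R b" and \<zeta>=0 and X=X and V=V and t=t]
      by (simp add: hs_def hst_def mt_def integral_pmf_finite[OF fin])
    show "((\<lambda>s. ht s t) has_real_derivative hts s t) (at s)" for s t
    proof -
      have D: "((\<lambda>s. lions f (z + s *\<^sub>R b) (mt t) y $ k) has_real_derivative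
        l k (z + s *\<^sub>R b, y) (mt t) \<bullet> (b, 0)) (at s)" for k y
      proof -
        have "GDERIV (\<lambda>zy. lions f (fst zy) (mt t) (snd zy) $ k) ((z, y) + s *\<^sub>R (b, 0)) :> l k ((z, y) + s *\<^sub>R (b, 0)) (mt t)"
          unfolding l_def by (intro GDERIV_grad) (use fl'[of k] mP2 in \<open>auto simp: fully_C1_def\<close>)
        from GDERIV_along_line[OF this] show ?thesis by simp
      qed
      show ?thesis
        unfolding ht_def hts_def
        by (rule DERIV_sum, rule DERIV_cmult, rule DERIV_sum, rule DERIV_cmult_right, rule D)
    qed
    show "isCont (\<lambda>w. hst (fst w) (snd w)) (0, 0)"
      unfolding isCont_def hst_def
    proof (intro tendsto_sum tendsto_mult tendsto_inner tendsto_const)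
      fix i
      have "((\<lambda>w. (\<lambda>(z, y) \<mu>. g z \<mu> y) (z + fst w *\<^sub>R b, X i + snd w *\<^sub>R V i) (mt (snd w))) \<longlongrightarrow>
         (\<lambda>(z, y) \<mu>. g z \<mu> y) (z, X i) m) (at (0, 0))"
        by (rule jointly_continuous_tendsto[OF jcg tendsto_Pair[OF limz limX] limW mP2' mP2])
      then show "((\<lambda>w. g (z + fst w *\<^sub>R b) (mt (snd w)) (X i + snd w *\<^sub>R V i)) \<longlongrightarrow>
         g (z + fst (0, 0) *\<^sub>R b) (mt (snd (0, 0))) (X i + snd (0, 0) *\<^sub>R V i)) (at (0, 0))"
        by (simp add: mt0)
    qed
    show "isCont (\<lambda>w. hts (fst w) (snd w)) (0, 0)"
      unfolding isCont_def hts_def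
    proof (intro tendsto_sum tendsto_mult tendsto_inner tendsto_const)
      fix i k
      have "((\<lambda>w. l k (z + fst w *\<^sub>R b, X i + snd w *\<^sub>R V i) (mt (snd w))) \<longlongrightarrow> l k (z, X i) m) (at (0, 0))"
        by (rule jointly_continuous_tendsto[OF jcl tendsto_Pair[OF limz limX] limW mP2' mP2])
      then show "((\<lambda>w. l k (z + fst w *\<^sub>R b, X i + snd w *\<^sub>R V i) (mt (snd w))) \<longlongrightarrow>
         l k (z + fst (0, 0) *\<^sub>R b, X i + snd (0, 0) *\<^sub>R V i) (mt (snd (0, 0)))) (at (0, 0))"
        by (simp add: mt0)
    qed
  qed
  then show ?thesis
    by (simp add: hst_def hts_def mt0 integral_pmf_finite[OF fin] l_def case_prod_unfold mult.commute)
qed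

text \<open>The same Schwarz lemma with both parameters Euclidean and the measure frozen.\<close>

lemma grad_grad_symmetric:
  fixes f :: "'z::euclidean_space \<Rightarrow> (real^'n) measure \<Rightarrow> real"
  assumes f: "fully_C2 f" and b: "b \<in> Basis" and c: "c \<in> Basis" and \<mu>: "\<mu> \<in> P2"
  shows "grad (\<lambda>z. grad (\<lambda>z'. f z' \<mu>) z \<bullet> b) z \<bullet> c = grad (\<lambda>z. grad (\<lambda>z'. f z' \<mu>) z \<bullet> c) z \<bullet> b"
proof -
  have f1: "fully_C1 f" and fb: "fully_C1 (\<lambda>z \<mu>. grad (\<lambda>z'. f z' \<mu>) z \<bullet> b)"
    and fc: "fully_C1 (\<lambda>z \<mu>. grad (\<lambda>z'. f z' \<mu>) z \<bullet> c)"
    using f b c by (auto simp: fully_C2_def)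
  define G where "G = (\<lambda>b z. grad (\<lambda>z. grad (\<lambda>z'. f z' \<mu>) z \<bullet> b) z)"
  have lim: "((\<lambda>w. z + fst w *\<^sub>R b + snd w *\<^sub>R c) \<longlongrightarrow> z) (at ((0::real), (0::real)))"
    by (auto intro!: tendsto_eq_intros)
  have cG: "((\<lambda>w. G a (z + fst w *\<^sub>R b + snd w *\<^sub>R c)) \<longlongrightarrow> G a z) (at ((0::real), (0::real)))"
    if "fully_C1 (\<lambda>z \<mu>. grad (\<lambda>z'. f z' \<mu>) z \<bullet> a)" for a
    using jointly_continuous_tendsto[OF _ lim W2_self_tendsto[OF \<mu>] \<mu> \<mu>] that
    unfolding G_def fully_C1_def by blast
  have G: "GDERIV (\<lambda>z. grad (\<lambda>z'. f z' \<mu>) z \<bullet> a) z :> G a z"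
    if "fully_C1 (\<lambda>z \<mu>. grad (\<lambda>z'. f z' \<mu>) z \<bullet> a)" for a z
    unfolding G_def by (rule GDERIV_grad) (use that \<mu> in \<open>auto simp: fully_C1_def\<close>)
  have D: "GDERIV (\<lambda>z'. f z' \<mu>) z :> grad (\<lambda>z'. f z' \<mu>) z" for z
    by (rule GDERIV_grad) (use f1 \<mu> in \<open>auto simp: fully_C1_def\<close>)
  have "G b (z + 0 *\<^sub>R b + 0 *\<^sub>R c) \<bullet> c = G c (z + 0 *\<^sub>R b + 0 *\<^sub>R c) \<bullet> b"
  proof (rule mixed_derivatives_eq[of "\<lambda>s t. f (z + s *\<^sub>R b + t *\<^sub>R c) \<mu>"
        "\<lambda>s t. grad (\<lambda>z'. f z' \<mu>) (z + s *\<^sub>R b + t *\<^sub>R c) \<bullet> b"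
        "\<lambda>s t. grad (\<lambda>z'. f z' \<mu>) (z + s *\<^sub>R b + t *\<^sub>R c) \<bullet> c"
        "\<lambda>s t. G b (z + s *\<^sub>R b + t *\<^sub>R c) \<bullet> c" "\<lambda>s t. G c (z + s *\<^sub>R b + t *\<^sub>R c) \<bullet> b"])
    show "((\<lambda>s. f (z + s *\<^sub>R b + t *\<^sub>R c) \<mu>) has_real_derivative
      grad (\<lambda>z'. f z' \<mu>) (z + s *\<^sub>R b + t *\<^sub>R c) \<bullet> b) (at s)" for s t
      using GDERIV_along_line[OF D, where z="z + t *\<^sub>R c" and t=s and \<zeta>=b] by (simp add: add_ac)
    show "((\<lambda>s. grad (\<lambda>z'. f z' \<mu>) (z + s *\<^sub>R b + t *\<^sub>R c) \<bullet> c) has_real_derivative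
      G c (z + s *\<^sub>R b + t *\<^sub>R c) \<bullet> b) (at s)" for s t
      using GDERIV_along_line[OF G[OF fc], where z="z + t *\<^sub>R c" and t=s and \<zeta>=b] by (simp add: add_ac)
    show "((\<lambda>t. grad (\<lambda>z'. f z' \<mu>) (z + s *\<^sub>R b + t *\<^sub>R c) \<bullet> b) has_real_derivative
      G b (z + s *\<^sub>R b + t *\<^sub>R c) \<bullet> c) (at t)" for s t
      by (rule GDERIV_along_line[OF G[OF fb]])
    show "isCont (\<lambda>w. G b (z + fst w *\<^sub>R b + snd w *\<^sub>R c) \<bullet> c) (0, 0)"
      "isCont (\<lambda>w. G c (z + fst w *\<^sub>R b + snd w *\<^sub>R c) \<bullet> b) (0, 0)"
      using cG[OF fb] cG[OF fc] unfolding isCont_def by (auto intro!: tendsto_intros)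
  qed (rule GDERIV_along_line[OF D])
  then show ?thesis by (simp add: G_def)
qed

lemma fully_C1_differentiable:
  "fully_C1 f \<Longrightarrow> \<mu> \<in> P2 \<Longrightarrow> (\<lambda>z. f z \<mu>) differentiable (at z)"
  unfolding fully_C1_def by blast

lemma jacobian_mult_vector:
  fixes f :: "real^'n \<Rightarrow> real^'m"
  assumes "(f has_derivative f') (at y)"
  shows "jacobian f (at y) *v h = f' h"
  using assms jacobian_works[of f "at y"] has_derivative_unique[of f f' y]
  by (metis differentiableI)

section \<open>The linearised monotonicity form\<close>

text \<open>The displacement form of the shifted Hamiltonian, in the momenta \<open>Q\<close>,
  \<open>R\<close> of \<open>H\<close>. The joint law of \<open>X\<close> and \<open>Y\<close> plays
  the part of the coupling, and the momenta are functions on the sample space, so that a coupling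
  and a finite index set are covered alike.\<close>

definition disp_form ::
  "'n::finite hamiltonian \<Rightarrow> real \<Rightarrow> 'a measure \<Rightarrow> ('a \<Rightarrow> real^'n) \<Rightarrow> ('a \<Rightarrow> real^'n) \<Rightarrow>
    ('a \<Rightarrow> real^'n) \<Rightarrow> ('a \<Rightarrow> real^'n) \<Rightarrow> real" where
  "disp_form H \<alpha> M X Y Q R =
    (let \<mu> = distr M borel X; \<nu> = distr M borel Y in
      \<integral>\<omega>. ((2 * \<alpha>) *\<^sub>R (dp H (X \<omega>) \<mu> (Q \<omega>) - dp H (Y \<omega>) \<nu> (R \<omega>))
            - (dx H (X \<omega>) \<mu> (Q \<omega>) - dx H (Y \<omega>) \<nu> (R \<omega>))) \<bullet> (X \<omega> - Y \<omega>)
        + (dp H (X \<omega>) \<mu> (Q \<omega>) - dp H (Y \<omega>) \<nu> (R \<omega>)) \<bullet> (Q \<omega> - R \<omega>) \<partial>M)"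

text \<open>The arguments \<open>a\<close> and \<open>b\<close> stand for the integrals over \<open>y\<close> of \<open>\<partial>\<^sub>x\<^sub>\<mu> H v(y)\<close> and
  \<open>\<partial>\<^sub>p\<^sub>\<mu> H v(y)\<close>. The momenta \<open>q\<close> are those of \<open>H\<close>, after the shift by \<open>\<alpha> x\<close>.\<close>

definition quad_integrand ::
  "'n::finite hamiltonian \<Rightarrow> real \<Rightarrow> real^'n \<Rightarrow> (real^'n) measure \<Rightarrow> real^'n \<Rightarrow> real^'n \<Rightarrow> real^'n \<Rightarrow>
    real^'n \<Rightarrow> real^'n \<Rightarrow> real" where
  "quad_integrand H \<alpha> x \<mu> q v r a b =
    - (((dxx H x \<mu> q - (2 * \<alpha>) *\<^sub>R dxp H x \<mu> q) *v v + a - (2 * \<alpha>) *\<^sub>R b) \<bullet> v)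
    + (dpp H x \<mu> q *v r + b + (2 * \<alpha>) *\<^sub>R (dpp H x \<mu> q *v v)) \<bullet> r"

text \<open>\<open>V\<close> is the velocity of the points and \<open>R\<close> that of the momenta.
  Both live on the sample space, so coinciding points may have different velocities.\<close>

definition quad_form ::
  "'n::finite hamiltonian \<Rightarrow> real \<Rightarrow> 'a measure \<Rightarrow> ('a \<Rightarrow> real^'n) \<Rightarrow> ('a \<Rightarrow> real^'n) \<Rightarrow>
    ('a \<Rightarrow> real^'n) \<Rightarrow> ('a \<Rightarrow> real^'n) \<Rightarrow> real" where
  "quad_form H \<alpha> M X Q V R =
    (let \<mu> = distr M borel X in
      \<integral>\<omega>. quad_integrand H \<alpha> (X \<omega>) \<mu> (Q \<omega>) (V \<omega>) (R \<omega>)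
        (\<integral>\<omega>'. dxmu H (X \<omega>) \<mu> (X \<omega>') (Q \<omega>) *v V \<omega>' \<partial>M)
        (\<integral>\<omega>'. dpmu H (X \<omega>) \<mu> (X \<omega>') (Q \<omega>) *v V \<omega>' \<partial>M) \<partial>M)"

lemma dx_dp_of_GDERIV:
  fixes K :: "'n::finite hamiltonian"
  assumes "GDERIV (\<lambda>z. K (fst z) \<mu> (snd z)) (x, p) :> g"
  shows "dx K x \<mu> p = fst g" and "dp K x \<mu> p = snd g"
proof -
  have "((\<lambda>x'. K x' \<mu> p) has_derivative (\<lambda>h. (h, 0) \<bullet> g)) (at x)"
    by (rule has_derivative_compose[where g="\<lambda>z. K (fst z) \<mu> (snd z)" and f="\<lambda>x'. (x', p)", simplified])
      (use assms in \<open>auto simp: gderiv_def intro!: derivative_eq_intros\<close>)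
  then show "dx K x \<mu> p = fst g"
    unfolding dx_def by (intro grad_eqI) (simp add: gderiv_def inner_prod_def)
  have "((\<lambda>p'. K x \<mu> p') has_derivative (\<lambda>h. (0, h) \<bullet> g)) (at p)"
    by (rule has_derivative_compose[where g="\<lambda>z. K (fst z) \<mu> (snd z)" and f="\<lambda>p'. (x, p')", simplified])
      (use assms in \<open>auto simp: gderiv_def intro!: derivative_eq_intros\<close>)
  then show "dp K x \<mu> p = snd g"
    unfolding dp_def by (intro grad_eqI) (simp add: gderiv_def inner_prod_def)
qed

section \<open>The joint gradient of the Hamiltonian and its derivative along point
  configurations\<close>

locale smooth_hamiltonian =
  fixes H :: "real^'n \<Rightarrow> (real^'n) measure \<Rightarrow> real^'n \<Rightarrow> real"
  assumes C2: "fully_C2 (\<lambda>(x, p) \<mu>. H x \<mu> p)"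
begin

definition G :: "(real^'n) \<times> (real^'n) \<Rightarrow> (real^'n) measure \<Rightarrow> (real^'n) \<times> (real^'n)" where
  "G z \<mu> = grad (\<lambda>z. H (fst z) \<mu> (snd z)) z"

text \<open>The Hessian in \<open>(x, p)\<close> as an operator, assembled from the gradients of the
  components of \<open>G\<close> because full C2 regularity is stated for components.\<close>

definition DG :: "(real^'n) \<times> (real^'n) \<Rightarrow> (real^'n) measure \<Rightarrow> (real^'n) \<times> (real^'n) \<Rightarrow> (real^'n) \<times> (real^'n)" where
  "DG z \<mu> \<zeta> = (\<Sum>b\<in>Basis. (grad (\<lambda>z. G z \<mu> \<bullet> b) z \<bullet> \<zeta>) *\<^sub>R b)"

lemma H_uncurry: "(\<lambda>(x, p) \<mu>. H x \<mu> p) = (\<lambda>z \<mu>. H (fst z) \<mu> (snd z))"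
  by (simp add: case_prod_unfold)

lemma C2': "fully_C2 (\<lambda>z \<mu>. H (fst z) \<mu> (snd z))"
  using C2 by (simp only: H_uncurry)

lemma C1: "fully_C1 (\<lambda>z \<mu>. H (fst z) \<mu> (snd z))"
  and C1_G: "b \<in> Basis \<Longrightarrow> fully_C1 (\<lambda>z \<mu>. G z \<mu> \<bullet> b)"
  and C1_lions: "fully_C1 (\<lambda>(z, y) \<mu>. lions (\<lambda>z \<mu>. H (fst z) \<mu> (snd z)) z \<mu> y $ k)"
  using C2' by (auto simp: fully_C2_def G_def)

lemma GDERIV_H: "\<mu> \<in> P2 \<Longrightarrow> GDERIV (\<lambda>z. H (fst z) \<mu> (snd z)) z :> G z \<mu>"
  unfolding G_def by (rule GDERIV_grad[OF fully_C1_differentiable[OF C1]])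

lemma jointly_continuous_G: "jointly_continuous G"
  using C1 by (simp add: fully_C1_def G_def[abs_def])

lemma dx_eq: "\<mu> \<in> P2 \<Longrightarrow> dx H x \<mu> p = fst (G (x, p) \<mu>)"
  and dp_eq: "\<mu> \<in> P2 \<Longrightarrow> dp H x \<mu> p = snd (G (x, p) \<mu>)"
  using dx_dp_of_GDERIV[OF GDERIV_H] by auto

lemma G_has_derivative:
  assumes "\<mu> \<in> P2"
  shows "((\<lambda>z. G z \<mu>) has_derivative DG z \<mu>) (at z)"
proof (subst has_derivative_componentwise_within, safe)
  fix b :: "(real^'n) \<times> (real^'n)" assume b: "b \<in> Basis"
  have "GDERIV (\<lambda>z. G z \<mu> \<bullet> b) z :> grad (\<lambda>z. G z \<mu> \<bullet> b) z"
    by (rule GDERIV_grad[OF fully_C1_differentiable[OF C1_G[OF b] assms]])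
  moreover have "DG z \<mu> \<zeta> \<bullet> b = \<zeta> \<bullet> grad (\<lambda>z. G z \<mu> \<bullet> b) z" for \<zeta>
    using b by (simp add: DG_def inner_commute[of \<zeta>])
  ultimately show "((\<lambda>z. G z \<mu> \<bullet> b) has_derivative (\<lambda>\<zeta>. DG z \<mu> \<zeta> \<bullet> b)) (at z)"
    by (simp add: gderiv_def)
qed

lemma DG_linear: "linear (DG z \<mu>)"
  unfolding DG_def
  by (rule linearI) (simp_all add: inner_add_right scaleR_add_left sum.distrib scaleR_sum_right)

text \<open>In coordinates both sides are the same double sum up to exchanging the two second
  partial derivatives.\<close>

lemma DG_symmetric:
  assumes "\<mu> \<in> P2"
  shows "DG z \<mu> \<zeta> \<bullet> c = DG z \<mu> c \<bullet> \<zeta>"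
proof -
  have *: "DG z \<mu> u \<bullet> w = (\<Sum>b\<in>Basis. \<Sum>a\<in>Basis. (grad (\<lambda>z. G z \<mu> \<bullet> b) z \<bullet> a) * (u \<bullet> a) * (w \<bullet> b))"
    for u w
  proof -
    have "DG z \<mu> u \<bullet> w = (\<Sum>b\<in>Basis. (grad (\<lambda>z. G z \<mu> \<bullet> b) z \<bullet> u) * (w \<bullet> b))"
      by (simp add: DG_def inner_sum_left inner_commute[of w])
    then show ?thesis
      by (simp add: euclidean_inner[of _ u] sum_distrib_right)
  qed
  show ?thesis
    unfolding * using grad_grad_symmetric[OF C2' _ _ assms]
    by (subst sum.swap) (auto simp: G_def mult_ac intro!: sum.cong)
qed

lemma dxx_eq: "dxx H x \<mu> p *v h = fst (DG (x, p) \<mu> (h, 0))"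
  and dxp_eq: "dxp H x \<mu> p *v h = fst (DG (x, p) \<mu> (0, h))"
  and dpp_eq: "dpp H x \<mu> p *v h = snd (DG (x, p) \<mu> (0, h))" if \<mu>: "\<mu> \<in> P2"
proof -
  have X: "((\<lambda>x'. G (x', p) \<mu>) has_derivative (\<lambda>h. DG (x, p) \<mu> (h, 0))) (at x)"
    by (rule has_derivative_compose[where g="\<lambda>z. G z \<mu>" and f="\<lambda>x'. (x', p)", simplified])
      (auto intro!: derivative_eq_intros G_has_derivative[OF \<mu>])
  have P: "((\<lambda>p'. G (x, p') \<mu>) has_derivative (\<lambda>h. DG (x, p) \<mu> (0, h))) (at p)"
    by (rule has_derivative_compose[where g="\<lambda>z. G z \<mu>" and f="\<lambda>p'. (x, p')", simplified])
      (auto intro!: derivative_eq_intros G_has_derivative[OF \<mu>])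
  show "dxx H x \<mu> p *v h = fst (DG (x, p) \<mu> (h, 0))"
    unfolding dxx_def dx_eq[OF \<mu>] by (rule jacobian_mult_vector) (rule has_derivative_fst[OF X])
  show "dxp H x \<mu> p *v h = fst (DG (x, p) \<mu> (0, h))"
    unfolding dxp_def dx_eq[OF \<mu>] by (rule jacobian_mult_vector) (rule has_derivative_fst[OF P])
  show "dpp H x \<mu> p *v h = snd (DG (x, p) \<mu> (0, h))"
    unfolding dpp_def dp_eq[OF \<mu>] by (rule jacobian_mult_vector) (rule has_derivative_snd[OF P])
qed

lemma dpp_symmetric:
  assumes "\<mu> \<in> P2"
  shows "transpose (dpp H x \<mu> p) = dpp H x \<mu> p"
proof -
  have "(dpp H x \<mu> p *v v) \<bullet> w = (dpp H x \<mu> p *v w) \<bullet> v" for v w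
    using DG_symmetric[OF assms, of "(x, p)" "(0, v)" "(0, w)"]
    by (simp add: dpp_eq[OF assms] inner_prod_def)
  then have "(transpose (dpp H x \<mu> p) *v v) \<bullet> w = (dpp H x \<mu> p *v v) \<bullet> w" for v w
    by (metis inner_commute inner_matrix_vector_transpose)
  then show ?thesis by (metis matrix_eq vector_eq_rdot)
qed

text \<open>The left side is the derivative of the Lions derivative in direction \<open>c\<close>,
  paired with \<open>v\<close>. Linearity splits it into the x and p parts, and the transposes in
  \<open>dxmu\<close> and \<open>dpmu\<close> move the matrices onto \<open>v\<close>.\<close>

lemma mixed_measure_derivative:
  assumes \<mu>: "\<mu> \<in> P2"
  shows "(\<Sum>k\<in>UNIV. v $ k * (grad (\<lambda>(z, y). lions (\<lambda>z \<mu>. H (fst z) \<mu> (snd z)) z \<mu> y $ k) (z, y) \<bullet> (c, 0)))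
    = fst c \<bullet> (dxmu H (fst z) \<mu> y (snd z) *v v) + snd c \<bullet> (dpmu H (fst z) \<mu> y (snd z) *v v)"
proof -
  define L where "L z = lions (\<lambda>z \<mu>. H (fst z) \<mu> (snd z)) z \<mu> y" for z
  define l where "l k = grad (\<lambda>(z, y). lions (\<lambda>z \<mu>. H (fst z) \<mu> (snd z)) z \<mu> y $ k) (z, y)" for k
  define D where "D \<zeta> = (\<chi> k. l k \<bullet> (\<zeta>, 0))" for \<zeta>
  have L: "(L has_derivative D) (at z)"
  proof (subst has_derivative_componentwise_within, safe)
    fix b :: "real^'n" assume "b \<in> Basis"
    then obtain k where b: "b = axis k 1" by (auto simp: Basis_vec_def)
    have "GDERIV (\<lambda>(z, y). lions (\<lambda>z \<mu>. H (fst z) \<mu> (snd z)) z \<mu> y $ k) (z, y) :> l k"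
      unfolding l_def
      by (rule GDERIV_grad) (use fully_C1_differentiable[OF C1_lions[of k] \<mu>] in \<open>simp add: case_prod_unfold\<close>)
    then have "((\<lambda>(z, y). lions (\<lambda>z \<mu>. H (fst z) \<mu> (snd z)) z \<mu> y $ k) has_derivative (\<lambda>h. h \<bullet> l k)) (at (z, y))"
      by (simp add: gderiv_def)
    moreover have "((\<lambda>z. (z, y)) has_derivative (\<lambda>h. (h, 0))) (at z)"
      by (auto intro!: derivative_eq_intros)
    ultimately have "((\<lambda>z. L z $ k) has_derivative (\<lambda>h. (h, 0) \<bullet> l k)) (at z)"
      using has_derivative_compose by (fastforce simp: L_def)
    then show "((\<lambda>z. L z \<bullet> b) has_derivative (\<lambda>\<zeta>. D \<zeta> \<bullet> b)) (at z)"
      by (simp add: b inner_axis D_def inner_commute[of "l k"])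
  qed
  have dmu: "dmu H x \<mu> y p = L (x, p)" for x p
    by (simp add: dmu_def L_def H_uncurry)
  have Dlin: "D (a + b) = D a + D b" for a b
    by (simp add: D_def vec_eq_iff inner_add_right[symmetric])
  have "((\<lambda>x'. L (x', snd z)) has_derivative (\<lambda>h. D (h, 0))) (at (fst z))"
    by (rule has_derivative_compose[where g=L and f="\<lambda>x'. (x', snd z)", simplified])
      (auto intro!: derivative_eq_intros L)
  from jacobian_mult_vector[OF this] have 1: "fst c \<bullet> (dxmu H (fst z) \<mu> y (snd z) *v v) = D (fst c, 0) \<bullet> v"
    unfolding dxmu_def dmu inner_matrix_vector_transpose[symmetric] by simp
  have "((\<lambda>p'. L (fst z, p')) has_derivative (\<lambda>h. D (0, h))) (at (snd z))"
    by (rule has_derivative_compose[where g=L and f="\<lambda>p'. (fst z, p')", simplified])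
      (auto intro!: derivative_eq_intros L)
  from jacobian_mult_vector[OF this] have 2: "snd c \<bullet> (dpmu H (fst z) \<mu> y (snd z) *v v) = D (0, snd c) \<bullet> v"
    unfolding dpmu_def dmu inner_matrix_vector_transpose[symmetric] by simp
  have "D (fst c, 0) \<bullet> v + D (0, snd c) \<bullet> v = D c \<bullet> v"
    unfolding inner_add_left[symmetric] Dlin[symmetric] by simp
  moreover have "D c \<bullet> v = (\<Sum>k\<in>UNIV. v $ k * (l k \<bullet> (c, 0)))"
    by (simp add: D_def inner_vec_def mult.commute)
  ultimately show ?thesis
    by (simp add: 1 2 l_def)
qed

text \<open>Each component of \<open>G\<close> has some continuous Lions derivative, which the
  commutation lemma converts into derivatives of the Lions derivative of \<open>H\<close>. Summing
  the components with the coordinates of \<open>c\<close> as weights recovers the matrices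
  \<open>dxmu\<close> and \<open>dpmu\<close>.\<close>

lemma G_DERIV_along_plaw:
  fixes X V :: "'i \<Rightarrow> real^'n"
  assumes fin: "finite (set_pmf P)"
  defines "m t \<equiv> distr (measure_pmf P) borel (\<lambda>i. X i + t *\<^sub>R V i)"
  shows "((\<lambda>t. G (z + t *\<^sub>R \<zeta>) (m t) \<bullet> c) has_real_derivative
    DG (z + t *\<^sub>R \<zeta>) (m t) \<zeta> \<bullet> c +
    (\<integral>i. fst c \<bullet> (dxmu H (fst (z + t *\<^sub>R \<zeta>)) (m t) (X i + t *\<^sub>R V i) (snd (z + t *\<^sub>R \<zeta>)) *v V i)
      + snd c \<bullet> (dpmu H (fst (z + t *\<^sub>R \<zeta>)) (m t) (X i + t *\<^sub>R V i) (snd (z + t *\<^sub>R \<zeta>)) *v V i) \<partial>measure_pmf P)) (at t)"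
proof -
  define z' where "z' = z + t *\<^sub>R \<zeta>"
  define X' where "X' i = X i + t *\<^sub>R V i" for i
  have mP2: "m t \<in> P2" for t using fin by (simp add: m_def)
  have mX': "distr (measure_pmf P) borel X' = m t" by (simp add: m_def X'_def[abs_def])
  define l where "l i k = grad (\<lambda>(z, y). lions (\<lambda>z \<mu>. H (fst z) \<mu> (snd z)) z (m t) y $ k) (z', X' i)" for i k
  have D: "((\<lambda>t. G (z + t *\<^sub>R \<zeta>) (m t) \<bullet> b) has_real_derivative
      grad (\<lambda>z. G z (m t) \<bullet> b) z' \<bullet> \<zeta> + (\<integral>i. (\<Sum>k\<in>UNIV. V i $ k * (l i k \<bullet> (b, 0))) \<partial>measure_pmf P)) (at t)"
    if b: "b \<in> Basis" for b
  proof -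
    obtain g where g: "continuous_lions_derivative (\<lambda>z \<mu>. G z \<mu> \<bullet> b) g"
      using C1_G[OF b] by (auto simp: fully_C1_def)
    show ?thesis
      using DERIV_along_plaw[OF C1_G[OF b] g fin, where z=z and \<zeta>=\<zeta> and X=X and V=V and t=t]
        lions_grad_commute[OF C2' b fin g[unfolded G_def], of z' X' V]
      by (simp add: m_def[symmetric] z'_def[symmetric] X'_def[symmetric] mX' l_def)
  qed
  have "((\<lambda>t. \<Sum>b\<in>Basis. (G (z + t *\<^sub>R \<zeta>) (m t) \<bullet> b) * (c \<bullet> b)) has_real_derivative
      (\<Sum>b\<in>Basis. (grad (\<lambda>z. G z (m t) \<bullet> b) z' \<bullet> \<zeta> +
         (\<integral>i. (\<Sum>k\<in>UNIV. V i $ k * (l i k \<bullet> (b, 0))) \<partial>measure_pmf P)) * (c \<bullet> b))) (at t)"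
    by (rule DERIV_sum, rule DERIV_cmult_right, rule D)
  moreover have "(\<Sum>b\<in>Basis. (grad (\<lambda>z. G z (m t) \<bullet> b) z' \<bullet> \<zeta> +
         (\<integral>i. (\<Sum>k\<in>UNIV. V i $ k * (l i k \<bullet> (b, 0))) \<partial>measure_pmf P)) * (c \<bullet> b))
    = DG z' (m t) \<zeta> \<bullet> c + (\<integral>i. (\<Sum>k\<in>UNIV. V i $ k * (l i k \<bullet> (c, 0))) \<partial>measure_pmf P)"
  proof -
    have *: "(\<Sum>b\<in>Basis. (\<Sum>k\<in>UNIV. V i $ k * (l i k \<bullet> (b, 0))) * (c \<bullet> b))
      = (\<Sum>k\<in>UNIV. V i $ k * (l i k \<bullet> (c, 0)))" for i
    proof -
      have "l i k \<bullet> (c, 0) = (\<Sum>b\<in>Basis. (l i k \<bullet> (b, 0)) * (c \<bullet> b))" for k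
        by (simp add: inner_Pair_0 euclidean_inner[of "fst (l i k)" c])
      then show ?thesis
        by (simp only: sum_distrib_right sum_distrib_left) (subst sum.swap, simp add: mult_ac)
    qed
    have "(\<Sum>b\<in>Basis. (\<integral>i. (\<Sum>k\<in>UNIV. V i $ k * (l i k \<bullet> (b, 0))) \<partial>measure_pmf P) * (c \<bullet> b))
      = (\<integral>i. (\<Sum>b\<in>Basis. (\<Sum>k\<in>UNIV. V i $ k * (l i k \<bullet> (b, 0))) * (c \<bullet> b)) \<partial>measure_pmf P)"
      by (simp add: integrable_measure_pmf_finite[OF fin])
    also have "\<dots> = (\<integral>i. (\<Sum>k\<in>UNIV. V i $ k * (l i k \<bullet> (c, 0))) \<partial>measure_pmf P)"
      unfolding * ..
    finally show ?thesis
      by (simp add: distrib_right sum.distrib DG_def inner_sum_right inner_commute[of _ c])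
  qed
  moreover have "(\<Sum>b\<in>Basis. (G (z + t *\<^sub>R \<zeta>) (m t) \<bullet> b) * (c \<bullet> b)) = G (z + t *\<^sub>R \<zeta>) (m t) \<bullet> c" for t
    by (simp add: euclidean_inner[of _ c])
  ultimately show ?thesis
    unfolding l_def mixed_measure_derivative[OF mP2] z'_def X'_def by simp
qed

text \<open>Paired with this test vector, the mixed Hessian contributes
  \<open>- fst (D (0, r)) \<bullet> v\<close> and \<open>snd (D (v, 0)) \<bullet> r\<close>, which
  cancel by symmetry. The part of the mixed Hessian paired with
  \<open>(2 * \<alpha>) *\<^sub>R v\<close> survives as the \<open>dxp\<close> term.\<close>

lemma quad_integrand_eq:
  assumes \<mu>: "\<mu> \<in> P2"
  shows "DG (x, q) \<mu> (v, r) \<bullet> (- v, (2 * \<alpha>) *\<^sub>R v + r) + (- v) \<bullet> a + ((2 * \<alpha>) *\<^sub>R v + r) \<bullet> b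
    = quad_integrand H \<alpha> x \<mu> q v r a b"
proof -
  define D where "D = DG (x, q) \<mu>"
  interpret D: linear D unfolding D_def by (rule DG_linear)
  have split: "D (u, w) = D (u, 0) + D (0, w)" for u w
    by (simp add: D.add[symmetric])
  have sym: "snd (D (v, 0)) \<bullet> w = fst (D (0, w)) \<bullet> v" for w
    using DG_symmetric[OF \<mu>, of "(x, q)" "(v, 0)" "(0, w)"] by (simp add: D_def inner_prod_def)
  have sym': "snd (D (0, r)) \<bullet> v = snd (D (0, v)) \<bullet> r"
    using DG_symmetric[OF \<mu>, of "(x, q)" "(0, r)" "(0, v)"] by (simp add: D_def inner_prod_def)
  have scal: "D (0, s *\<^sub>R w) = s *\<^sub>R D (0, w)" for s w
    using D.scale[of s "(0, w)"] by simp
  show ?thesis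
    unfolding quad_integrand_def dxx_eq[OF \<mu>] dxp_eq[OF \<mu>] dpp_eq[OF \<mu>]
      matrix_vector_mult_diff_rdistrib scaleR_matrix_vector_assoc[symmetric] D_def[symmetric]
    by (subst split) (simp add: inner_prod_def inner_simps sym sym' scal inner_commute[of v] inner_commute[of r] algebra_simps)
qed

text \<open>Along a segment the test vector is constant while only \<open>G\<close> moves. Hence
  increments in \<open>t\<close> are displacement forms and the derivative is the quadratic
  form.\<close>

definition line_form ::
  "real \<Rightarrow> 'i pmf \<Rightarrow> ('i \<Rightarrow> real^'n) \<Rightarrow> ('i \<Rightarrow> real^'n) \<Rightarrow> ('i \<Rightarrow> real^'n) \<Rightarrow> ('i \<Rightarrow> real^'n) \<Rightarrow> real \<Rightarrow> real" where
  "line_form \<alpha> P X Q V R t =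
    (\<integral>i. G ((X i, Q i) + t *\<^sub>R (V i, R i)) (distr (measure_pmf P) borel (\<lambda>i. X i + t *\<^sub>R V i))
      \<bullet> (- V i, (2 * \<alpha>) *\<^sub>R V i + R i) \<partial>measure_pmf P)"

lemma line_form_DERIV:
  assumes fin: "finite (set_pmf P)"
  shows "(line_form \<alpha> P X Q V R has_real_derivative
    quad_form H \<alpha> (measure_pmf P) (\<lambda>i. X i + t *\<^sub>R V i) (\<lambda>i. Q i + t *\<^sub>R R i) V R) (at t)"
proof -
  define m where "m t = distr (measure_pmf P) borel (\<lambda>i. X i + t *\<^sub>R V i)" for t
  have mP2: "m t \<in> P2" for t using fin by (simp add: m_def)
  have int: "integrable (measure_pmf P) f" for f :: "'a \<Rightarrow> 'b::{banach,second_countable_topology}"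
    by (rule integrable_measure_pmf_finite[OF fin])
  have "((\<lambda>t. G ((X i, Q i) + t *\<^sub>R (V i, R i)) (m t) \<bullet> (- V i, (2 * \<alpha>) *\<^sub>R V i + R i)) has_real_derivative
    quad_integrand H \<alpha> (X i + t *\<^sub>R V i) (m t) (Q i + t *\<^sub>R R i) (V i) (R i)
        (\<integral>j. dxmu H (X i + t *\<^sub>R V i) (m t) (X j + t *\<^sub>R V j) (Q i + t *\<^sub>R R i) *v V j \<partial>measure_pmf P)
        (\<integral>j. dpmu H (X i + t *\<^sub>R V i) (m t) (X j + t *\<^sub>R V j) (Q i + t *\<^sub>R R i) *v V j \<partial>measure_pmf P)) (at t)" for i
    using G_DERIV_along_plaw[OF fin, of "(X i, Q i)" "(V i, R i)" X V "(- V i, (2 * \<alpha>) *\<^sub>R V i + R i)" t]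
    unfolding m_def[symmetric] quad_integrand_eq[OF mP2, symmetric]
    by (simp add: Bochner_Integration.integral_add[OF int int] integral_inner_right[OF int] add.assoc
        del: inner_add_left inner_minus_left)
  then show ?thesis
    unfolding line_form_def[abs_def] quad_form_def Let_def m_def[symmetric] integral_pmf_finite[OF fin, where 'b=real]
      real_scaleR_def
    by (intro DERIV_sum DERIV_cmult) 
qed

text \<open>Gradients and positions are both subtracted as start minus end, so the two signs cancel;
  the displacement carries the factor \<open>s\<close>.\<close>

lemma disp_form_line:
  assumes fin: "finite (set_pmf P)"
  shows "disp_form H \<alpha> (measure_pmf P) X (\<lambda>i. X i + s *\<^sub>R V i) Q (\<lambda>i. Q i + s *\<^sub>R R i)
    = s * (line_form \<alpha> P X Q V R s - line_form \<alpha> P X Q V R 0)"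
proof -
  define m where "m t = distr (measure_pmf P) borel (\<lambda>i. X i + t *\<^sub>R V i)" for t
  have mP2: "m t \<in> P2" for t using fin by (simp add: m_def)
  have m0: "distr (measure_pmf P) borel X = m 0" by (simp add: m_def)
  show ?thesis
    unfolding disp_form_def line_form_def Let_def m_def[symmetric] m0 dx_eq[OF mP2] dp_eq[OF mP2]
      integral_pmf_finite[OF fin, where 'b=real] sum_subtractf[symmetric] sum_distrib_left
    by (intro sum.cong refl) (simp add: inner_prod_def inner_simps algebra_simps)
qed

text \<open>The difference quotient of the line form is the displacement form divided by the square
  of \<open>s\<close>. Only small positive \<open>s\<close> are asked for, since the endpoints are
  known to be distinct only for such \<open>s\<close>.\<close>

lemma quad_form_nonneg_of_disp_form:
  assumes fin: "finite (set_pmf P)"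
    and ev: "\<forall>\<^sub>F s in at_right 0. 0 \<le> disp_form H \<alpha> (measure_pmf P) X (\<lambda>i. X i + s *\<^sub>R V i) Q (\<lambda>i. Q i + s *\<^sub>R R i)"
  shows "0 \<le> quad_form H \<alpha> (measure_pmf P) X Q V R"
proof -
  let ?F = "line_form \<alpha> P X Q V R"
  have "((\<lambda>s. (?F s - ?F 0) / s) \<longlongrightarrow> quad_form H \<alpha> (measure_pmf P) X Q V R) (at 0)"
    using line_form_DERIV[OF fin, of \<alpha> X Q V R 0] by (simp add: DERIV_def)
  then have "((\<lambda>s. (?F s - ?F 0) / s) \<longlongrightarrow> quad_form H \<alpha> (measure_pmf P) X Q V R) (at_right 0)"
    by (rule filterlim_mono) (auto simp: at_le)
  moreover have "\<forall>\<^sub>F s in at_right 0. 0 \<le> (?F s - ?F 0) / s"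
    using ev eventually_at_right_less[of "0::real"]
    by eventually_elim (simp add: disp_form_line[OF fin] zero_le_mult_iff)
  ultimately show ?thesis
    by (rule tendsto_lowerbound) simp
qed

text \<open>The line form is nondecreasing along the segment from \<open>X\<close>, \<open>Q\<close>
  to \<open>Y\<close>, \<open>R\<close>. Points may collide on the way, so nonnegativity is assumed
  for all configurations.\<close>

lemma disp_form_nonneg_of_quad_form:
  assumes fin: "finite (set_pmf P)"
    and nn: "\<And>X Q V R. 0 \<le> quad_form H \<alpha> (measure_pmf P) X Q V R"
  shows "0 \<le> disp_form H \<alpha> (measure_pmf P) X Y Q R"
proof -
  let ?F = "line_form \<alpha> P X Q (\<lambda>i. Y i - X i) (\<lambda>i. R i - Q i)"
  have "?F 0 \<le> ?F 1"
    by (rule DERIV_nonneg_imp_nondecreasing[of 0 1 ?F, OF zero_le_one]) (use line_form_DERIV[OF fin] nn in blast)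
  then show ?thesis
    using disp_form_line[OF fin, of \<alpha> X 1 "\<lambda>i. Y i - X i" Q "\<lambda>i. R i - Q i"] by simp
qed

end

section \<open>Approximation by finitely supported laws\<close>

lemma L2fun_integrable_norm:
  assumes "prob_space M" "f \<in> L2fun M"
  shows "integrable M (\<lambda>x. norm (f x))"
proof (rule Bochner_Integration.integrable_bound)
  interpret prob_space M by fact
  show "integrable M (\<lambda>x. 1 + (norm (f x))\<^sup>2)"
    using assms(2) by (auto simp: L2fun_def)
  have "t \<le> 1 + t\<^sup>2" for t :: real
    using sum_squares_ge_zero[of "t - 1/2" 0] by (simp add: power2_eq_square algebra_simps)
  then show "AE x in M. norm (norm (f x)) \<le> norm (1 + (norm (f x))\<^sup>2)"
    by (auto simp: add_nonneg_nonneg)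
qed (use assms(2) in \<open>auto simp: L2fun_def\<close>)

lemma L2fun_simple_approx:
  fixes f :: "'a \<Rightarrow> 'b::euclidean_space"
  assumes "f \<in> L2fun M"
  obtains F where "\<And>k. simple_function M (F k)" "\<And>x. x \<in> space M \<Longrightarrow> (\<lambda>k. F k x) \<longlonglongrightarrow> f x"
    "\<And>k x. x \<in> space M \<Longrightarrow> norm (F k x) \<le> 2 * norm (f x)" "\<And>k. F k \<in> L2fun M"
proof -
  have f [measurable]: "f \<in> borel_measurable M" using assms by (simp add: L2fun_def)
  obtain F where F: "\<And>k. simple_function M (F k)" "\<And>x. x \<in> space M \<Longrightarrow> (\<lambda>k. F k x) \<longlonglongrightarrow> f x"
    "\<And>k x. x \<in> space M \<Longrightarrow> norm (F k x) \<le> 2 * norm (f x)"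
    using borel_measurable_implies_sequence_metric[OF f, of 0] by (simp add: dist_norm) metis
  have "F k \<in> L2fun M" for k
  proof -
    have "integrable M (\<lambda>x. (norm (F k x))\<^sup>2)"
    proof (rule Bochner_Integration.integrable_bound)
      show "integrable M (\<lambda>x. 4 * (norm (f x))\<^sup>2)" using assms by (simp add: L2fun_def)
      have "(norm (F k x))\<^sup>2 \<le> 4 * (norm (f x))\<^sup>2" if "x \<in> space M" for x
        using power_mono[OF F(3)[OF that, of k], of 2] by (simp add: power_mult_distrib)
      then show "AE x in M. norm ((norm (F k x))\<^sup>2) \<le> norm (4 * (norm (f x))\<^sup>2)"
        by auto
    qed (use borel_measurable_simple_function[OF F(1)] in measurable)
    then show ?thesis
      using borel_measurable_simple_function[OF F(1)] by (simp add: L2fun_def)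
  qed
  with F that show ?thesis by blast
qed

lemma W2_tendsto_0_dominated:
  fixes X :: "'a \<Rightarrow> real^'n"
  assumes M: "prob_space M" and X: "X \<in> L2fun M" and Xk: "\<And>k::nat. Xk k \<in> borel_measurable M"
    and lim: "\<And>x. x \<in> space M \<Longrightarrow> (\<lambda>k. Xk k x) \<longlonglongrightarrow> X x"
    and bnd: "\<And>k x. x \<in> space M \<Longrightarrow> norm (Xk k x) \<le> 2 * norm (X x)"
  shows "(\<lambda>k. W2 (distr M borel X) (distr M borel (Xk k))) \<longlonglongrightarrow> 0"
proof (rule W2_tendsto_0[OF M _ Xk])
  have [measurable]: "X \<in> borel_measurable M" using X by (simp add: L2fun_def)
  then show "X \<in> borel_measurable M" .
  note [measurable] = Xk
  have "(\<lambda>k. \<integral>\<omega>. (dist (X \<omega>) (Xk k \<omega>))\<^sup>2 \<partial>M) \<longlonglongrightarrow> (\<integral>\<omega>. 0 \<partial>M)"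
  proof (rule integral_dominated_convergence)
    \<comment> \<open>The distance is at most \<open>norm (X x)\<close> plus twice that, and 9 is
      the square of 3.\<close>
    show "integrable M (\<lambda>x. 9 * (norm (X x))\<^sup>2)" using X by (simp add: L2fun_def)
    show "AE x in M. (\<lambda>k. (dist (X x) (Xk k x))\<^sup>2) \<longlonglongrightarrow> 0"
    proof (rule AE_I2)
      fix x assume "x \<in> space M"
      have "(\<lambda>k. (dist (X x) (Xk k x))\<^sup>2) \<longlonglongrightarrow> (dist (X x) (X x))\<^sup>2"
        by (intro tendsto_intros lim \<open>x \<in> space M\<close>)
      then show "(\<lambda>k. (dist (X x) (Xk k x))\<^sup>2) \<longlonglongrightarrow> 0" by simp
    qed
    show "AE x in M. norm ((dist (X x) (Xk k x))\<^sup>2) \<le> 9 * (norm (X x))\<^sup>2" for k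
    proof (rule AE_I2)
      fix x assume "x \<in> space M"
      then have "dist (X x) (Xk k x) \<le> 3 * norm (X x)"
        using bnd[of x k] norm_triangle_ineq4[of "X x" "Xk k x"] by (simp add: dist_norm)
      from power_mono[OF this, of 2] show "norm ((dist (X x) (Xk k x))\<^sup>2) \<le> 9 * (norm (X x))\<^sup>2"
        by (simp add: power_mult_distrib)
    qed
  qed auto
  then show "(\<lambda>k. \<integral>\<omega>. (dist (X \<omega>) (Xk k \<omega>))\<^sup>2 \<partial>M) \<longlonglongrightarrow> 0" by simp
qed

text \<open>The values of measure zero are finitely many and hence form a null set, so almost every
  point is an atom, as the type of pmfs requires.\<close>

lemma simple_function_law:
  assumes "prob_space M" and J: "simple_function M J"
  obtains P where "finite (set_pmf P)" "measure_pmf P = distr M (count_space UNIV) J"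
proof -
  interpret prob_space M by fact
  have Jm [measurable]: "J \<in> measurable M (count_space UNIV)"
    by (rule measurable_simple_function[OF J])
  have fin: "finite (J ` space M)" using J by (simp add: simple_function_def)
  define N where "N = distr M (count_space UNIV) J"
  interpret N: prob_space N unfolding N_def by (rule prob_space_distr) simp
  have sets_N: "sets N = UNIV" by (simp add: N_def)
  have inJ: "AE x in N. x \<in> J ` space M"
    unfolding N_def by (subst AE_distr_iff) auto
  have "AE x in N. \<forall>a\<in>J ` space M. x = a \<longrightarrow> measure N {a} \<noteq> 0"
  proof (subst AE_finite_all[OF fin], safe)
    fix a :: 'b
    show "AE x in N. x = a \<longrightarrow> measure N {a} \<noteq> 0"
    proof (cases "measure N {a} = 0")
      case True
      then have "emeasure N {a} = 0" by (simp add: N.emeasure_eq_measure)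
      then have "AE x in N. x \<notin> {a}"
        by (intro AE_not_in) (auto simp: null_sets_def N_def)
      then show ?thesis by eventually_elim simp
    qed simp
  qed
  with inJ have "AE x in N. measure N {x} \<noteq> 0"
    by eventually_elim auto
  then have "N \<in> {M. prob_space M \<and> sets M = UNIV \<and> (AE x in M. measure M {x} \<noteq> 0)}"
    using N.prob_space_axioms sets_N by simp
  then have P: "measure_pmf (Abs_pmf N) = N" by (rule Abs_pmf_inverse)
  have "set_pmf (Abs_pmf N) \<subseteq> J ` space M"
    using inJ by (simp add: AE_measure_pmf_iff[symmetric] P subset_iff Ball_def[symmetric])
      (metis AE_measure_pmf_iff P)
  then have "finite (set_pmf (Abs_pmf N))" using fin finite_subset by blast
  with P that show ?thesis unfolding N_def by blast
qed

lemma distr_pmf_law: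
  assumes "measure_pmf P = distr M (count_space UNIV) J" "J \<in> measurable M (count_space UNIV)"
  shows "distr (measure_pmf P) borel X = distr M borel (\<lambda>\<omega>. X (J \<omega>))"
  using assms by (simp add: distr_distr comp_def)

lemma integral_pmf_law:
  fixes f :: "_ \<Rightarrow> 'b::{banach, second_countable_topology}"
  assumes "measure_pmf P = distr M (count_space UNIV) J" "J \<in> measurable M (count_space UNIV)"
  shows "(\<integral>i. f i \<partial>measure_pmf P) = (\<integral>\<omega>. f (J \<omega>) \<partial>M)"
  using assms by (simp add: integral_distr)

text \<open>The form depends on the sample space only through the law of the index \<open>J\<close>,
  so simple random variables can be treated as functions on a finitely supported pmf of their joint
  values.\<close>

lemma quad_form_law:
  assumes "measure_pmf P = distr M (count_space UNIV) J" "J \<in> measurable M (count_space UNIV)"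
  shows "quad_form H \<alpha> (measure_pmf P) X Q V R =
    quad_form H \<alpha> M (\<lambda>\<omega>. X (J \<omega>)) (\<lambda>\<omega>. Q (J \<omega>)) (\<lambda>\<omega>. V (J \<omega>)) (\<lambda>\<omega>. R (J \<omega>))"
  unfolding quad_form_def Let_def distr_pmf_law[OF assms] integral_pmf_law[OF assms] ..

lemma disp_form_law:
  assumes "measure_pmf P = distr M (count_space UNIV) J" "J \<in> measurable M (count_space UNIV)"
  shows "disp_form H \<alpha> (measure_pmf P) X Y Q R =
    disp_form H \<alpha> M (\<lambda>\<omega>. X (J \<omega>)) (\<lambda>\<omega>. Y (J \<omega>)) (\<lambda>\<omega>. Q (J \<omega>)) (\<lambda>\<omega>. R (J \<omega>))"
  unfolding disp_form_def Let_def distr_pmf_law[OF assms] integral_pmf_law[OF assms] ..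

text \<open>Coinciding starting points are separated by their velocities, distinct ones stay apart
  for small \<open>s\<close>. This serves both to make points distinct, with injective velocities,
  and to keep distinct points distinct under arbitrary velocities.\<close>

lemma eventually_inj_on_line:
  fixes X U :: "'i \<Rightarrow> 'b::real_normed_vector"
  assumes "finite S" and ne: "\<And>a b. a \<in> S \<Longrightarrow> b \<in> S \<Longrightarrow> a \<noteq> b \<Longrightarrow> X a \<noteq> X b \<or> U a \<noteq> U b"
  shows "\<forall>\<^sub>F s in at_right 0. inj_on (\<lambda>i. X i + s *\<^sub>R U i) S"
proof -
  have "\<forall>\<^sub>F s in at_right 0. X a + s *\<^sub>R U a \<noteq> X b + s *\<^sub>R U b" if "a \<in> S" "b \<in> S" "a \<noteq> b" for a b
  proof (cases "X a = X b")
    case True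
    then have "U a \<noteq> U b" using ne that by blast
    with True show ?thesis
      using eventually_at_right_less[of "0::real"] by (auto elim: eventually_mono)
  next
    case False
    have "((\<lambda>s. (X a + s *\<^sub>R U a) - (X b + s *\<^sub>R U b)) \<longlongrightarrow> (X a + 0 *\<^sub>R U a) - (X b + 0 *\<^sub>R U b)) (at_right 0)"
      by (intro tendsto_intros)
    then have "\<forall>\<^sub>F s in at_right 0. (X a + s *\<^sub>R U a) - (X b + s *\<^sub>R U b) \<noteq> 0"
      using False by (intro tendsto_imp_eventually_ne) auto
    then show ?thesis by eventually_elim auto
  qed
  then have "\<forall>\<^sub>F s in at_right 0. \<forall>a\<in>S. \<forall>b\<in>S. a \<noteq> b \<longrightarrow> X a + s *\<^sub>R U a \<noteq> X b + s *\<^sub>R U b"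
    using assms(1) by (intro eventually_ball_finite ballI) (auto intro!: always_eventually elim: eventually_mono)
  then show ?thesis
    by eventually_elim (auto simp: inj_on_def)
qed

text \<open>Tietze on the finite set of points. Distinctness is what makes the prescribed values a
  function of position.\<close>

lemma bcontfun_interpolation:
  fixes X :: "'i \<Rightarrow> real^'n" and Y :: "'i \<Rightarrow> real^'m"
  assumes "finite S" "inj_on X S"
  obtains f where "f \<in> bcontfun" "\<And>i. i \<in> S \<Longrightarrow> f (X i) = Y i"
proof -
  define B where "B = (\<Sum>i\<in>S. norm (Y i))"
  define h where "h = Y \<circ> the_inv_into S X"
  have h: "h (X i) = Y i" if "i \<in> S" for i
    using assms that by (simp add: h_def the_inv_into_f_f)
  obtain f where f: "continuous_on UNIV f" "\<And>x. x \<in> X ` S \<Longrightarrow> f x = h x" "\<And>x. norm (f x) \<le> B"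
  proof (rule Tietze[of "X ` S" h UNIV B])
    show "continuous_on (X ` S) h" using assms(1) by (intro continuous_on_finite) auto
    show "closedin (top_of_set UNIV) (X ` S)" using assms(1) by (simp add: finite_imp_closed)
    show "norm (h x) \<le> B" if "x \<in> X ` S" for x
      using that h assms(1) unfolding B_def by (auto intro!: member_le_sum)
  qed (auto simp: B_def sum_nonneg)
  have "f \<in> bcontfun"
    using f(1,3) by (auto simp: bcontfun_def bounded_iff)
  with f(2) h show ?thesis by (intro that) auto
qed

section \<open>Bounded second derivatives and limits of the quadratic form\<close>

locale regular_hamiltonian = smooth_hamiltonian H
  for H :: "real^'n \<Rightarrow> (real^'n) measure \<Rightarrow> real^'n \<Rightarrow> real" +
  fixes c L :: real
  assumes c: "0 < c" and L: "0 < L"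
    and dpp_ge: "\<And>x \<mu> p w. \<mu> \<in> P2 \<Longrightarrow> c * (w \<bullet> w) \<le> w \<bullet> (dpp H x \<mu> p *v w)"
    and cont_xp: "jointly_continuous (\<lambda>(x, p) \<mu>. dxp H x \<mu> p)"
    and cont_pp: "jointly_continuous (\<lambda>(x, p) \<mu>. dpp H x \<mu> p)"
    and cont_xx: "jointly_continuous (\<lambda>(x, p) \<mu>. dxx H x \<mu> p)"
    and cont_pmu: "jointly_continuous (\<lambda>(x, y, p) \<mu>. dpmu H x \<mu> y p)"
    and cont_xmu: "jointly_continuous (\<lambda>(x, y, p) \<mu>. dxmu H x \<mu> y p)"
    and bnd: "\<And>x \<mu> p. \<mu> \<in> P2 \<Longrightarrow> norm (dxp H x \<mu> p) \<le> L" "\<And>x \<mu> p. \<mu> \<in> P2 \<Longrightarrow> norm (dpp H x \<mu> p) \<le> L"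
      "\<And>x \<mu> p. \<mu> \<in> P2 \<Longrightarrow> norm (dxx H x \<mu> p) \<le> L"
    and bnd_mu: "\<And>x \<mu> y p. \<mu> \<in> P2 \<Longrightarrow> norm (dpmu H x \<mu> y p) \<le> L" "\<And>x \<mu> y p. \<mu> \<in> P2 \<Longrightarrow> norm (dxmu H x \<mu> y p) \<le> L"
begin

lemma
  assumes "(x \<longlongrightarrow> x') F" "(q \<longlongrightarrow> q') F" "((\<lambda>k. W2 \<mu>' (\<mu> k)) \<longlongrightarrow> 0) F" "\<mu>' \<in> P2" "\<And>k. \<mu> k \<in> P2"
  shows tendsto_dxx: "((\<lambda>k. dxx H (x k) (\<mu> k) (q k)) \<longlongrightarrow> dxx H x' \<mu>' q') F"
    and tendsto_dxp: "((\<lambda>k. dxp H (x k) (\<mu> k) (q k)) \<longlongrightarrow> dxp H x' \<mu>' q') F"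
    and tendsto_dpp: "((\<lambda>k. dpp H (x k) (\<mu> k) (q k)) \<longlongrightarrow> dpp H x' \<mu>' q') F"
  using jointly_continuous_tendsto[OF cont_xx tendsto_Pair[OF assms(1,2)] assms(3-5)]
    jointly_continuous_tendsto[OF cont_xp tendsto_Pair[OF assms(1,2)] assms(3-5)]
    jointly_continuous_tendsto[OF cont_pp tendsto_Pair[OF assms(1,2)] assms(3-5)]
  by auto

lemma
  assumes "(x \<longlongrightarrow> x') F" "(y \<longlongrightarrow> y') F" "(q \<longlongrightarrow> q') F"
    "((\<lambda>k. W2 \<mu>' (\<mu> k)) \<longlongrightarrow> 0) F" "\<mu>' \<in> P2" "\<And>k. \<mu> k \<in> P2"
  shows tendsto_dxmu: "((\<lambda>k. dxmu H (x k) (\<mu> k) (y k) (q k)) \<longlongrightarrow> dxmu H x' \<mu>' y' q') F"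
    and tendsto_dpmu: "((\<lambda>k. dpmu H (x k) (\<mu> k) (y k) (q k)) \<longlongrightarrow> dpmu H x' \<mu>' y' q') F"
  using jointly_continuous_tendsto[OF cont_xmu tendsto_Pair[OF assms(1) tendsto_Pair[OF assms(2,3)]] assms(4-6)]
    jointly_continuous_tendsto[OF cont_pmu tendsto_Pair[OF assms(1) tendsto_Pair[OF assms(2,3)]] assms(4-6)]
  by auto

lemma tendsto_quad_integrand:
  assumes "(x \<longlongrightarrow> x') F" "((\<lambda>k. W2 \<mu>' (\<mu> k)) \<longlongrightarrow> 0) F" "\<mu>' \<in> P2" "\<And>k. \<mu> k \<in> P2"
    "(q \<longlongrightarrow> q') F" "(v \<longlongrightarrow> v') F" "(r \<longlongrightarrow> r') F" "(a \<longlongrightarrow> a') F" "(b \<longlongrightarrow> b') F"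
  shows "((\<lambda>k. quad_integrand H \<alpha> (x k) (\<mu> k) (q k) (v k) (r k) (a k) (b k)) \<longlongrightarrow>
    quad_integrand H \<alpha> x' \<mu>' q' v' r' a' b') F"
  unfolding quad_integrand_def
  by (intro tendsto_intros tendsto_dxx tendsto_dxp tendsto_dpp assms)

text \<open>The constant before the factor 2 covers every coefficient of the two vectors paired with
  \<open>v\<close> and \<open>r\<close>, and 2 counts these pairings. The bound is uniform in
  \<open>x\<close>, \<open>\<mu>\<close> and \<open>q\<close>, so it yields domination for every
  continuous momentum field.\<close>

lemma quad_integrand_bound:
  assumes "\<mu> \<in> P2"
  shows "\<bar>quad_integrand H \<alpha> x \<mu> q v r a b\<bar>
    \<le> 2 * ((1 + 2 * \<bar>\<alpha>\<bar>) * (1 + L)) * (norm v + norm r + norm a + norm b)\<^sup>2"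
proof -
  define C where "C = (1 + 2 * \<bar>\<alpha>\<bar>) * (1 + L)"
  define n where "n = norm v + norm r + norm a + norm b"
  have n: "norm v \<le> n" "norm r \<le> n" "0 \<le> n" by (auto simp: n_def)
  define A1 where "A1 = dxx H x \<mu> q *v v - (2 * \<alpha>) *\<^sub>R (dxp H x \<mu> q *v v) + a - (2 * \<alpha>) *\<^sub>R b"
  define A2 where "A2 = dpp H x \<mu> q *v r + b + (2 * \<alpha>) *\<^sub>R (dpp H x \<mu> q *v v)"
  have "norm A1 \<le> norm (dxx H x \<mu> q *v v) + 2 * \<bar>\<alpha>\<bar> * norm (dxp H x \<mu> q *v v) + norm a + 2 * \<bar>\<alpha>\<bar> * norm b"
    unfolding A1_def
    by (rule norm_triangle_le_diff norm_triangle_le add_mono | simp add: abs_mult)+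
  also have "\<dots> \<le> L * norm v + 2 * \<bar>\<alpha>\<bar> * (L * norm v) + norm a + 2 * \<bar>\<alpha>\<bar> * norm b"
    using bnd[OF assms] by (intro add_mono mult_left_mono norm_matrix_vector_mult_bound) auto
  also have "\<dots> \<le> C * n"
    using L by (auto simp: C_def n_def algebra_simps intro!: add_nonneg_nonneg mult_nonneg_nonneg)
  finally have 1: "norm A1 \<le> C * n" .
  have "norm A2 \<le> norm (dpp H x \<mu> q *v r) + norm b + 2 * \<bar>\<alpha>\<bar> * norm (dpp H x \<mu> q *v v)"
    unfolding A2_def
    by (rule norm_triangle_le_diff norm_triangle_le add_mono | simp add: abs_mult)+
  also have "\<dots> \<le> L * norm r + norm b + 2 * \<bar>\<alpha>\<bar> * (L * norm v)"
    using bnd[OF assms] by (intro add_mono mult_left_mono norm_matrix_vector_mult_bound) auto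
  also have "\<dots> \<le> C * n"
    using L by (auto simp: C_def n_def algebra_simps intro!: add_nonneg_nonneg mult_nonneg_nonneg)
  finally have 2: "norm A2 \<le> C * n" .
  have "\<bar>- (A1 \<bullet> v) + A2 \<bullet> r\<bar> \<le> norm A1 * norm v + norm A2 * norm r"
    using Cauchy_Schwarz_ineq2[of A1 v] Cauchy_Schwarz_ineq2[of A2 r] by linarith
  also have "\<dots> \<le> (C * n) * n + (C * n) * n"
    using L n by (intro add_mono mult_mono 1 2) (auto simp: C_def)
  also have "\<dots> = 2 * C * n\<^sup>2"
    by (simp add: power2_eq_square)
  finally show ?thesis
    by (simp only: quad_integrand_def A1_def A2_def C_def n_def
        matrix_vector_mult_diff_rdistrib scaleR_matrix_vector_assoc)
qed

text \<open>For a finite law the form is continuous in the points with \<open>Q\<close>,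
  \<open>V\<close>, \<open>R\<close> held fixed on the index set, so distinct points
  suffice.\<close>

lemma quad_form_nonneg_perturb:
  fixes P :: "'i pmf"
  assumes fin: "finite (set_pmf P)"
    and nn: "\<And>X. inj_on X (set_pmf P) \<Longrightarrow> 0 \<le> quad_form H \<alpha> (measure_pmf P) X Q V R"
  shows "0 \<le> quad_form H \<alpha> (measure_pmf P) X Q V R"
proof -
  obtain e :: "'i \<Rightarrow> nat" where e: "inj_on e (set_pmf P)"
    using finite_imp_inj_to_nat_seg[OF fin] by blast
  \<comment> \<open>Any injective velocity on the support will do; here a numbering of the indices
    is repeated in all coordinates.\<close>
  define U :: "'i \<Rightarrow> real^'n" where "U i = (\<chi> k. real (e i))" for i
  have U: "U a \<noteq> U b" if "a \<in> set_pmf P" "b \<in> set_pmf P" "a \<noteq> b" for a b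
    using e that by (auto simp: U_def vec_eq_iff inj_on_def)
  define m where "m s = distr (measure_pmf P) borel (\<lambda>i. X i + s *\<^sub>R U i)" for s
  have mP2: "m s \<in> P2" for s using fin by (simp add: m_def)
  have m0: "distr (measure_pmf P) borel X = m 0" by (simp add: m_def)
  have lX: "((\<lambda>s. X i + s *\<^sub>R U i) \<longlongrightarrow> X i) (at_right 0)" for i
    by (auto intro!: tendsto_eq_intros)
  have W: "((\<lambda>s. W2 (m 0) (m s)) \<longlongrightarrow> 0) (at_right 0)"
    unfolding m0[symmetric] unfolding m_def by (rule plaw_W2_tendsto_0[OF fin lX])
  have "((\<lambda>s. quad_form H \<alpha> (measure_pmf P) (\<lambda>i. X i + s *\<^sub>R U i) Q V R) \<longlongrightarrow>
    quad_form H \<alpha> (measure_pmf P) X Q V R) (at_right 0)"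
    unfolding quad_form_def Let_def m_def[symmetric] m0 integral_pmf_finite[OF fin]
    by (intro tendsto_sum tendsto_scaleR tendsto_const tendsto_quad_integrand lX W mP2
        tendsto_matrix_vector_mult tendsto_dxmu tendsto_dpmu)
  moreover have "\<forall>\<^sub>F s in at_right 0. 0 \<le> quad_form H \<alpha> (measure_pmf P) (\<lambda>i. X i + s *\<^sub>R U i) Q V R"
    using eventually_inj_on_line[of "set_pmf P" X U] fin U
    by (auto elim!: eventually_mono intro: nn)
  ultimately show ?thesis
    by (rule tendsto_lowerbound) simp
qed

text \<open>Points and both directions are replaced by simple functions, while the momenta follow
  the points through the continuous \<open>p\<close>. The measure inside the derivatives moves too,
  which joint continuity in W2 absorbs.\<close>

lemma quad_form_nonneg_limit:
  fixes X V R :: "'a \<Rightarrow> real^'n"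
  assumes M: "prob_space M" and X: "X \<in> L2fun M" and V: "V \<in> L2fun M" and R: "R \<in> L2fun M"
    and p: "continuous_on UNIV p"
    and nn: "\<And>P :: ((real^'n) \<times> (real^'n) \<times> (real^'n)) pmf. \<And>X Q V R. finite (set_pmf P) \<Longrightarrow>
      0 \<le> quad_form H \<alpha> (measure_pmf P) X Q V R"
  shows "0 \<le> quad_form H \<alpha> M X (\<lambda>\<omega>. p (X \<omega>)) V R"
proof -
  interpret prob_space M by fact
  obtain Xk where Xk: "\<And>k. simple_function M (Xk k)" "\<And>x. x \<in> space M \<Longrightarrow> (\<lambda>k. Xk k x) \<longlonglongrightarrow> X x"
    "\<And>k x. x \<in> space M \<Longrightarrow> norm (Xk k x) \<le> 2 * norm (X x)" "\<And>k. Xk k \<in> L2fun M"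
    using L2fun_simple_approx[OF X] by blast
  obtain Vk where Vk: "\<And>k. simple_function M (Vk k)" "\<And>x. x \<in> space M \<Longrightarrow> (\<lambda>k. Vk k x) \<longlonglongrightarrow> V x"
    "\<And>k x. x \<in> space M \<Longrightarrow> norm (Vk k x) \<le> 2 * norm (V x)" "\<And>k. Vk k \<in> L2fun M"
    using L2fun_simple_approx[OF V] by blast
  obtain Rk where Rk: "\<And>k. simple_function M (Rk k)" "\<And>x. x \<in> space M \<Longrightarrow> (\<lambda>k. Rk k x) \<longlonglongrightarrow> R x"
    "\<And>k x. x \<in> space M \<Longrightarrow> norm (Rk k x) \<le> 2 * norm (R x)" "\<And>k. Rk k \<in> L2fun M"
    using L2fun_simple_approx[OF R] by blast
  \<comment> \<open>The approximations of \<open>V\<close> and \<open>R\<close> need not be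
    functions of that of \<open>X\<close>, so the index records all three values.\<close>
  define J where "J k \<omega> = (Xk k \<omega>, Vk k \<omega>, Rk k \<omega>)" for k \<omega>
  have J: "simple_function M (J k)" for k
    unfolding J_def by (intro simple_function_Pair Xk Vk Rk)
  \<comment> \<open>Being finitely valued, \<open>J k\<close> is measurable into the count space, so
    every function of it is measurable. Measurability of the limiting integrands is then inherited
    through pointwise limits.\<close>
  have Jmeas: "(\<lambda>\<omega>. f (J k \<omega>)) \<in> borel_measurable M" for f :: "_ \<Rightarrow> 'b::topological_space" and k
    by (rule measurable_compose[OF measurable_simple_function[OF J]]) simp
  have nnk: "0 \<le> quad_form H \<alpha> M (Xk k) (\<lambda>\<omega>. p (Xk k \<omega>)) (Vk k) (Rk k)" for k
  proof -
    obtain P where P: "finite (set_pmf P)" "measure_pmf P = distr M (count_space UNIV) (J k)"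
      by (rule simple_function_law[OF M J])
    show ?thesis
      using nn[OF P(1), of fst "\<lambda>z. p (fst z)" "\<lambda>z. fst (snd z)" "\<lambda>z. snd (snd z)"]
      unfolding quad_form_law[OF P(2) measurable_simple_function[OF J]] by (simp add: J_def)
  qed
  define \<mu> where "\<mu> = distr M borel X"
  define \<mu>k where "\<mu>k k = distr M borel (Xk k)" for k
  have \<mu>: "\<mu> \<in> P2" "\<mu>k k \<in> P2" for k
    using distr_in_P2[OF M] X Xk(4) by (auto simp: \<mu>_def \<mu>k_def)
  have W: "(\<lambda>k. W2 \<mu> (\<mu>k k)) \<longlonglongrightarrow> 0"
    unfolding \<mu>_def \<mu>k_def
    by (rule W2_tendsto_0_dominated[OF M X _ Xk(2,3)]) (use Xk(4) in \<open>auto simp: L2fun_def\<close>)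
  have plim: "(\<lambda>k. p (Xk k x)) \<longlonglongrightarrow> p (X x)" if "x \<in> space M" for x
    using Xk(2)[OF that] p by (auto intro: continuous_on_tendsto_compose)
  have intV: "integrable M (\<lambda>y. L * (2 * norm (V y)))"
    using L2fun_integrable_norm[OF M V] by simp
  \<comment> \<open>One bound for both inner integrals, uniform in the outer point and in the
    approximation index.\<close>
  define B where "B = (\<integral>y. L * (2 * norm (V y)) \<partial>M)"
  have B: "0 \<le> B" using L by (auto simp: B_def intro!: integral_nonneg_AE)
  have inner: "(\<lambda>k. \<integral>y. D (Xk k x) (\<mu>k k) (Xk k y) (p (Xk k x)) *v Vk k y \<partial>M)
        \<longlonglongrightarrow> (\<integral>y. D (X x) \<mu> (X y) (p (X x)) *v V y \<partial>M)" (is ?lim)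
    and inner_bound: "norm (\<integral>y. D (Xk k x) (\<mu>k k) (Xk k y) (p (Xk k x)) *v Vk k y \<partial>M) \<le> B" (is ?bound)
    if x: "x \<in> space M" and D: "D = dxmu H \<or> D = dpmu H" for x D k
  proof -
    have meas: "(\<lambda>y. D (Xk k x) (\<mu>k k) (Xk k y) (p (Xk k x)) *v Vk k y) \<in> borel_measurable M" for k
      using Jmeas[of "\<lambda>(a, b, c). D (Xk k x) (\<mu>k k) a (p (Xk k x)) *v b" k] by (simp add: J_def)
    have lim: "(\<lambda>k. D (Xk k x) (\<mu>k k) (Xk k y) (p (Xk k x)) *v Vk k y) \<longlonglongrightarrow> D (X x) \<mu> (X y) (p (X x)) *v V y"
      if "y \<in> space M" for y
      using D that x
      by (elim disjE; simp only:) (intro tendsto_matrix_vector_mult tendsto_dxmu tendsto_dpmu Xk Vk plim W \<mu>; assumption)+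
    have bound: "norm (D (Xk k x) (\<mu>k k) (Xk k y) (p (Xk k x)) *v Vk k y) \<le> L * (2 * norm (V y))"
      if "y \<in> space M" for y k
    proof -
      have "norm (D (Xk k x) (\<mu>k k) (Xk k y) (p (Xk k x)) *v Vk k y) \<le> L * norm (Vk k y)"
        using D bnd_mu[OF \<mu>(2)] by (intro norm_matrix_vector_mult_bound) auto
      also have "\<dots> \<le> L * (2 * norm (V y))"
        using L Vk(3)[OF that, of k] by (intro mult_left_mono) auto
      finally show ?thesis .
    qed
    have measl: "(\<lambda>y. D (X x) \<mu> (X y) (p (X x)) *v V y) \<in> borel_measurable M"
      by (rule borel_measurable_LIMSEQ_metric[OF meas lim])
    show ?lim
      by (rule integral_dominated_convergence[OF measl meas intV]) (use lim bound in auto)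
    have "norm (\<integral>y. D (Xk k x) (\<mu>k k) (Xk k y) (p (Xk k x)) *v Vk k y \<partial>M)
      \<le> (\<integral>y. norm (D (Xk k x) (\<mu>k k) (Xk k y) (p (Xk k x)) *v Vk k y) \<partial>M)"
      by (rule integral_norm_bound)
    also have "\<dots> \<le> B"
      unfolding B_def
    proof (rule integral_mono[OF _ intV bound])
      show "integrable M (\<lambda>y. norm (D (Xk k x) (\<mu>k k) (Xk k y) (p (Xk k x)) *v Vk k y))"
        by (rule Bochner_Integration.integrable_bound[OF intV]) (use meas bound L in auto)
    qed
    finally show ?bound .
  qed
  define qi where "qi k x = quad_integrand H \<alpha> (Xk k x) (\<mu>k k) (p (Xk k x)) (Vk k x) (Rk k x)
        (\<integral>y. dxmu H (Xk k x) (\<mu>k k) (Xk k y) (p (Xk k x)) *v Vk k y \<partial>M)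
        (\<integral>y. dpmu H (Xk k x) (\<mu>k k) (Xk k y) (p (Xk k x)) *v Vk k y \<partial>M)" for k x
  define qi' where "qi' x = quad_integrand H \<alpha> (X x) \<mu> (p (X x)) (V x) (R x)
        (\<integral>y. dxmu H (X x) \<mu> (X y) (p (X x)) *v V y \<partial>M)
        (\<integral>y. dpmu H (X x) \<mu> (X y) (p (X x)) *v V y \<partial>M)" for x
  have lim: "(\<lambda>k. qi k x) \<longlonglongrightarrow> qi' x" if "x \<in> space M" for x
    unfolding qi_def qi'_def
    by (intro tendsto_quad_integrand Xk Vk Rk W \<mu> plim inner that) auto
  have meas: "qi k \<in> borel_measurable M" for k
    using Jmeas[of "\<lambda>(a, b, c). quad_integrand H \<alpha> a (\<mu>k k) (p a) b c
        (\<integral>y. dxmu H a (\<mu>k k) (Xk k y) (p a) *v Vk k y \<partial>M)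
        (\<integral>y. dpmu H a (\<mu>k k) (Xk k y) (p a) *v Vk k y \<partial>M)" k]
    by (simp add: J_def qi_def[abs_def])
  define C where "C = 2 * ((1 + 2 * \<bar>\<alpha>\<bar>) * (1 + L))"
  have C: "0 \<le> C" using L by (simp add: C_def)
  have square4: "(a + b + c + d)\<^sup>2 \<le> 4 * (a\<^sup>2 + b\<^sup>2 + c\<^sup>2 + d\<^sup>2)" for a b c d :: real
  proof -
    have "4 * (a\<^sup>2 + b\<^sup>2 + c\<^sup>2 + d\<^sup>2) - (a + b + c + d)\<^sup>2
      = (a - b)\<^sup>2 + (a - c)\<^sup>2 + (a - d)\<^sup>2 + (b - c)\<^sup>2 + (b - d)\<^sup>2 + (c - d)\<^sup>2"
      by (simp add: power2_eq_square algebra_simps)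
    then show ?thesis by (smt (verit) zero_le_power2)
  qed
  have "(\<lambda>k. \<integral>x. qi k x \<partial>M) \<longlonglongrightarrow> (\<integral>x. qi' x \<partial>M)"
  proof (rule integral_dominated_convergence)
    show "qi' \<in> borel_measurable M"
      by (rule borel_measurable_LIMSEQ_metric[OF meas lim])
    show "integrable M (\<lambda>x. C * (4 * (4 * (norm (V x))\<^sup>2 + 4 * (norm (R x))\<^sup>2 + B\<^sup>2 + B\<^sup>2)))"
      using V R by (simp add: L2fun_def)
    show "AE x in M. norm (qi k x) \<le> C * (4 * (4 * (norm (V x))\<^sup>2 + 4 * (norm (R x))\<^sup>2 + B\<^sup>2 + B\<^sup>2))" for k
    proof (rule AE_I2)
      fix x assume x: "x \<in> space M"
      have "norm (qi k x) \<le> C * (norm (Vk k x) + norm (Rk k x)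
          + norm (\<integral>y. dxmu H (Xk k x) (\<mu>k k) (Xk k y) (p (Xk k x)) *v Vk k y \<partial>M)
          + norm (\<integral>y. dpmu H (Xk k x) (\<mu>k k) (Xk k y) (p (Xk k x)) *v Vk k y \<partial>M))\<^sup>2"
        unfolding qi_def real_norm_def C_def by (rule quad_integrand_bound[OF \<mu>(2)])
      also have "\<dots> \<le> C * (2 * norm (V x) + 2 * norm (R x) + B + B)\<^sup>2"
        using C x by (intro mult_left_mono power_mono add_mono Vk Rk inner_bound) auto
      also have "\<dots> \<le> C * (4 * ((2 * norm (V x))\<^sup>2 + (2 * norm (R x))\<^sup>2 + B\<^sup>2 + B\<^sup>2))"
        using C by (intro mult_left_mono square4)
      finally show "norm (qi k x) \<le> C * (4 * (4 * (norm (V x))\<^sup>2 + 4 * (norm (R x))\<^sup>2 + B\<^sup>2 + B\<^sup>2))"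
        by (simp add: power_mult_distrib)
    qed
  qed (use meas lim in auto)
  moreover have "(\<integral>x. qi k x \<partial>M) = quad_form H \<alpha> M (Xk k) (\<lambda>\<omega>. p (Xk k \<omega>)) (Vk k) (Rk k)" for k
    by (simp add: quad_form_def Let_def qi_def \<mu>k_def)
  moreover have "(\<integral>x. qi' x \<partial>M) = quad_form H \<alpha> M X (\<lambda>\<omega>. p (X \<omega>)) V R"
    by (simp add: quad_form_def Let_def qi'_def \<mu>_def)
  ultimately have "(\<lambda>k. quad_form H \<alpha> M (Xk k) (\<lambda>\<omega>. p (Xk k \<omega>)) (Vk k) (Rk k))
    \<longlonglongrightarrow> quad_form H \<alpha> M X (\<lambda>\<omega>. p (X \<omega>)) V R" by simp
  then show ?thesis
    by (rule LIMSEQ_le_const) (use nnk in auto)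
qed

end

section \<open>Square-integrability and coordinates of couplings\<close>

lemma L2fun_dominated:
  fixes f :: "'a \<Rightarrow> 'b::euclidean_space" and g :: "'a \<Rightarrow> 'c::euclidean_space"
  assumes M: "prob_space M" and f: "f \<in> L2fun M" and g: "g \<in> borel_measurable M"
    and le: "\<And>x. x \<in> space M \<Longrightarrow> norm (g x) \<le> C * (1 + norm (f x))"
  shows "g \<in> L2fun M"
proof -
  interpret prob_space M by fact
  have [measurable]: "f \<in> borel_measurable M" using f by (simp add: L2fun_def)
  note [measurable] = g
  have "integrable M (\<lambda>x. (norm (g x))\<^sup>2)"
  proof (rule Bochner_Integration.integrable_bound)
    show "integrable M (\<lambda>x. C\<^sup>2 * (2 * (1 + (norm (f x))\<^sup>2)))"
      using f by (simp add: L2fun_def)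
    have "(norm (g x))\<^sup>2 \<le> C\<^sup>2 * (2 * (1 + (norm (f x))\<^sup>2))" if "x \<in> space M" for x
    proof -
      have "(norm (g x))\<^sup>2 \<le> (C * (1 + norm (f x)))\<^sup>2"
        using le[OF that] by (intro power_mono) auto
      also have "\<dots> \<le> C\<^sup>2 * (2 * (1 + (norm (f x))\<^sup>2))"
        unfolding power_mult_distrib
        by (intro mult_left_mono) (use sum_squares_ge_zero[of "1 - norm (f x)" 0] in
            \<open>auto simp: power2_eq_square algebra_simps\<close>)
      finally show ?thesis .
    qed
    then show "AE x in M. norm ((norm (g x))\<^sup>2) \<le> norm (C\<^sup>2 * (2 * (1 + (norm (f x))\<^sup>2)))"
      by (auto simp: abs_mult)
  qed auto
  then show ?thesis using g by (simp add: L2fun_def)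
qed

lemma L2fun_inner_integrable:
  fixes f g :: "'a \<Rightarrow> 'b::euclidean_space"
  assumes "f \<in> L2fun M" "g \<in> L2fun M"
  shows "integrable M (\<lambda>x. f x \<bullet> g x)"
proof (rule Bochner_Integration.integrable_bound)
  show "integrable M (\<lambda>x. (norm (f x))\<^sup>2 + (norm (g x))\<^sup>2)"
    using assms by (simp add: L2fun_def)
  have [measurable]: "f \<in> borel_measurable M" "g \<in> borel_measurable M"
    using assms by (auto simp: L2fun_def)
  show "(\<lambda>x. f x \<bullet> g x) \<in> borel_measurable M" by measurable
  have "\<bar>f x \<bullet> g x\<bar> \<le> (norm (f x))\<^sup>2 + (norm (g x))\<^sup>2" for x
  proof -
    have "\<bar>f x \<bullet> g x\<bar> \<le> norm (f x) * norm (g x)" by (rule Cauchy_Schwarz_ineq2)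
    also have "\<dots> \<le> (norm (f x))\<^sup>2 + (norm (g x))\<^sup>2"
    proof -
      have "0 \<le> norm (f x) * norm (g x)" by simp
      then show ?thesis
        using sum_squares_bound[of "norm (f x)" "norm (g x)"] by (simp only: mult.assoc)
    qed
    finally show ?thesis .
  qed
  then show "AE x in M. norm (f x \<bullet> g x) \<le> norm ((norm (f x))\<^sup>2 + (norm (g x))\<^sup>2)"
    by auto
qed

lemma L2fun_diff:
  fixes f g :: "'a \<Rightarrow> 'b::euclidean_space"
  assumes "f \<in> L2fun M" "g \<in> L2fun M"
  shows "(\<lambda>x. f x - g x) \<in> L2fun M"
proof -
  have "integrable M (\<lambda>x. (norm (f x))\<^sup>2 - 2 * (f x \<bullet> g x) + (norm (g x))\<^sup>2)"
    using assms L2fun_inner_integrable[OF assms] by (auto simp: L2fun_def)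
  then show ?thesis
    using assms by (auto simp: L2fun_def power2_norm_eq_inner inner_simps inner_commute algebra_simps)
qed

lemma L2fun_scaleR:
  fixes f :: "'a \<Rightarrow> 'b::euclidean_space"
  shows "f \<in> L2fun M \<Longrightarrow> (\<lambda>x. s *\<^sub>R f x) \<in> L2fun M"
  by (auto simp: L2fun_def power_mult_distrib)

lemma bcontfun_bounded:
  assumes "p \<in> bcontfun"
  obtains B where "0 \<le> B" "\<And>x. norm (p x :: 'b::real_normed_vector) \<le> B"
  using assms by (auto simp: bcontfun_def bounded_iff) (metis norm_ge_zero order_trans)

lemma couplings_L2fun:
  assumes "\<mu> \<in> P2" "\<nu> \<in> P2" "\<gamma> \<in> couplings \<mu> \<nu>"
  shows "prob_space \<gamma>" "sets \<gamma> = sets borel" "fst \<in> L2fun \<gamma>" "snd \<in> L2fun \<gamma>"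
    "distr \<gamma> borel fst = \<mu>" "distr \<gamma> borel snd = \<nu>"
proof -
  show \<gamma>: "prob_space \<gamma>" "sets \<gamma> = sets borel" "distr \<gamma> borel fst = \<mu>" "distr \<gamma> borel snd = \<nu>"
    using assms(3) by (auto simp: couplings_def)
  have [measurable]: "fst \<in> borel_measurable \<gamma>" "snd \<in> borel_measurable \<gamma>"
    unfolding measurable_cong_sets[OF \<gamma>(2) refl] by measurable
  have "integrable (distr \<gamma> borel fst) (\<lambda>x. (norm x)\<^sup>2)" "integrable (distr \<gamma> borel snd) (\<lambda>x. (norm x)\<^sup>2)"
    using assms(1,2) unfolding \<gamma> by (auto simp: P2_def)
  then show "fst \<in> L2fun \<gamma>" "snd \<in> L2fun \<gamma>"
    by (auto simp: L2fun_def integrable_distr_eq)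
qed

lemma norm_fst_snd_le: "norm (fst z) \<le> norm z" "norm (snd z) \<le> norm z"
  by (metis norm_fst_le norm_snd_le prod.collapse)+

section \<open>Displacement monotonicity\<close>

context regular_hamiltonian
begin

text \<open>All four blocks of the Hessian are bounded by \<open>L\<close>. The x-derivative of the
  p-gradient is not one of the matrices bounded by assumption; it is handled as the adjoint of
  \<open>dxp\<close>.\<close>

lemma G_lipschitz:
  assumes \<mu>: "\<mu> \<in> P2"
  shows "norm (G z \<mu> - G z' \<mu>) \<le> 4 * L * norm (z - z')"
proof (rule differentiable_bound[of UNIV _ "\<lambda>z. DG z \<mu>"])
  show "((\<lambda>z. G z \<mu>) has_derivative DG z \<mu>) (at z within UNIV)" for z
    by (rule G_has_derivative[OF \<mu>])
  show "onorm (DG z \<mu>) \<le> 4 * L" for z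
  proof (rule onorm_le)
    fix \<zeta> :: "(real^'n) \<times> (real^'n)"
    obtain x q where z: "z = (x, q)" by fastforce
    obtain h k where \<zeta>: "\<zeta> = (h, k)" by fastforce
    have "DG z \<mu> \<zeta> = DG z \<mu> (h, 0) + DG z \<mu> (0, k)"
      using linear_add[OF DG_linear[of z \<mu>], of "(h, 0)" "(0, k)"] by (simp add: \<zeta>)
    also have "\<dots> = (dxx H x \<mu> q *v h + dxp H x \<mu> q *v k, snd (DG z \<mu> (h, 0)) + dpp H x \<mu> q *v k)"
      by (simp add: z dxx_eq[OF \<mu>] dxp_eq[OF \<mu>] dpp_eq[OF \<mu>] prod_eq_iff)
    finally have eq: "DG z \<mu> \<zeta> = \<dots>" .
    \<comment> \<open>Symmetry is tested with \<open>u\<close> itself, which turns the unknown block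
      into \<open>dxp\<close> applied to \<open>u\<close>.\<close>
    define u where "u = snd (DG z \<mu> (h, 0))"
    have "u \<bullet> u = (dxp H x \<mu> q *v u) \<bullet> h"
      using DG_symmetric[OF \<mu>, of z "(h, 0)" "(0, u)"]
      by (simp add: u_def z dxp_eq[OF \<mu>] inner_prod_def)
    also have "\<dots> \<le> norm (dxp H x \<mu> q *v u) * norm h" by (rule norm_cauchy_schwarz)
    also have "\<dots> \<le> L * norm u * norm h"
      using bnd[OF \<mu>] by (intro mult_right_mono norm_matrix_vector_mult_bound) auto
    finally have "norm u * norm u \<le> norm u * (L * norm h)"
      by (simp add: power2_norm_eq_inner[symmetric] power2_eq_square mult_ac)
    then have u: "norm u \<le> L * norm h"
      using L by (cases "u = 0") auto
    have "norm (DG z \<mu> \<zeta>) \<le> norm (dxx H x \<mu> q *v h + dxp H x \<mu> q *v k) + norm (u + dpp H x \<mu> q *v k)"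
      unfolding eq u_def by (rule norm_Pair_le)
    also have "\<dots> \<le> (L * norm h + L * norm k) + (L * norm h + L * norm k)"
      by (intro add_mono norm_triangle_le norm_matrix_vector_mult_bound u bnd[OF \<mu>])
    also have "\<dots> = 2 * L * (norm h + norm k)" by (simp add: algebra_simps)
    also have "\<dots> \<le> 2 * L * (2 * norm \<zeta>)"
      using L norm_fst_le[of h k] norm_snd_le[of k h] by (intro mult_left_mono) (auto simp: \<zeta>)
    also have "\<dots> = 4 * L * norm \<zeta>" by simp
    finally show "norm (DG z \<mu> \<zeta>) \<le> 4 * L * norm \<zeta>" .
  qed
qed auto

text \<open>The measure enters only through the value at 0, which stays bounded along convergent
  measures; the growth in \<open>x\<close> and \<open>q\<close> is uniform.\<close>

lemma G_bound:
  assumes "\<mu> \<in> P2"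
  shows "norm (G (x, q) \<mu>) \<le> norm (G 0 \<mu>) + 4 * L * (norm x + norm q)"
proof -
  have "norm (G (x, q) \<mu>) \<le> norm (G 0 \<mu>) + norm (G (x, q) \<mu> - G 0 \<mu>)"
    by (metis add.commute diff_add_cancel norm_triangle_ineq)
  also have "\<dots> \<le> norm (G 0 \<mu>) + 4 * L * norm ((x, q) - 0)"
    using G_lipschitz[OF assms, of "(x, q)" 0] by simp
  also have "\<dots> \<le> norm (G 0 \<mu>) + 4 * L * (norm x + norm q)"
    using L norm_Pair_le[of x q] by simp
  finally show ?thesis .
qed

lemma continuous_G: "\<mu> \<in> P2 \<Longrightarrow> continuous_on UNIV (\<lambda>z. G z \<mu>)"
  by (rule jointly_continuous_imp_continuous[OF jointly_continuous_G])

lemma G_measurable [measurable]: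
  assumes "\<mu> \<in> P2" and [measurable]: "X \<in> borel_measurable M" "Q \<in> borel_measurable M"
  shows "(\<lambda>\<omega>. G (X \<omega>, Q \<omega>) \<mu>) \<in> borel_measurable M"
proof -
  have "(\<lambda>\<omega>. (X \<omega>, Q \<omega>)) \<in> borel_measurable M" by measurable
  from measurable_compose[OF this borel_measurable_continuous_onI[OF continuous_G[OF assms(1)]]]
  show ?thesis .
qed

lemma G_L2fun:
  assumes M: "prob_space M" and \<mu>: "\<mu> \<in> P2" and X: "X \<in> L2fun M" and Q: "Q \<in> L2fun M"
  shows "(\<lambda>\<omega>. G (X \<omega>, Q \<omega>) \<mu>) \<in> L2fun M"
proof (rule L2fun_dominated[OF M])
  have meas: "X \<in> borel_measurable M" "Q \<in> borel_measurable M"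
    using X Q by (auto simp: L2fun_def)
  note [measurable] = meas
  have "integrable M (\<lambda>x. (norm (X x))\<^sup>2 + (norm (Q x))\<^sup>2)"
    using X Q by (simp add: L2fun_def)
  then show "(\<lambda>\<omega>. (X \<omega>, Q \<omega>)) \<in> L2fun M"
    by (simp add: L2fun_def norm_Pair)
  show "(\<lambda>\<omega>. G (X \<omega>, Q \<omega>) \<mu>) \<in> borel_measurable M"
    by (rule G_measurable[OF \<mu> meas])
  show "norm (G (X \<omega>, Q \<omega>) \<mu>) \<le> (norm (G 0 \<mu>) + 4 * L) * (1 + norm (X \<omega>, Q \<omega>))" for \<omega>
  proof -
    have "norm (G (X \<omega>, Q \<omega>) \<mu>) \<le> norm (G 0 \<mu>) + norm (G (X \<omega>, Q \<omega>) \<mu> - G 0 \<mu>)"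
      by (metis add.commute diff_add_cancel norm_triangle_ineq)
    also have "\<dots> \<le> norm (G 0 \<mu>) + 4 * L * norm ((X \<omega>, Q \<omega>) - 0)"
      using G_lipschitz[OF \<mu>, of "(X \<omega>, Q \<omega>)" 0] by simp
    also have "\<dots> \<le> (norm (G 0 \<mu>) + 4 * L) * (1 + norm (X \<omega>, Q \<omega>))"
      using L by (simp add: algebra_simps)
    finally show ?thesis .
  qed
qed

text \<open>The integrand of the displacement form with the gradient values \<open>A\<close>,
  \<open>B\<close> as parameters, so that its bound is pure vector algebra.\<close>

definition disp_integrand where
  "disp_integrand \<alpha> A B x y q r =
    ((2 * \<alpha>) *\<^sub>R (snd A - snd B) - (fst A - fst B)) \<bullet> (x - y) + (snd A - snd B) \<bullet> (q - r)"
  for A B :: "(real^'n) \<times> (real^'n)" and x y q r :: "real^'n"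

lemma disp_integrand_bound:
  "\<bar>disp_integrand \<alpha> A B x y q r\<bar>
    \<le> (2 * \<bar>\<alpha>\<bar> + 2) * (norm A + norm B) * (norm x + norm y + norm q + norm r)"
proof -
  define N where "N = norm A + norm B"
  have f: "norm (fst A - fst B) \<le> N" and s: "norm (snd A - snd B) \<le> N"
    using norm_triangle_ineq4[of "fst A" "fst B"] norm_triangle_ineq4[of "snd A" "snd B"]
      norm_fst_snd_le[of A] norm_fst_snd_le[of B]
    unfolding N_def by linarith+
  have xy: "norm (x - y) \<le> norm x + norm y" "norm (q - r) \<le> norm q + norm r"
    by (rule norm_triangle_ineq4)+
  have "norm ((2 * \<alpha>) *\<^sub>R (snd A - snd B) - (fst A - fst B))
      \<le> norm ((2 * \<alpha>) *\<^sub>R (snd A - snd B)) + norm (fst A - fst B)"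
    by (rule norm_triangle_ineq4)
  also have "\<dots> \<le> 2 * \<bar>\<alpha>\<bar> * N + N"
    using f s by (intro add_mono) (auto simp: abs_mult intro!: mult_left_mono)
  finally have 1: "norm ((2 * \<alpha>) *\<^sub>R (snd A - snd B) - (fst A - fst B)) \<le> (2 * \<bar>\<alpha>\<bar> + 2) * N"
    by (simp add: algebra_simps N_def) (smt (verit) norm_ge_zero)
  have 2: "norm (snd A - snd B) \<le> (2 * \<bar>\<alpha>\<bar> + 2) * N"
    using s mult_right_mono[of 1 "2 * \<bar>\<alpha>\<bar> + 2" N] by (simp add: N_def)
  have "\<bar>disp_integrand \<alpha> A B x y q r\<bar> \<le>
      norm ((2 * \<alpha>) *\<^sub>R (snd A - snd B) - (fst A - fst B)) * norm (x - y) + norm (snd A - snd B) * norm (q - r)"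
    unfolding disp_integrand_def
    by (intro order_trans[OF abs_triangle_ineq] add_mono Cauchy_Schwarz_ineq2)
  also have "\<dots> \<le> (2 * \<bar>\<alpha>\<bar> + 2) * N * (norm x + norm y) + (2 * \<bar>\<alpha>\<bar> + 2) * N * (norm q + norm r)"
    by (intro add_mono mult_mono 1 2 xy) (auto simp: N_def)
  finally show ?thesis by (simp add: N_def algebra_simps)
qed

lemma disp_form_eq:
  assumes "distr M borel X \<in> P2" "distr M borel Y \<in> P2"
  shows "disp_form H \<alpha> M X Y Q R = (\<integral>\<omega>. disp_integrand \<alpha> (G (X \<omega>, Q \<omega>) (distr M borel X))
    (G (Y \<omega>, R \<omega>) (distr M borel Y)) (X \<omega>) (Y \<omega>) (Q \<omega>) (R \<omega>) \<partial>M)"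
  unfolding disp_form_def Let_def dx_eq[OF assms(1)] dx_eq[OF assms(2)] dp_eq[OF assms(1)] dp_eq[OF assms(2)]
    disp_integrand_def ..

text \<open>Linear growth of gradients and momenta bounds the integrand by a multiple of the square
  of \<open>1 + norm (X \<omega>) + norm (Y \<omega>)\<close>, which is integrable. Both marginal
  laws move with the simple approximations.\<close>

lemma disp_form_nonneg_limit:
  fixes X Y :: "'a \<Rightarrow> real^'n"
  assumes M: "prob_space M" and X: "X \<in> L2fun M" and Y: "Y \<in> L2fun M"
    and q1: "continuous_on UNIV q1" and q2: "continuous_on UNIV q2"
    and C0: "0 \<le> C0" "\<And>x. norm (q1 x) \<le> C0 * (1 + norm x)" "\<And>x. norm (q2 x) \<le> C0 * (1 + norm x)"
    and nn: "\<And>P :: ((real^'n) \<times> (real^'n)) pmf. \<And>X Y Q R. finite (set_pmf P) \<Longrightarrow>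
      0 \<le> disp_form H \<alpha> (measure_pmf P) X Y Q R"
  shows "0 \<le> disp_form H \<alpha> M X Y (\<lambda>\<omega>. q1 (X \<omega>)) (\<lambda>\<omega>. q2 (Y \<omega>))"
proof -
  interpret prob_space M by fact
  obtain Xk where Xk: "\<And>k. simple_function M (Xk k)" "\<And>x. x \<in> space M \<Longrightarrow> (\<lambda>k. Xk k x) \<longlonglongrightarrow> X x"
    "\<And>k x. x \<in> space M \<Longrightarrow> norm (Xk k x) \<le> 2 * norm (X x)" "\<And>k. Xk k \<in> L2fun M"
    using L2fun_simple_approx[OF X] by blast
  obtain Yk where Yk: "\<And>k. simple_function M (Yk k)" "\<And>x. x \<in> space M \<Longrightarrow> (\<lambda>k. Yk k x) \<longlonglongrightarrow> Y x"
    "\<And>k x. x \<in> space M \<Longrightarrow> norm (Yk k x) \<le> 2 * norm (Y x)" "\<And>k. Yk k \<in> L2fun M"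
    using L2fun_simple_approx[OF Y] by blast
  define J where "J k \<omega> = (Xk k \<omega>, Yk k \<omega>)" for k \<omega>
  have J: "simple_function M (J k)" for k
    unfolding J_def by (intro simple_function_Pair Xk Yk)
  have nnk: "0 \<le> disp_form H \<alpha> M (Xk k) (Yk k) (\<lambda>\<omega>. q1 (Xk k \<omega>)) (\<lambda>\<omega>. q2 (Yk k \<omega>))" for k
  proof -
    obtain P where P: "finite (set_pmf P)" "measure_pmf P = distr M (count_space UNIV) (J k)"
      by (rule simple_function_law[OF M J])
    show ?thesis
      using nn[OF P(1), of fst snd "\<lambda>z. q1 (fst z)" "\<lambda>z. q2 (snd z)"]
      unfolding disp_form_law[OF P(2) measurable_simple_function[OF J]] by (simp add: J_def)
  qed
  define \<mu> where "\<mu> = distr M borel X"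
  define \<mu>k where "\<mu>k k = distr M borel (Xk k)" for k
  define \<nu> where "\<nu> = distr M borel Y"
  define \<nu>k where "\<nu>k k = distr M borel (Yk k)" for k
  have P2: "\<mu> \<in> P2" "\<mu>k k \<in> P2" "\<nu> \<in> P2" "\<nu>k k \<in> P2" for k
    using distr_in_P2[OF M] X Xk(4) Y Yk(4) by (auto simp: \<mu>_def \<mu>k_def \<nu>_def \<nu>k_def)
  have W: "(\<lambda>k. W2 \<mu> (\<mu>k k)) \<longlonglongrightarrow> 0" "(\<lambda>k. W2 \<nu> (\<nu>k k)) \<longlonglongrightarrow> 0"
    unfolding \<mu>_def \<mu>k_def \<nu>_def \<nu>k_def
    using W2_tendsto_0_dominated[OF M X _ Xk(2,3)] W2_tendsto_0_dominated[OF M Y _ Yk(2,3)] Xk(4) Yk(4)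
    by (auto simp: L2fun_def)
  have qlim: "(\<lambda>k. q1 (Xk k x)) \<longlonglongrightarrow> q1 (X x)" "(\<lambda>k. q2 (Yk k x)) \<longlonglongrightarrow> q2 (Y x)" if "x \<in> space M" for x
    using Xk(2)[OF that] Yk(2)[OF that] q1 q2 by (auto intro: continuous_on_tendsto_compose)
  \<comment> \<open>Convergence of the gradients at the origin supplies a growth constant uniform in
    \<open>k\<close>.\<close>
  have "(\<lambda>k. G 0 (\<mu>k k)) \<longlonglongrightarrow> G 0 \<mu>" "(\<lambda>k. G 0 (\<nu>k k)) \<longlonglongrightarrow> G 0 \<nu>"
    using jointly_continuous_tendsto[OF jointly_continuous_G tendsto_const W(1) P2(1,2)]
      jointly_continuous_tendsto[OF jointly_continuous_G tendsto_const W(2) P2(3,4)] by auto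
  then have "Bseq (\<lambda>k. G 0 (\<mu>k k))" "Bseq (\<lambda>k. G 0 (\<nu>k k))"
    by (auto intro!: convergent_imp_Bseq convergentI)
  then obtain K1 K2 where K12: "0 < K1" "\<And>k. norm (G 0 (\<mu>k k)) \<le> K1" "0 < K2" "\<And>k. norm (G 0 (\<nu>k k)) \<le> K2"
    by (metis BseqE)
  define K where "K = K1 + K2"
  have K: "0 \<le> K" "norm (G 0 (\<mu>k k)) \<le> K" "norm (G 0 (\<nu>k k)) \<le> K" for k
    using K12(1,3) K12(2)[of k] K12(4)[of k] by (auto simp: K_def)
  define di where "di k \<omega> = disp_integrand \<alpha> (G (Xk k \<omega>, q1 (Xk k \<omega>)) (\<mu>k k))
    (G (Yk k \<omega>, q2 (Yk k \<omega>)) (\<nu>k k)) (Xk k \<omega>) (Yk k \<omega>) (q1 (Xk k \<omega>)) (q2 (Yk k \<omega>))" for k \<omega>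
  define di' where "di' \<omega> = disp_integrand \<alpha> (G (X \<omega>, q1 (X \<omega>)) \<mu>)
    (G (Y \<omega>, q2 (Y \<omega>)) \<nu>) (X \<omega>) (Y \<omega>) (q1 (X \<omega>)) (q2 (Y \<omega>))" for \<omega>
  have meas: "di k \<in> borel_measurable M" for k
  proof -
    have "(\<lambda>\<omega>. (\<lambda>(x, y). disp_integrand \<alpha> (G (x, q1 x) (\<mu>k k)) (G (y, q2 y) (\<nu>k k)) x y (q1 x) (q2 y)) (J k \<omega>))
      \<in> borel_measurable M"
      by (rule measurable_compose[OF measurable_simple_function[OF J]]) simp
    then show ?thesis by (simp add: J_def di_def[abs_def])
  qed
  have lim: "(\<lambda>k. di k \<omega>) \<longlonglongrightarrow> di' \<omega>" if "\<omega> \<in> space M" for \<omega>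
    unfolding di_def di'_def disp_integrand_def
    by (intro tendsto_intros jointly_continuous_tendsto[OF jointly_continuous_G] Xk Yk qlim W P2 that)
  \<comment> \<open>Chosen so that twice \<open>norm (X \<omega>)\<close> plus the momentum bound at
    the approximation is at most \<open>D * n \<omega>\<close>; then \<open>E\<close> is the
    matching constant for the gradients.\<close>
  define D where "D = 2 + 2 * C0"
  define E where "E = K + 4 * L * D"
  have DE: "0 \<le> D" "0 \<le> E" using C0 K L by (auto simp: D_def E_def)
  define n where "n \<omega> = 1 + norm (X \<omega>) + norm (Y \<omega>)" for \<omega>
  have "(\<lambda>k. \<integral>\<omega>. di k \<omega> \<partial>M) \<longlonglongrightarrow> (\<integral>\<omega>. di' \<omega> \<partial>M)"
  proof (rule integral_dominated_convergence)
    show "di' \<in> borel_measurable M"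
      by (rule borel_measurable_LIMSEQ_metric[OF meas lim])
    show "integrable M (\<lambda>\<omega>. (2 * \<bar>\<alpha>\<bar> + 2) * (2 * E) * (2 * D) * (3 * (1 + (norm (X \<omega>))\<^sup>2 + (norm (Y \<omega>))\<^sup>2)))"
      using X Y by (simp add: L2fun_def)
    show "AE \<omega> in M. norm (di k \<omega>) \<le> (2 * \<bar>\<alpha>\<bar> + 2) * (2 * E) * (2 * D) * (3 * (1 + (norm (X \<omega>))\<^sup>2 + (norm (Y \<omega>))\<^sup>2))" for k
    proof (rule AE_I2)
      fix \<omega> assume \<omega>: "\<omega> \<in> space M"
      have C0X: "norm (q1 (Xk k \<omega>)) \<le> C0 * (1 + 2 * norm (X \<omega>))" "norm (q2 (Yk k \<omega>)) \<le> C0 * (1 + 2 * norm (Y \<omega>))"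
        using C0(2)[of "Xk k \<omega>"] C0(3)[of "Yk k \<omega>"] Xk(3)[OF \<omega>, of k] Yk(3)[OF \<omega>, of k] C0(1)
        by (smt (verit) mult_left_mono)+
      have C0n: "0 \<le> C0 * norm (X \<omega>)" "0 \<le> C0 * norm (Y \<omega>)" using C0(1) by auto
      have xq: "norm (Xk k \<omega>) + norm (q1 (Xk k \<omega>)) \<le> D * n \<omega>" "norm (Yk k \<omega>) + norm (q2 (Yk k \<omega>)) \<le> D * n \<omega>"
        using C0X C0n Xk(3)[OF \<omega>, of k] Yk(3)[OF \<omega>, of k] C0(1)
        by (auto simp: D_def n_def algebra_simps) (smt (verit) norm_ge_zero)+
      have "K \<le> K * n \<omega>" using K(1) by (simp add: n_def mult_le_cancel_left1)
      moreover have "4 * L * (norm (Xk k \<omega>) + norm (q1 (Xk k \<omega>))) \<le> 4 * L * (D * n \<omega>)"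
        "4 * L * (norm (Yk k \<omega>) + norm (q2 (Yk k \<omega>))) \<le> 4 * L * (D * n \<omega>)"
        using xq L by (auto intro!: mult_left_mono)
      moreover have "E * n \<omega> = K * n \<omega> + 4 * L * (D * n \<omega>)"
        by (simp add: E_def distrib_right)
      ultimately have Gb: "norm (G (Xk k \<omega>, q1 (Xk k \<omega>)) (\<mu>k k)) \<le> E * n \<omega>" "norm (G (Yk k \<omega>, q2 (Yk k \<omega>)) (\<nu>k k)) \<le> E * n \<omega>"
        using G_bound[OF P2(2)[of k], of "Xk k \<omega>" "q1 (Xk k \<omega>)"] G_bound[OF P2(4)[of k], of "Yk k \<omega>" "q2 (Yk k \<omega>)"]
          K(2,3)[of k]
        by linarith+
      have "norm (di k \<omega>) \<le> (2 * \<bar>\<alpha>\<bar> + 2) * (norm (G (Xk k \<omega>, q1 (Xk k \<omega>)) (\<mu>k k)) + norm (G (Yk k \<omega>, q2 (Yk k \<omega>)) (\<nu>k k)))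
        * (norm (Xk k \<omega>) + norm (Yk k \<omega>) + norm (q1 (Xk k \<omega>)) + norm (q2 (Yk k \<omega>)))"
        unfolding di_def real_norm_def by (rule disp_integrand_bound)
      also have "\<dots> \<le> (2 * \<bar>\<alpha>\<bar> + 2) * (2 * E * n \<omega>) * (2 * D * n \<omega>)"
        using Gb xq by (intro mult_mono) (auto intro!: add_nonneg_nonneg mult_nonneg_nonneg DE simp: n_def)
      also have "\<dots> = (2 * \<bar>\<alpha>\<bar> + 2) * (2 * E) * (2 * D) * (n \<omega>)\<^sup>2"
        by (simp add: power2_eq_square)
      also have "\<dots> \<le> (2 * \<bar>\<alpha>\<bar> + 2) * (2 * E) * (2 * D) * (3 * (1 + (norm (X \<omega>))\<^sup>2 + (norm (Y \<omega>))\<^sup>2))"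
      proof (rule mult_left_mono)
        have "3 * (1 + a\<^sup>2 + b\<^sup>2) - (1 + a + b)\<^sup>2 = (1 - a)\<^sup>2 + (1 - b)\<^sup>2 + (a - b)\<^sup>2" for a b :: real
          by (simp add: power2_eq_square algebra_simps)
        then show "(n \<omega>)\<^sup>2 \<le> 3 * (1 + (norm (X \<omega>))\<^sup>2 + (norm (Y \<omega>))\<^sup>2)"
          unfolding n_def by (smt (verit) zero_le_power2)
      qed (use DE in auto)
      finally show "norm (di k \<omega>) \<le> (2 * \<bar>\<alpha>\<bar> + 2) * (2 * E) * (2 * D) * (3 * (1 + (norm (X \<omega>))\<^sup>2 + (norm (Y \<omega>))\<^sup>2))" .
    qed
  qed (use meas lim in auto)
  moreover have "(\<integral>\<omega>. di k \<omega> \<partial>M) = disp_form H \<alpha> M (Xk k) (Yk k) (\<lambda>\<omega>. q1 (Xk k \<omega>)) (\<lambda>\<omega>. q2 (Yk k \<omega>))" for k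
    using P2(2,4)[of k] by (simp add: disp_form_eq \<mu>k_def \<nu>k_def di_def)
  moreover have "(\<integral>\<omega>. di' \<omega> \<partial>M) = disp_form H \<alpha> M X Y (\<lambda>\<omega>. q1 (X \<omega>)) (\<lambda>\<omega>. q2 (Y \<omega>))"
    using P2(1,3) by (simp add: disp_form_eq \<mu>_def \<nu>_def di'_def)
  ultimately have "(\<lambda>k. disp_form H \<alpha> M (Xk k) (Yk k) (\<lambda>\<omega>. q1 (Xk k \<omega>)) (\<lambda>\<omega>. q2 (Yk k \<omega>)))
    \<longlonglongrightarrow> disp_form H \<alpha> M X Y (\<lambda>\<omega>. q1 (X \<omega>)) (\<lambda>\<omega>. q2 (Y \<omega>))" by simp
  then show ?thesis
    by (rule LIMSEQ_le_const) (use nnk in auto)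
qed

section \<open>The shifted Hamiltonian and its monotonicity in the momenta of H\<close>

definition G_shift where
  "G_shift \<alpha> z \<mu> = (let g = G (fst z, snd z - \<alpha> *\<^sub>R fst z) \<mu> in (fst g - \<alpha> *\<^sub>R snd g, snd g))"

lemma GDERIV_shift:
  assumes "\<mu> \<in> P2"
  shows "GDERIV (\<lambda>z. shift_H H \<alpha> (fst z) \<mu> (snd z)) z :> G_shift \<alpha> z \<mu>"
proof -
  have "((\<lambda>z. (fst z, snd z - \<alpha> *\<^sub>R fst z)) has_derivative (\<lambda>h. (fst h, snd h - \<alpha> *\<^sub>R fst h))) (at z)"
    by (auto intro!: derivative_eq_intros)
  from has_derivative_compose[OF this GDERIV_H[OF assms, unfolded gderiv_def]]
  have "((\<lambda>z. shift_H H \<alpha> (fst z) \<mu> (snd z)) has_derivative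
    (\<lambda>h. (fst h, snd h - \<alpha> *\<^sub>R fst h) \<bullet> G (fst z, snd z - \<alpha> *\<^sub>R fst z) \<mu>)) (at z)"
    by (simp add: shift_H_def)
  moreover have "(fst h, snd h - \<alpha> *\<^sub>R fst h) \<bullet> G (fst z, snd z - \<alpha> *\<^sub>R fst z) \<mu> = h \<bullet> G_shift \<alpha> z \<mu>" for h
    by (simp add: G_shift_def Let_def inner_prod_def inner_simps)
  ultimately show ?thesis by (simp add: gderiv_def)
qed

lemma continuous_G_shift: "\<mu> \<in> P2 \<Longrightarrow> continuous_on UNIV (\<lambda>z. G_shift \<alpha> z \<mu>)"
  unfolding G_shift_def Let_def
  by (intro continuous_intros continuous_on_compose2[OF continuous_G]) auto

text \<open>The chain rule gives the smoothness clause and expresses the shifted gradients through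
  \<open>G\<close>. Joining the two integrals of the definition requires integrability of each: with
  bounded momenta and gradients of linear growth, both are inner products of square-integrable
  functions.\<close>

lemma displacement_monotone_iff:
  "displacement_monotone (shift_H H \<alpha>) \<longleftrightarrow>
    (\<forall>\<mu>\<in>P2. \<forall>\<nu>\<in>P2. \<forall>\<gamma>\<in>couplings \<mu> \<nu>. \<forall>p1\<in>bcontfun. \<forall>p2\<in>bcontfun.
      0 \<le> disp_form H \<alpha> \<gamma> fst snd (\<lambda>z. p1 (fst z) - \<alpha> *\<^sub>R fst z) (\<lambda>z. p2 (snd z) - \<alpha> *\<^sub>R snd z))"
proof -
  have C1: "\<exists>g. continuous_on UNIV g \<and> (\<forall>z. GDERIV (\<lambda>(x, p). shift_H H \<alpha> x \<mu> p) z :> g z)" if "\<mu> \<in> P2" for \<mu>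
    using GDERIV_shift[OF that] continuous_G_shift[OF that]
    by (intro exI[of _ "\<lambda>z. G_shift \<alpha> z \<mu>"]) (simp add: case_prod_unfold)
  have "- (\<integral>(x, y). (dx (shift_H H \<alpha>) x \<mu> (p1 x) - dx (shift_H H \<alpha>) y \<nu> (p2 y)) \<bullet> (x - y) \<partial>\<gamma>)
      + (\<integral>(x, y). (dp (shift_H H \<alpha>) x \<mu> (p1 x) - dp (shift_H H \<alpha>) y \<nu> (p2 y)) \<bullet> (p1 x - p2 y) \<partial>\<gamma>)
    = disp_form H \<alpha> \<gamma> fst snd (\<lambda>z. p1 (fst z) - \<alpha> *\<^sub>R fst z) (\<lambda>z. p2 (snd z) - \<alpha> *\<^sub>R snd z)"
    if \<mu>: "\<mu> \<in> P2" and \<nu>: "\<nu> \<in> P2" and \<gamma>: "\<gamma> \<in> couplings \<mu> \<nu>" and p1: "p1 \<in> bcontfun" and p2: "p2 \<in> bcontfun"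
    for \<mu> \<nu> \<gamma> and p1 p2 :: "real^'n \<Rightarrow> real^'n"
  proof -
    note cpl = couplings_L2fun[OF \<mu> \<nu> \<gamma>]
    interpret \<gamma>: prob_space \<gamma> by (rule cpl)
    have L2p: "(\<lambda>z. p (X z)) \<in> L2fun \<gamma>" if p: "p \<in> bcontfun" and X: "X \<in> L2fun \<gamma>"
      for p :: "real^'n \<Rightarrow> real^'n" and X
    proof -
      obtain B where B: "0 \<le> B" "\<And>x. norm (p x) \<le> B" using bcontfun_bounded[OF p] by blast
      have Xm: "X \<in> borel_measurable \<gamma>" using X by (simp add: L2fun_def)
      have "p \<in> borel_measurable borel"
        using p by (auto simp: bcontfun_def intro!: borel_measurable_continuous_onI)
      from measurable_compose[OF Xm this] show ?thesis
      proof (rule L2fun_dominated[OF cpl(1) X])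
        show "norm (p (X z)) \<le> B * (1 + norm (X z))" for z
          using B(1) B(2)[of "X z"] by (simp add: distrib_left add_increasing2)
      qed
    qed
    have fs: "(\<lambda>z. fst z) \<in> L2fun \<gamma>" "(\<lambda>z. snd z) \<in> L2fun \<gamma>" using cpl by auto
    note p12 = L2p[OF p1 fs(1)] L2p[OF p2 fs(2)]
    define A where "A z = G (fst z, p1 (fst z) - \<alpha> *\<^sub>R fst z) \<mu>" for z :: "(real^'n) \<times> (real^'n)"
    define B where "B z = G (snd z, p2 (snd z) - \<alpha> *\<^sub>R snd z) \<nu>" for z :: "(real^'n) \<times> (real^'n)"
    have A: "A \<in> L2fun \<gamma>" and B: "B \<in> L2fun \<gamma>"
      unfolding A_def B_def by (intro G_L2fun \<mu> \<nu> cpl fs L2fun_diff L2fun_scaleR p12)+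
    have A': "(\<lambda>z. fst (A z)) \<in> L2fun \<gamma>" "(\<lambda>z. snd (A z)) \<in> L2fun \<gamma>"
      and B': "(\<lambda>z. fst (B z)) \<in> L2fun \<gamma>" "(\<lambda>z. snd (B z)) \<in> L2fun \<gamma>"
    proof -
      have "(\<lambda>z. fst (F z)) \<in> L2fun \<gamma>" "(\<lambda>z. snd (F z)) \<in> L2fun \<gamma>" if "F \<in> L2fun \<gamma>"
        for F :: "_ \<Rightarrow> (real^'n) \<times> (real^'n)"
      proof -
        have m [measurable]: "F \<in> borel_measurable \<gamma>" using that by (simp add: L2fun_def)
        have "(\<lambda>z. fst (F z)) \<in> borel_measurable \<gamma>" "(\<lambda>z. snd (F z)) \<in> borel_measurable \<gamma>"
          by (rule measurable_compose[OF m]; rule borel_measurable_fst_snd)+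
        then show "(\<lambda>z. fst (F z)) \<in> L2fun \<gamma>" "(\<lambda>z. snd (F z)) \<in> L2fun \<gamma>"
          by (auto intro!: L2fun_dominated[OF cpl(1) that, where C=1] add_increasing norm_fst_snd_le)
      qed
      with A B show "(\<lambda>z. fst (A z)) \<in> L2fun \<gamma>" "(\<lambda>z. snd (A z)) \<in> L2fun \<gamma>"
        "(\<lambda>z. fst (B z)) \<in> L2fun \<gamma>" "(\<lambda>z. snd (B z)) \<in> L2fun \<gamma>" by auto
    qed
    have dK: "dx (shift_H H \<alpha>) (fst z) \<mu> (p1 (fst z)) = fst (A z) - \<alpha> *\<^sub>R snd (A z)"
      "dp (shift_H H \<alpha>) (fst z) \<mu> (p1 (fst z)) = snd (A z)"
      "dx (shift_H H \<alpha>) (snd z) \<nu> (p2 (snd z)) = fst (B z) - \<alpha> *\<^sub>R snd (B z)"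
      "dp (shift_H H \<alpha>) (snd z) \<nu> (p2 (snd z)) = snd (B z)" for z
      using dx_dp_of_GDERIV[where K="shift_H H \<alpha>", OF GDERIV_shift[OF \<mu>]] dx_dp_of_GDERIV[where K="shift_H H \<alpha>", OF GDERIV_shift[OF \<nu>]]
      by (simp_all add: G_shift_def Let_def A_def B_def)
    define F1 where "F1 z = ((fst (A z) - \<alpha> *\<^sub>R snd (A z)) - (fst (B z) - \<alpha> *\<^sub>R snd (B z))) \<bullet> (fst z - snd z)" for z
    define F2 where "F2 z = (snd (A z) - snd (B z)) \<bullet> (p1 (fst z) - p2 (snd z))" for z
    have int: "integrable \<gamma> F1" "integrable \<gamma> F2"
      unfolding F1_def F2_def
      by (intro L2fun_inner_integrable L2fun_diff L2fun_scaleR A' B' fs p12)+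
    have "- F1 z + F2 z = disp_integrand \<alpha> (A z) (B z) (fst z) (snd z) (p1 (fst z) - \<alpha> *\<^sub>R fst z) (p2 (snd z) - \<alpha> *\<^sub>R snd z)" for z
      by (simp add: F1_def F2_def disp_integrand_def inner_simps algebra_simps)
    moreover have "- (\<integral>z. F1 z \<partial>\<gamma>) + (\<integral>z. F2 z \<partial>\<gamma>) = (\<integral>z. - F1 z + F2 z \<partial>\<gamma>)"
      using int by simp
    ultimately show ?thesis
      using \<mu> \<nu> by (simp add: disp_form_eq cpl case_prod_unfold dK F1_def F2_def A_def[symmetric] B_def[symmetric])
  qed
  then show ?thesis
    unfolding displacement_monotone_def using C1 by auto
qed

end

section \<open>Integrability with matrix coefficients and continuity of inverses\<close>

lemma L2fun_add:
  fixes f g :: "'a \<Rightarrow> 'b::euclidean_space"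
  assumes "f \<in> L2fun M" "g \<in> L2fun M"
  shows "(\<lambda>x. f x + g x) \<in> L2fun M"
  using L2fun_diff[OF assms(1) L2fun_scaleR[OF assms(2), of "-1"]] by simp

lemma L2fun_matrix_vector_mult:
  fixes A :: "'a \<Rightarrow> real^'n^'m" and v :: "'a \<Rightarrow> real^'n"
  assumes "prob_space M" "v \<in> L2fun M" "A \<in> borel_measurable M" "\<And>x. norm (A x) \<le> L"
  shows "(\<lambda>x. A x *v v x) \<in> L2fun M"
proof (rule L2fun_dominated[OF assms(1,2)])
  show "(\<lambda>x. A x *v v x) \<in> borel_measurable M"
    using assms(2,3) by (auto simp: L2fun_def)
  show "norm (A x *v v x) \<le> L * (1 + norm (v x))" for x
  proof -
    have "0 \<le> L" using assms(4)[of x] norm_ge_zero[of "A x"] by linarith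
    have "norm (A x *v v x) \<le> norm (A x) * norm (v x)" by (rule norm_matrix_vector_mult_le)
    also have "\<dots> \<le> L * (1 + norm (v x))"
      using \<open>0 \<le> L\<close> assms(4) by (intro mult_mono) auto
    finally show ?thesis .
  qed
qed

lemma norm_matrix_inv_le:
  fixes A :: "real^'n^'n"
  assumes c: "0 < c" "\<And>w. c * (w \<bullet> w) \<le> w \<bullet> (A *v w)"
  shows "invertible A" "norm (matrix_inv A *v w) \<le> inverse c * norm w"
proof -
  have "0 < w \<bullet> (A *v w)" if "w \<noteq> 0" for w
    using c(1) c(2)[of w] that by (smt (verit) inner_gt_zero_iff mult_pos_pos)
  then show inv: "invertible A" by (rule invertible_pos_def)
  define u where "u = matrix_inv A *v w"
  have w: "w = A *v u" using matrix_inv_mult_vector[OF inv] by (simp add: u_def)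
  have "norm u * (c * norm u) \<le> norm u * norm w"
    using c(2)[of u] norm_cauchy_schwarz[of u w]
    by (simp add: w power2_norm_eq_inner[symmetric] power2_eq_square mult_ac)
  then have "c * norm u \<le> norm w" by (cases "u = 0") auto
  then show "norm (matrix_inv A *v w) \<le> inverse c * norm w"
    using c(1) by (simp add: u_def[symmetric] field_simps)
qed

text \<open>With \<open>u\<close> the limit vector, the error is the inverse of \<open>A k\<close>
  applied to \<open>w - A k *v u\<close>. Coercivity bounds these inverses uniformly by
  \<open>inverse c\<close>, and the argument tends to 0.\<close>

lemma tendsto_matrix_inv_vector:
  fixes A :: "'a \<Rightarrow> real^'n^'n"
  assumes lim: "(A \<longlongrightarrow> A') F" and c: "0 < c"
    and pos: "\<And>k w. c * (w \<bullet> w) \<le> w \<bullet> (A k *v w)" "\<And>w. c * (w \<bullet> w) \<le> w \<bullet> (A' *v w)"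
  shows "((\<lambda>k. matrix_inv (A k) *v w) \<longlongrightarrow> matrix_inv A' *v w) F"
proof -
  define u where "u = matrix_inv A' *v w"
  have u: "A' *v u = w"
    using matrix_inv_mult_vector[OF norm_matrix_inv_le(1)[OF c pos(2)]] by (simp add: u_def)
  have le: "norm (matrix_inv (A k) *v w - u) \<le> inverse c * norm (w - A k *v u)" for k
  proof -
    have "matrix_inv (A k) *v w - u = matrix_inv (A k) *v (w - A k *v u)"
      using matrix_inv_mult_vector[OF norm_matrix_inv_le(1)[OF c pos(1)]]
      by (simp add: matrix_vector_mult_diff_distrib)
    then show ?thesis using norm_matrix_inv_le(2)[OF c pos(1)] by simp
  qed
  have "((\<lambda>k. inverse c * norm (w - A k *v u)) \<longlongrightarrow> inverse c * norm (w - A' *v u)) F"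
    by (intro tendsto_intros lim)
  then have "((\<lambda>k. inverse c * norm (w - A k *v u)) \<longlongrightarrow> 0) F"
    by (simp add: u)
  then have "((\<lambda>k. matrix_inv (A k) *v w - u) \<longlongrightarrow> 0) F"
    by (rule Lim_null_comparison[rotated]) (simp add: le)
  then show ?thesis
    unfolding u_def[symmetric] by (simp add: LIM_zero_iff)
qed

lemma quad_form_pmf_cong:
  assumes fin: "finite (set_pmf P)"
    and "\<And>i. i \<in> set_pmf P \<Longrightarrow> Q i = Q' i" "\<And>i. i \<in> set_pmf P \<Longrightarrow> V i = V' i" "\<And>i. i \<in> set_pmf P \<Longrightarrow> R i = R' i"
  shows "quad_form H \<alpha> (measure_pmf P) X Q V R = quad_form H \<alpha> (measure_pmf P) X Q' V' R'"
  unfolding quad_form_def Let_def integral_pmf_finite[OF fin] using assms by simp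

lemma disp_form_pmf_cong:
  assumes fin: "finite (set_pmf P)"
    and "\<And>i. i \<in> set_pmf P \<Longrightarrow> Q i = Q' i" "\<And>i. i \<in> set_pmf P \<Longrightarrow> R i = R' i"
  shows "disp_form H \<alpha> (measure_pmf P) X Y Q R = disp_form H \<alpha> (measure_pmf P) X Y Q' R'"
  unfolding disp_form_def Let_def integral_pmf_finite[OF fin] using assms by simp

lemma measurable_of_continuous:
  "sets M = sets borel \<Longrightarrow> continuous_on UNIV f \<Longrightarrow> f \<in> borel_measurable M"
  by (subst measurable_cong_sets[of M borel]) (auto intro: borel_measurable_continuous_onI)

section \<open>From monotonicity to finitely supported quadratic forms\<close>

context regular_hamiltonian
begin

text \<open>For distinct points, both the start and, for small \<open>s\<close>, the displaced
  configuration carry their momenta as values of bounded continuous functions. Monotonicity applied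
  to the joint law of the two configurations then gives the sign needed for differentiation at
  \<open>s = 0\<close>.\<close>

lemma quad_form_nonneg_of_monotone:
  fixes P :: "'i pmf"
  assumes mono: "displacement_monotone (shift_H H \<alpha>)" and fin: "finite (set_pmf P)"
  shows "0 \<le> quad_form H \<alpha> (measure_pmf P) X Q V R"
proof (rule quad_form_nonneg_perturb[OF fin])
  fix X :: "'i \<Rightarrow> real^'n" assume inj: "inj_on X (set_pmf P)"
  have "\<forall>\<^sub>F s in at_right 0. inj_on (\<lambda>i. X i + s *\<^sub>R V i) (set_pmf P)"
    by (rule eventually_inj_on_line[OF fin]) (use inj in \<open>auto simp: inj_on_def\<close>)
  then have "\<forall>\<^sub>F s in at_right 0. 0 \<le> disp_form H \<alpha> (measure_pmf P) X (\<lambda>i. X i + s *\<^sub>R V i) Q (\<lambda>i. Q i + s *\<^sub>R R i)"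
  proof eventually_elim
    case (elim s)
    define Y where "Y i = X i + s *\<^sub>R V i" for i
    \<comment> \<open>The momenta of \<open>H\<close> are prescribed, so \<alpha> times the position
      is added back for the shifted Hamiltonian.\<close>
    obtain p1 where p1: "p1 \<in> bcontfun" "\<And>i. i \<in> set_pmf P \<Longrightarrow> p1 (X i) = Q i + \<alpha> *\<^sub>R X i"
      using bcontfun_interpolation[OF fin inj, of "\<lambda>i. Q i + \<alpha> *\<^sub>R X i"] by blast
    obtain p2 where p2: "p2 \<in> bcontfun" "\<And>i. i \<in> set_pmf P \<Longrightarrow> p2 (Y i) = Q i + s *\<^sub>R R i + \<alpha> *\<^sub>R Y i"
      using bcontfun_interpolation[OF fin elim, of "\<lambda>i. Q i + s *\<^sub>R R i + \<alpha> *\<^sub>R (X i + s *\<^sub>R V i)"]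
      unfolding Y_def by blast
    define \<mu> where "\<mu> = distr (measure_pmf P) borel X"
    define \<nu> where "\<nu> = distr (measure_pmf P) borel Y"
    define \<gamma> where "\<gamma> = distr (measure_pmf P) borel (\<lambda>i. (X i, Y i))"
    have P2: "\<mu> \<in> P2" "\<nu> \<in> P2" using fin by (auto simp: \<mu>_def \<nu>_def)
    have \<gamma>: "\<gamma> \<in> couplings \<mu> \<nu>"
      unfolding \<gamma>_def \<mu>_def \<nu>_def by (rule distr_Pair_in_couplings) (auto simp: prob_space_measure_pmf)
    note cpl = couplings_L2fun[OF P2 \<gamma>]
    have cont: "continuous_on UNIV p1" "continuous_on UNIV p2" using p1 p2 by (auto simp: bcontfun_def)
    have "0 \<le> disp_form H \<alpha> \<gamma> fst snd (\<lambda>z. p1 (fst z) - \<alpha> *\<^sub>R fst z) (\<lambda>z. p2 (snd z) - \<alpha> *\<^sub>R snd z)"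
      using mono P2 \<gamma> p1(1) p2(1) unfolding displacement_monotone_iff by blast
    also have "\<dots> = (\<integral>z. disp_integrand \<alpha> (G (fst z, p1 (fst z) - \<alpha> *\<^sub>R fst z) \<mu>)
        (G (snd z, p2 (snd z) - \<alpha> *\<^sub>R snd z) \<nu>) (fst z) (snd z) (p1 (fst z) - \<alpha> *\<^sub>R fst z) (p2 (snd z) - \<alpha> *\<^sub>R snd z) \<partial>\<gamma>)"
      using P2 by (simp add: disp_form_eq cpl)
    also have "\<dots> = (\<integral>i. disp_integrand \<alpha> (G (X i, p1 (X i) - \<alpha> *\<^sub>R X i) \<mu>)
        (G (Y i, p2 (Y i) - \<alpha> *\<^sub>R Y i) \<nu>) (X i) (Y i) (p1 (X i) - \<alpha> *\<^sub>R X i) (p2 (Y i) - \<alpha> *\<^sub>R Y i) \<partial>measure_pmf P)"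
      unfolding \<gamma>_def
    proof (subst integral_distr)
      show "(\<lambda>z. disp_integrand \<alpha> (G (fst z, p1 (fst z) - \<alpha> *\<^sub>R fst z) \<mu>)
        (G (snd z, p2 (snd z) - \<alpha> *\<^sub>R snd z) \<nu>) (fst z) (snd z) (p1 (fst z) - \<alpha> *\<^sub>R fst z) (p2 (snd z) - \<alpha> *\<^sub>R snd z))
        \<in> borel_measurable borel"
        unfolding disp_integrand_def
        by (intro borel_measurable_continuous_onI continuous_intros
            continuous_on_compose2[OF continuous_G[OF P2(1)]] continuous_on_compose2[OF continuous_G[OF P2(2)]]
            continuous_on_compose2[OF cont(1)] continuous_on_compose2[OF cont(2)]) auto
    qed simp_all
    also have "\<dots> = disp_form H \<alpha> (measure_pmf P) X Y (\<lambda>i. p1 (X i) - \<alpha> *\<^sub>R X i) (\<lambda>i. p2 (Y i) - \<alpha> *\<^sub>R Y i)"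
      using P2 by (simp add: disp_form_eq \<mu>_def \<nu>_def)
    also have "\<dots> = disp_form H \<alpha> (measure_pmf P) X Y Q (\<lambda>i. Q i + s *\<^sub>R R i)"
      by (rule disp_form_pmf_cong[OF fin]) (use p1 p2 in auto)
    finally show ?case by (simp add: Y_def[abs_def])
  qed
  then show "0 \<le> quad_form H \<alpha> (measure_pmf P) X Q V R"
    by (rule quad_form_nonneg_of_disp_form[OF fin])
qed

section \<open>Completing the square\<close>

context
  fixes \<mu> :: "(real^'n) measure" and p v :: "real^'n \<Rightarrow> real^'n" and \<alpha> :: real
  assumes \<mu>: "\<mu> \<in> P2" and p: "continuous_on UNIV p" and v: "v \<in> L2fun \<mu>"
begin

lemma prob_\<mu>: "prob_space \<mu>" and sets_\<mu>: "sets \<mu> = sets borel"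
  using \<mu> by (auto simp: P2_def)

lemma v_measurable: "v \<in> borel_measurable \<mu>"
  using v by (simp add: L2fun_def)

lemma distr_\<mu>: "distr \<mu> borel (\<lambda>x. x) = \<mu>"
  by (rule distr_id2) (simp add: sets_\<mu>)

lemma derivatives_measurable:
  shows "(\<lambda>x. dxx H x \<mu> (p x)) \<in> borel_measurable \<mu>" (is ?xx)
    and "(\<lambda>x. dxp H x \<mu> (p x)) \<in> borel_measurable \<mu>" (is ?xp)
    and "(\<lambda>x. dpp H x \<mu> (p x)) \<in> borel_measurable \<mu>" (is ?pp)
    and "(\<lambda>z. dxmu H (fst z) \<mu> (snd z) (p (fst z))) \<in> borel_measurable (\<mu> \<Otimes>\<^sub>M \<mu>)" (is ?xmu)
    and "(\<lambda>z. dpmu H (fst z) \<mu> (snd z) (p (fst z))) \<in> borel_measurable (\<mu> \<Otimes>\<^sub>M \<mu>)" (is ?pmu)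
proof -
  have *: "continuous_on UNIV (\<lambda>x. (x, p x))" by (intro continuous_intros p)
  show ?xx ?xp ?pp
    using continuous_on_compose2[OF jointly_continuous_imp_continuous[OF cont_xx \<mu>] *]
      continuous_on_compose2[OF jointly_continuous_imp_continuous[OF cont_xp \<mu>] *]
      continuous_on_compose2[OF jointly_continuous_imp_continuous[OF cont_pp \<mu>] *]
    by (auto intro!: measurable_of_continuous sets_\<mu>)
  have **: "continuous_on UNIV (\<lambda>z :: (real^'n) \<times> (real^'n). (fst z, snd z, p (fst z)))"
    by (intro continuous_intros continuous_on_compose2[OF p]) auto
  \<comment> \<open>The product of the Borel sets is the Borel structure of the product, so
    continuity of the matrices gives joint measurability.\<close>
  have s: "sets (\<mu> \<Otimes>\<^sub>M \<mu>) = sets borel"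
    by (simp add: borel_prod[symmetric] sets_\<mu> cong: sets_pair_measure_cong)
  show ?xmu ?pmu
    using continuous_on_compose2[OF jointly_continuous_imp_continuous[OF cont_xmu \<mu>] **]
      continuous_on_compose2[OF jointly_continuous_imp_continuous[OF cont_pmu \<mu>] **]
    by (auto intro!: measurable_of_continuous s)
qed

lemma derivatives_L2fun:
  assumes "u \<in> L2fun \<mu>"
  shows "(\<lambda>x. dxx H x \<mu> (p x) *v u x) \<in> L2fun \<mu>" "(\<lambda>x. dxp H x \<mu> (p x) *v u x) \<in> L2fun \<mu>"
    "(\<lambda>x. dpp H x \<mu> (p x) *v u x) \<in> L2fun \<mu>"
  using L2fun_matrix_vector_mult[OF prob_\<mu> assms derivatives_measurable(1) bnd(3)[OF \<mu>]]
    L2fun_matrix_vector_mult[OF prob_\<mu> assms derivatives_measurable(2) bnd(1)[OF \<mu>]]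
    L2fun_matrix_vector_mult[OF prob_\<mu> assms derivatives_measurable(3) bnd(2)[OF \<mu>]]
  by auto

text \<open>A bounded kernel applied to \<open>v\<close> has an inner integral bounded by
  \<open>L\<close> times the mean of \<open>norm (v y)\<close>. The product
  \<open>norm (v x) * norm (v y)\<close> dominates the double integrand, which justifies
  Fubini.\<close>

lemma inner_integral_L2fun:
  fixes D :: "real^'n \<Rightarrow> real^'n \<Rightarrow> real^'n^'n"
  assumes D: "(\<lambda>z. D (fst z) (snd z)) \<in> borel_measurable (\<mu> \<Otimes>\<^sub>M \<mu>)" and bD: "\<And>x y. norm (D x y) \<le> L"
  shows "(\<lambda>x. \<integral>y. D x y *v v y \<partial>\<mu>) \<in> L2fun \<mu>"
    and "integrable \<mu> (\<lambda>y. D x y *v v y)"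
    and "integrable (\<mu> \<Otimes>\<^sub>M \<mu>) (\<lambda>z. (D (fst z) (snd z) *v v (snd z)) \<bullet> v (fst z))"
    and "(\<integral>z. (D (fst z) (snd z) *v v (snd z)) \<bullet> v (fst z) \<partial>(\<mu> \<Otimes>\<^sub>M \<mu>)) = (\<integral>x. (\<integral>y. D x y *v v y \<partial>\<mu>) \<bullet> v x \<partial>\<mu>)"
proof -
  interpret prob_space \<mu> by (rule prob_\<mu>)
  interpret pair_sigma_finite \<mu> \<mu> ..
  note [measurable] = D v_measurable
  have nv: "integrable \<mu> (\<lambda>y. norm (v y))" by (rule L2fun_integrable_norm[OF prob_\<mu> v])
  have le: "norm (D x y *v v y) \<le> L * norm (v y)" for x y
    using norm_matrix_vector_mult_le[of "D x y" "v y"] mult_right_mono[OF bD norm_ge_zero[of "v y"], of x y] by linarith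
  have Dx: "(\<lambda>y. D x y) \<in> borel_measurable \<mu>" for x
  proof -
    have "(\<lambda>y. (x, y)) \<in> measurable \<mu> (\<mu> \<Otimes>\<^sub>M \<mu>)"
      by (rule measurable_Pair1') (simp add: sets_eq_imp_space_eq[OF sets_\<mu>])
    from measurable_compose[OF this D] show ?thesis by simp
  qed
  show int: "integrable \<mu> (\<lambda>y. D x y *v v y)" for x
  proof (rule Bochner_Integration.integrable_bound)
    show "integrable \<mu> (\<lambda>y. L * norm (v y))" using nv by simp
    show "(\<lambda>y. D x y *v v y) \<in> borel_measurable \<mu>"
      by (rule borel_measurable_matrix_vector_mult[OF Dx v_measurable])
    show "AE y in \<mu>. norm (D x y *v v y) \<le> norm (L * norm (v y))"
      using le L by (auto simp: abs_mult)
  qed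
  have prodm: "(\<lambda>z. D (fst z) (snd z) *v v (snd z)) \<in> borel_measurable (\<mu> \<Otimes>\<^sub>M \<mu>)"
    by (rule borel_measurable_matrix_vector_mult[OF D measurable_compose[OF measurable_snd v_measurable]])
  have am: "(\<lambda>x. \<integral>y. D x y *v v y \<partial>\<mu>) \<in> borel_measurable \<mu>"
    using sigma_finite_measure.borel_measurable_lebesgue_integral[OF prob_space_imp_sigma_finite[OF prob_\<mu>],
        of "\<lambda>x y. D x y *v v y" \<mu>] prodm
    by (simp add: case_prod_unfold)
  define B where "B = L * (\<integral>y. norm (v y) \<partial>\<mu>)"
  have B: "0 \<le> B" using L by (simp add: B_def)
  have bB: "norm (\<integral>y. D x y *v v y \<partial>\<mu>) \<le> B" for x
  proof -
    have "norm (\<integral>y. D x y *v v y \<partial>\<mu>) \<le> (\<integral>y. norm (D x y *v v y) \<partial>\<mu>)" by (rule integral_norm_bound)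
    also have "\<dots> \<le> (\<integral>y. L * norm (v y) \<partial>\<mu>)"
      by (rule integral_mono) (use int nv le in auto)
    finally show ?thesis by (simp add: B_def)
  qed
  show "(\<lambda>x. \<integral>y. D x y *v v y \<partial>\<mu>) \<in> L2fun \<mu>"
  proof (rule L2fun_dominated[OF prob_\<mu> v am])
    show "norm (\<integral>y. D x y *v v y \<partial>\<mu>) \<le> B * (1 + norm (v x))" for x
      using bB[of x] B by (simp add: distrib_left add_increasing2)
  qed
  have "integrable (\<mu> \<Otimes>\<^sub>M \<mu>) (\<lambda>(x, y). norm (v x) * norm (v y))"
  proof (rule Fubini_integrable)
    show "integrable \<mu> (\<lambda>x. \<integral>y. norm (case (x, y) of (x, y) \<Rightarrow> norm (v x) * norm (v y)) \<partial>\<mu>)"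
      using nv by simp
    show "AE x in \<mu>. integrable \<mu> (\<lambda>y. case (x, y) of (x, y) \<Rightarrow> norm (v x) * norm (v y))"
      using nv by simp
  qed measurable
  then have bint: "integrable (\<mu> \<Otimes>\<^sub>M \<mu>) (\<lambda>z. L * (norm (v (fst z)) * norm (v (snd z))))"
    by (simp add: case_prod_unfold)
  show int2: "integrable (\<mu> \<Otimes>\<^sub>M \<mu>) (\<lambda>z. (D (fst z) (snd z) *v v (snd z)) \<bullet> v (fst z))"
  proof (rule Bochner_Integration.integrable_bound[OF bint])
    show "(\<lambda>z. (D (fst z) (snd z) *v v (snd z)) \<bullet> v (fst z)) \<in> borel_measurable (\<mu> \<Otimes>\<^sub>M \<mu>)"
      using prodm by measurable
    have "\<bar>(D x y *v v y) \<bullet> v x\<bar> \<le> L * (norm (v x) * norm (v y))" for x y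
      using Cauchy_Schwarz_ineq2[of "D x y *v v y" "v x"] mult_right_mono[OF le[of x y] norm_ge_zero[of "v x"]]
      by (simp add: mult_ac)
    then show "AE z in \<mu> \<Otimes>\<^sub>M \<mu>. norm ((D (fst z) (snd z) *v v (snd z)) \<bullet> v (fst z)) \<le> norm (L * (norm (v (fst z)) * norm (v (snd z))))"
      using L by (auto simp: abs_mult)
  qed
  have "(\<integral>x. (\<integral>y. (D x y *v v y) \<bullet> v x \<partial>\<mu>) \<partial>\<mu>) = (\<integral>z. (D (fst z) (snd z) *v v (snd z)) \<bullet> v (fst z) \<partial>(\<mu> \<Otimes>\<^sub>M \<mu>))"
    using integral_fst[of "\<lambda>x y. (D x y *v v y) \<bullet> v x"] int2 by (simp add: case_prod_unfold)
  moreover have "(\<integral>y. (D x y *v v y) \<bullet> v x \<partial>\<mu>) = (\<integral>y. D x y *v v y \<partial>\<mu>) \<bullet> v x" for x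
    using int by simp
  ultimately show "(\<integral>z. (D (fst z) (snd z) *v v (snd z)) \<bullet> v (fst z) \<partial>(\<mu> \<Otimes>\<^sub>M \<mu>)) = (\<integral>x. (\<integral>y. D x y *v v y \<partial>\<mu>) \<bullet> v x \<partial>\<mu>)"
    by simp
qed

definition int_xmu where "int_xmu x = (\<integral>y. dxmu H x \<mu> y (p x) *v v y \<partial>\<mu>)"
definition int_pmu where "int_pmu x = (\<integral>y. dpmu H x \<mu> y (p x) *v v y \<partial>\<mu>)"
definition linear_part where "linear_part x = int_pmu x + (2 * \<alpha>) *\<^sub>R (dpp H x \<mu> (p x) *v v x)"
text \<open>The critical point in \<open>r\<close> of the coercive quadratic polynomial with
  quadratic part \<open>dpp\<close> and linear part \<open>linear_part\<close>.\<close>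

definition minimizer where "minimizer x = (-1/2) *\<^sub>R (matrix_inv (dpp H x \<mu> (p x)) *v linear_part x)"

lemma int_xmu_L2fun: "int_xmu \<in> L2fun \<mu>" and int_pmu_L2fun: "int_pmu \<in> L2fun \<mu>"
  using inner_integral_L2fun(1)[OF derivatives_measurable(4)] inner_integral_L2fun(1)[OF derivatives_measurable(5)] bnd_mu[OF \<mu>]
  by (auto simp: int_xmu_def[abs_def] int_pmu_def[abs_def])

lemma linear_part_L2fun: "linear_part \<in> L2fun \<mu>"
  unfolding linear_part_def[abs_def]
  by (intro L2fun_add L2fun_scaleR int_pmu_L2fun derivatives_L2fun v)

text \<open>Measurability is obtained by applying the inverse to each fixed basis vector, where it
  is continuous in \<open>x\<close>, and recombining with the coordinates of
  \<open>linear_part\<close>. Coercivity gives the bound \<open>inverse c\<close>.\<close>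

lemma inv_linear_part_L2fun: "(\<lambda>x. matrix_inv (dpp H x \<mu> (p x)) *v linear_part x) \<in> L2fun \<mu>"
proof (rule L2fun_dominated[OF prob_\<mu> linear_part_L2fun])
  have *: "continuous_on UNIV (\<lambda>x. (x, p x))" by (intro continuous_intros p)
  have A: "continuous_on UNIV (\<lambda>x. dpp H x \<mu> (p x))"
    using continuous_on_compose2[OF jointly_continuous_imp_continuous[OF cont_pp \<mu>] *] by auto
  have "continuous_on UNIV (\<lambda>x. matrix_inv (dpp H x \<mu> (p x)) *v w)" for w
    using A unfolding continuous_on_def
    by (auto intro!: tendsto_matrix_inv_vector[OF _ c] dpp_ge[OF \<mu>])
  then have [measurable]: "(\<lambda>x. matrix_inv (dpp H x \<mu> (p x)) *v w) \<in> borel_measurable \<mu>" for w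
    by (rule measurable_of_continuous[OF sets_\<mu>])
  have [measurable]: "linear_part \<in> borel_measurable \<mu>"
    using linear_part_L2fun by (simp add: L2fun_def)
  have "matrix_inv (dpp H x \<mu> (p x)) *v linear_part x
    = (\<Sum>b\<in>Basis. (linear_part x \<bullet> b) *\<^sub>R (matrix_inv (dpp H x \<mu> (p x)) *v b))" for x
  proof -
    have "matrix_inv (dpp H x \<mu> (p x)) *v linear_part x
      = matrix_inv (dpp H x \<mu> (p x)) *v (\<Sum>b\<in>Basis. (linear_part x \<bullet> b) *\<^sub>R b)"
      by (simp add: euclidean_representation)
    then show ?thesis
      by (simp add: linear_sum[OF matrix_vector_mul_linear] matrix_vector_mult_scaleR)
  qed
  then show "(\<lambda>x. matrix_inv (dpp H x \<mu> (p x)) *v linear_part x) \<in> borel_measurable \<mu>"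
    by simp
  show "norm (matrix_inv (dpp H x \<mu> (p x)) *v linear_part x) \<le> inverse c * (1 + norm (linear_part x))" for x
    using norm_matrix_inv_le(2)[OF c dpp_ge[OF \<mu>], of x "p x" "linear_part x"] c
    by (simp add: distrib_left add_increasing)
qed

lemma minimizer_L2fun: "minimizer \<in> L2fun \<mu>"
  unfolding minimizer_def[abs_def] by (rule L2fun_scaleR[OF inv_linear_part_L2fun])

lemma quad_form_\<mu>:
  "quad_form H \<alpha> \<mu> (\<lambda>x. x) p v r = (\<integral>x. quad_integrand H \<alpha> x \<mu> (p x) (v x) (r x) (int_xmu x) (int_pmu x) \<partial>\<mu>)"
  by (simp add: quad_form_def Let_def distr_\<mu> int_xmu_def int_pmu_def)

lemma quad_integrand_integrable:
  assumes r: "r \<in> L2fun \<mu>"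
  shows "integrable \<mu> (\<lambda>x. quad_integrand H \<alpha> x \<mu> (p x) (v x) (r x) (int_xmu x) (int_pmu x))"
  unfolding quad_integrand_def matrix_vector_mult_diff_rdistrib scaleR_matrix_vector_assoc[symmetric]
  by (intro Bochner_Integration.integrable_add Bochner_Integration.integrable_minus L2fun_inner_integrable
      L2fun_add L2fun_diff L2fun_scaleR derivatives_L2fun v r int_xmu_L2fun int_pmu_L2fun)

text \<open>With \<open>B = A *v u\<close>, the square centred at \<open>- u / 2\<close> equals
  \<open>(A *v r + B) \<bullet> r\<close> plus a quarter of \<open>B \<bullet> u\<close>, and
  \<open>B \<bullet> u\<close> is the squared norm with the inverse square root.\<close>

lemma quad_integrand_complete_square:
  "quad_integrand H \<alpha> x \<mu> (p x) (v x) r (int_xmu x) (int_pmu x)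
    = - (((dxx H x \<mu> (p x) - (2 * \<alpha>) *\<^sub>R dxp H x \<mu> (p x)) *v v x) \<bullet> v x)
      - (int_xmu x - (2 * \<alpha>) *\<^sub>R int_pmu x) \<bullet> v x
      - 1/4 * (norm (matrix_inv_sqrt (dpp H x \<mu> (p x)) *v linear_part x))\<^sup>2
      + (r - minimizer x) \<bullet> (dpp H x \<mu> (p x) *v (r - minimizer x))"
proof -
  define A where "A = dpp H x \<mu> (p x)"
  define B where "B = linear_part x"
  define u where "u = matrix_inv A *v B"
  have A: "transpose A = A" "\<And>w. c * (w \<bullet> w) \<le> w \<bullet> (A *v w)"
    unfolding A_def by (rule dpp_symmetric[OF \<mu>]) (rule dpp_ge[OF \<mu>])
  have B: "B = A *v u"
    using matrix_inv_mult_vector[OF norm_matrix_inv_le(1)[OF c A(2)]] by (simp add: u_def)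
  have nrm: "(norm (matrix_inv_sqrt A *v B))\<^sup>2 = B \<bullet> u"
    unfolding u_def by (rule norm_matrix_inv_sqrt[OF A(1) c A(2)])
  have min: "minimizer x = (-1/2) *\<^sub>R u" by (simp add: minimizer_def A_def B_def u_def)
  have sym: "(A *v w) \<bullet> z = w \<bullet> (A *v z)" for w z
    by (simp only: inner_matrix_vector_transpose A(1))
  have min': "r - minimizer x = r + (1/2) *\<^sub>R u" by (simp add: min)
  have "(r - minimizer x) \<bullet> (A *v (r - minimizer x))
      = r \<bullet> (A *v r) + 1/2 * (r \<bullet> (A *v u)) + 1/2 * (u \<bullet> (A *v r)) + 1/4 * (u \<bullet> (A *v u))"
    unfolding min' by (simp add: matrix_vector_right_distrib matrix_vector_mult_scaleR inner_simps)
  also have "u \<bullet> (A *v r) = r \<bullet> (A *v u)" using sym[of r u] by (simp add: inner_commute)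
  finally have "(r - minimizer x) \<bullet> (A *v (r - minimizer x)) = (A *v r + B) \<bullet> r + 1/4 * (B \<bullet> u)"
    by (simp add: B inner_add_left inner_add_right inner_commute)
  then show ?thesis
    unfolding quad_integrand_def nrm[unfolded A_def B_def] A_def[symmetric]
    by (simp add: B_def[unfolded linear_part_def A_def[symmetric], symmetric] linear_part_def[of x, folded A_def]
        inner_simps nrm add.assoc)
qed

lemma quad_form_minimizer_le:
  assumes r: "r \<in> L2fun \<mu>"
  shows "quad_form H \<alpha> \<mu> (\<lambda>x. x) p v minimizer \<le> quad_form H \<alpha> \<mu> (\<lambda>x. x) p v r"
  unfolding quad_form_\<mu>
proof (rule integral_mono[OF quad_integrand_integrable[OF minimizer_L2fun] quad_integrand_integrable[OF r]])
  fix x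
  have "0 \<le> c * ((r x - minimizer x) \<bullet> (r x - minimizer x))" using c by simp
  also have "\<dots> \<le> (r x - minimizer x) \<bullet> (dpp H x \<mu> (p x) *v (r x - minimizer x))" by (rule dpp_ge[OF \<mu>])
  finally show "quad_integrand H \<alpha> x \<mu> (p x) (v x) (minimizer x) (int_xmu x) (int_pmu x)
    \<le> quad_integrand H \<alpha> x \<mu> (p x) (v x) (r x) (int_xmu x) (int_pmu x)"
    unfolding quad_integrand_complete_square by simp
qed

text \<open>At the minimizer the square vanishes. What remains is split into integrals of integrable
  functions, and Fubini matches the term over the product measure with the iterated integrals
  \<open>int_xmu\<close> and \<open>int_pmu\<close>.\<close>

lemma quad_form_minimizer:
  "(\<integral>x. ((dxx H x \<mu> (p x) - (2 * \<alpha>) *\<^sub>R dxp H x \<mu> (p x)) *v v x) \<bullet> v x \<partial>\<mu>)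
      + (\<integral>(x, y). ((dxmu H x \<mu> y (p x) - (2 * \<alpha>) *\<^sub>R dpmu H x \<mu> y (p x)) *v v y) \<bullet> v x \<partial>(\<mu> \<Otimes>\<^sub>M \<mu>))
      + 1 / 4 * (\<integral>x. (norm (matrix_inv_sqrt (dpp H x \<mu> (p x)) *v
            ((\<integral>y. dpmu H x \<mu> y (p x) *v v y \<partial>\<mu>) + (2 * \<alpha>) *\<^sub>R (dpp H x \<mu> (p x) *v v x))))\<^sup>2 \<partial>\<mu>)
    = - quad_form H \<alpha> \<mu> (\<lambda>x. x) p v minimizer"
proof -
  define j1 where "j1 x = ((dxx H x \<mu> (p x) - (2 * \<alpha>) *\<^sub>R dxp H x \<mu> (p x)) *v v x) \<bullet> v x" for x
  define j2 where "j2 x = (int_xmu x - (2 * \<alpha>) *\<^sub>R int_pmu x) \<bullet> v x" for x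
  define j3 where "j3 x = (norm (matrix_inv_sqrt (dpp H x \<mu> (p x)) *v linear_part x))\<^sup>2" for x
  have int1: "integrable \<mu> j1"
    unfolding j1_def matrix_vector_mult_diff_rdistrib scaleR_matrix_vector_assoc[symmetric]
    by (intro L2fun_inner_integrable L2fun_diff L2fun_scaleR derivatives_L2fun v)
  have int2: "integrable \<mu> j2"
    unfolding j2_def
    by (intro L2fun_inner_integrable L2fun_diff L2fun_scaleR v int_xmu_L2fun int_pmu_L2fun)
  have "j3 = (\<lambda>x. linear_part x \<bullet> (matrix_inv (dpp H x \<mu> (p x)) *v linear_part x))"
    unfolding j3_def by (intro ext norm_matrix_inv_sqrt[OF dpp_symmetric[OF \<mu>] c dpp_ge[OF \<mu>]])
  then have int3: "integrable \<mu> j3"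
    using L2fun_inner_integrable[OF linear_part_L2fun inv_linear_part_L2fun] by (simp only:)
  have "quad_form H \<alpha> \<mu> (\<lambda>x. x) p v minimizer = (\<integral>x. - j1 x - j2 x - 1/4 * j3 x \<partial>\<mu>)"
    unfolding quad_form_\<mu> quad_integrand_complete_square by (simp add: j1_def j2_def j3_def)
  also have "\<dots> = - (\<integral>x. j1 x \<partial>\<mu>) - (\<integral>x. j2 x \<partial>\<mu>) - 1/4 * (\<integral>x. j3 x \<partial>\<mu>)"
    using int1 int2 int3 by simp
  finally have q: "- quad_form H \<alpha> \<mu> (\<lambda>x. x) p v minimizer = (\<integral>x. j1 x \<partial>\<mu>) + (\<integral>x. j2 x \<partial>\<mu>) + 1/4 * (\<integral>x. j3 x \<partial>\<mu>)"
    by simp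
  define fx where "fx z = (dxmu H (fst z) \<mu> (snd z) (p (fst z)) *v v (snd z)) \<bullet> v (fst z)" for z
  define fp where "fp z = (dpmu H (fst z) \<mu> (snd z) (p (fst z)) *v v (snd z)) \<bullet> v (fst z)" for z
  note X = inner_integral_L2fun(3,4)[OF derivatives_measurable(4) bnd_mu(2)[OF \<mu>]]
  note P = inner_integral_L2fun(3,4)[OF derivatives_measurable(5) bnd_mu(1)[OF \<mu>]]
  have "(\<integral>(x, y). ((dxmu H x \<mu> y (p x) - (2 * \<alpha>) *\<^sub>R dpmu H x \<mu> y (p x)) *v v y) \<bullet> v x \<partial>(\<mu> \<Otimes>\<^sub>M \<mu>))
    = (\<integral>z. fx z - (2 * \<alpha>) * fp z \<partial>(\<mu> \<Otimes>\<^sub>M \<mu>))"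
    by (simp add: case_prod_unfold fx_def fp_def matrix_vector_mult_diff_rdistrib
        scaleR_matrix_vector_assoc[symmetric] inner_simps)
  also have "\<dots> = (\<integral>z. fx z \<partial>(\<mu> \<Otimes>\<^sub>M \<mu>)) - (2 * \<alpha>) * (\<integral>z. fp z \<partial>(\<mu> \<Otimes>\<^sub>M \<mu>))"
    using X(1) P(1) by (simp add: fx_def fp_def)
  also have "\<dots> = (\<integral>x. int_xmu x \<bullet> v x \<partial>\<mu>) - (2 * \<alpha>) * (\<integral>x. int_pmu x \<bullet> v x \<partial>\<mu>)"
    using X(2) P(2) by (simp add: fx_def fp_def int_xmu_def int_pmu_def)
  also have "\<dots> = (\<integral>x. j2 x \<partial>\<mu>)"
    using L2fun_inner_integrable[OF int_xmu_L2fun v] L2fun_inner_integrable[OF int_pmu_L2fun v]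
    by (simp add: j2_def inner_simps)
  finally show ?thesis
    unfolding q by (simp add: j1_def[abs_def] j3_def[abs_def] linear_part_def int_pmu_def)
qed

end

end

section \<open>Equivalence with nonnegativity at the minimizer\<close>

context regular_hamiltonian
begin

text \<open>On distinct points \<open>Q\<close>, \<open>V\<close>, \<open>R\<close> are values of
  functions of position. The form in the interpolated direction \<open>r\<close> is then at least
  its value at the minimizer for the same \<open>p\<close> and \<open>v\<close>.\<close>

lemma quad_form_nonneg_of_minimizer:
  fixes P :: "'i pmf"
  assumes ineq: "\<And>\<mu> p v. \<mu> \<in> P2 \<Longrightarrow> continuous_on UNIV p \<Longrightarrow> v \<in> L2fun \<mu> \<Longrightarrow>
      0 \<le> quad_form H \<alpha> \<mu> (\<lambda>x. x) p v (minimizer \<mu> p v \<alpha>)"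
    and fin: "finite (set_pmf P)"
  shows "0 \<le> quad_form H \<alpha> (measure_pmf P) X Q V R"
proof (rule quad_form_nonneg_perturb[OF fin])
  fix X :: "'i \<Rightarrow> real^'n" assume inj: "inj_on X (set_pmf P)"
  define \<mu> where "\<mu> = distr (measure_pmf P) borel X"
  have \<mu>: "\<mu> \<in> P2" using fin by (simp add: \<mu>_def)
  have sets_\<mu>: "sets \<mu> = sets borel" by (simp add: \<mu>_def)
  have interpolate: "\<exists>f. continuous_on UNIV f \<and> f \<in> L2fun \<mu> \<and> (\<forall>i\<in>set_pmf P. f (X i) = Y i)"
    for Y :: "'i \<Rightarrow> real^'n"
  proof -
    obtain f where f: "f \<in> bcontfun" "\<And>i. i \<in> set_pmf P \<Longrightarrow> f (X i) = Y i"
      using bcontfun_interpolation[OF fin inj, of Y] by blast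
    have c: "continuous_on UNIV f" using f by (simp add: bcontfun_def)
    have "integrable \<mu> (\<lambda>x. (norm (f x))\<^sup>2)"
      unfolding \<mu>_def
      by (subst integrable_distr_eq)
        (auto intro!: integrable_measure_pmf_finite[OF fin] borel_measurable_continuous_onI continuous_intros c)
    then show ?thesis
      using f c measurable_of_continuous[OF sets_\<mu> c] by (auto simp: L2fun_def)
  qed
  obtain p where p: "continuous_on UNIV p" "\<And>i. i \<in> set_pmf P \<Longrightarrow> p (X i) = Q i"
    using interpolate[of Q] by blast
  obtain v where v: "v \<in> L2fun \<mu>" "\<And>i. i \<in> set_pmf P \<Longrightarrow> v (X i) = V i"
    using interpolate[of V] by blast
  obtain r where r: "r \<in> L2fun \<mu>" "\<And>i. i \<in> set_pmf P \<Longrightarrow> r (X i) = R i"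
    using interpolate[of R] by blast
  note M = derivatives_measurable(4,5)[OF \<mu> p(1) v(1)]
  \<comment> \<open>Integrability is assumed because it supplies the Borel measurability needed to
    change variables.\<close>
  have pull: "(\<integral>x. f x \<partial>\<mu>) = (\<integral>i. f (X i) \<partial>measure_pmf P)"
    if "integrable \<mu> f" for f :: "real^'n \<Rightarrow> 'b::{banach, second_countable_topology}"
  proof -
    have "f \<in> borel_measurable borel"
      using borel_measurable_integrable[OF that] by (simp add: \<mu>_def)
    then show ?thesis unfolding \<mu>_def by (intro integral_distr) auto
  qed
  have "0 \<le> quad_form H \<alpha> \<mu> (\<lambda>x. x) p v (minimizer \<mu> p v \<alpha>)"
    by (rule ineq[OF \<mu> p(1) v(1)])
  also have "\<dots> \<le> quad_form H \<alpha> \<mu> (\<lambda>x. x) p v r"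
    by (rule quad_form_minimizer_le[OF \<mu> p(1) v(1) r(1)])
  also have "\<dots> = (\<integral>i. quad_integrand H \<alpha> (X i) \<mu> (p (X i)) (v (X i)) (r (X i))
      (int_xmu \<mu> p v (X i)) (int_pmu \<mu> p v (X i)) \<partial>measure_pmf P)"
    unfolding quad_form_\<mu>[OF \<mu> p(1) v(1)]
    by (rule pull[OF quad_integrand_integrable[OF \<mu> p(1) v(1) r(1)]])
  also have "\<dots> = quad_form H \<alpha> (measure_pmf P) X (\<lambda>i. p (X i)) (\<lambda>i. v (X i)) (\<lambda>i. r (X i))"
    unfolding quad_form_def Let_def \<mu>_def[symmetric] int_xmu_def[OF \<mu> p(1) v(1)] int_pmu_def[OF \<mu> p(1) v(1)]
    using pull[OF inner_integral_L2fun(2)[OF \<mu> p(1) v(1) M(1) bnd_mu(2)[OF \<mu>]]]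
      pull[OF inner_integral_L2fun(2)[OF \<mu> p(1) v(1) M(2) bnd_mu(1)[OF \<mu>]]]
    by simp
  also have "\<dots> = quad_form H \<alpha> (measure_pmf P) X Q V R"
    by (rule quad_form_pmf_cong[OF fin]) (use p v r in auto)
  finally show "0 \<le> quad_form H \<alpha> (measure_pmf P) X Q V R" .
qed

text \<open>The minimizer is in general only square-integrable, so monotonicity reaches it through
  simple approximations with \<open>X\<close> the identity. Conversely, nonnegativity on finite laws
  integrates along segments and passes to couplings.\<close>

lemma displacement_monotone_iff_minimizer:
  "displacement_monotone (shift_H H \<alpha>) \<longleftrightarrow>
    (\<forall>\<mu>\<in>P2. \<forall>p v. continuous_on UNIV p \<longrightarrow> v \<in> L2fun \<mu> \<longrightarrow>
      0 \<le> quad_form H \<alpha> \<mu> (\<lambda>x. x) p v (minimizer \<mu> p v \<alpha>))"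
proof safe
  fix \<mu> :: "(real^'n) measure" and p v :: "real^'n \<Rightarrow> real^'n"
  assume mono: "displacement_monotone (shift_H H \<alpha>)"
    and \<mu>: "\<mu> \<in> P2" and p: "continuous_on UNIV p" and v: "v \<in> L2fun \<mu>"
  have "(\<lambda>x. x) \<in> L2fun \<mu>"
    using \<mu> by (auto simp: P2_def L2fun_def measurable_of_continuous)
  then show "0 \<le> quad_form H \<alpha> \<mu> (\<lambda>x. x) p v (minimizer \<mu> p v \<alpha>)"
    using quad_form_nonneg_limit[OF prob_\<mu>[OF \<mu> p v] _ v minimizer_L2fun[OF \<mu> p v] p
        quad_form_nonneg_of_monotone[OF mono]] by simp
next
  assume "\<forall>\<mu>\<in>P2. \<forall>p v. continuous_on UNIV p \<longrightarrow> v \<in> L2fun \<mu> \<longrightarrow>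
      0 \<le> quad_form H \<alpha> \<mu> (\<lambda>x. x) p v (minimizer \<mu> p v \<alpha>)"
  then have nn: "0 \<le> disp_form H \<alpha> (measure_pmf P) X Y Q R" if "finite (set_pmf P)"
    for P :: "((real^'n) \<times> (real^'n)) pmf" and X Y Q R
    using that by (intro disp_form_nonneg_of_quad_form quad_form_nonneg_of_minimizer) auto
  show "displacement_monotone (shift_H H \<alpha>)"
    unfolding displacement_monotone_iff
  proof safe
    fix \<mu> \<nu> :: "(real^'n) measure" and \<gamma> and p1 p2 :: "real^'n \<Rightarrow> real^'n"
    assume \<mu>: "\<mu> \<in> P2" and \<nu>: "\<nu> \<in> P2" and \<gamma>: "\<gamma> \<in> couplings \<mu> \<nu>"
      and p1: "p1 \<in> bcontfun" and p2: "p2 \<in> bcontfun"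
    note cpl = couplings_L2fun[OF \<mu> \<nu> \<gamma>]
    obtain B1 where B1: "0 \<le> B1" "\<And>x. norm (p1 x) \<le> B1" using bcontfun_bounded[OF p1] by blast
    obtain B2 where B2: "0 \<le> B2" "\<And>x. norm (p2 x) \<le> B2" using bcontfun_bounded[OF p2] by blast
    \<comment> \<open>\<open>B1 + B2\<close> bounds both momenta, so one growth constant serves
      both; the last summand accounts for the shift.\<close>
    define C where "C = B1 + B2 + \<bar>\<alpha>\<bar>"
    have bound: "norm (w - \<alpha> *\<^sub>R x) \<le> C * (1 + norm x)" if "norm w \<le> B1 + B2" for w x :: "real^'n"
    proof -
      have "norm (w - \<alpha> *\<^sub>R x) \<le> norm w + \<bar>\<alpha>\<bar> * norm x"
        using norm_triangle_ineq4[of w "\<alpha> *\<^sub>R x"] by simp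
      also have "\<dots> \<le> (B1 + B2) * 1 + (B1 + B2) * norm x + \<bar>\<alpha>\<bar> * 1 + \<bar>\<alpha>\<bar> * norm x"
        using that B1(1) B2(1) by (simp add: add_increasing2)
      finally show ?thesis by (simp add: C_def algebra_simps)
    qed
    show "0 \<le> disp_form H \<alpha> \<gamma> fst snd (\<lambda>z. p1 (fst z) - \<alpha> *\<^sub>R fst z) (\<lambda>z. p2 (snd z) - \<alpha> *\<^sub>R snd z)"
    proof (rule disp_form_nonneg_limit[OF cpl(1,3,4), where ?q1.0="\<lambda>x. p1 x - \<alpha> *\<^sub>R x" and ?q2.0="\<lambda>x. p2 x - \<alpha> *\<^sub>R x" and ?C0.0=C])
      show "continuous_on UNIV (\<lambda>x. p1 x - \<alpha> *\<^sub>R x)" "continuous_on UNIV (\<lambda>x. p2 x - \<alpha> *\<^sub>R x)"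
        using p1 p2 by (auto simp: bcontfun_def intro!: continuous_intros)
      show "0 \<le> C" using B1 B2 by (simp add: C_def)
      show "norm (p1 x - \<alpha> *\<^sub>R x) \<le> C * (1 + norm x)" "norm (p2 x - \<alpha> *\<^sub>R x) \<le> C * (1 + norm x)" for x
        using B1 B2 by (auto intro!: bound simp: add_increasing add_increasing2)
    qed (rule nn)
  qed
qed

end

lemma assumption_H_regular:
  "assumption_H H \<Longrightarrow> \<exists>c L. regular_hamiltonian H c L"
  unfolding assumption_H_def
  apply (elim conjE exE)
  subgoal for c0 L
    by (rule exI[of _ "inverse c0"], rule exI[of _ L], unfold_locales)
      (auto intro: jointly_uniformly_continuous_imp_continuous)
  done

theorem lemma3p6:
  fixes H :: "real^'n \<Rightarrow> (real^'n) measure \<Rightarrow> real^'n \<Rightarrow> real" and \<alpha> :: real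
  assumes "fully_C2 (\<lambda>(x, p) \<mu>. H x \<mu> p)"
    and "assumption_H H"
  shows "displacement_monotone (shift_H H \<alpha>) \<longleftrightarrow>
    (\<forall>\<mu>\<in>P2. \<forall>p v. continuous_on UNIV p \<longrightarrow> v \<in> L2fun \<mu> \<longrightarrow>
      (\<integral>x. ((dxx H x \<mu> (p x) - (2 * \<alpha>) *\<^sub>R dxp H x \<mu> (p x)) *v v x) \<bullet> v x \<partial>\<mu>)
      + (\<integral>(x, y). ((dxmu H x \<mu> y (p x) - (2 * \<alpha>) *\<^sub>R dpmu H x \<mu> y (p x)) *v v y) \<bullet> v x
            \<partial>(\<mu> \<Otimes>\<^sub>M \<mu>))
      + 1 / 4 * (\<integral>x. (norm (matrix_inv_sqrt (dpp H x \<mu> (p x)) *v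
            ((\<integral>y. dpmu H x \<mu> y (p x) *v v y \<partial>\<mu>)
              + (2 * \<alpha>) *\<^sub>R (dpp H x \<mu> (p x) *v v x))))\<^sup>2 \<partial>\<mu>)
      \<le> 0)"
proof -
  obtain c L where "regular_hamiltonian H c L"
    using assumption_H_regular[OF assms(2)] by blast
  then interpret regular_hamiltonian H c L .
  \<comment> \<open>The expression in the statement is minus the quadratic form at the
    minimizer.\<close>
  show ?thesis
    unfolding displacement_monotone_iff_minimizer
    by (intro ball_cong refl iff_allI imp_cong) (simp only: quad_form_minimizer neg_le_0_iff_le)
qed

end
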